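(* Consider the $r$-factor model $X=FB^\top+E$ with $X,E\in\mathbb{R}^{T\times N}$, $F=(f_{tl})\in\mathbb{R}^{T\times r}$, $B=(b_1,\dots,b_N)^\top=(b_{jl})\in\mathbb{R}^{N\times r}$, whose loadings have a latent group structure: there is a partition $\mathcal G(K_0)=\{\mathcal G_1,\dots,\mathcal G_{K_0}\}$ of $\{1,\dots,N\}$ with $b_i=b_{\mathcal G,k}$ for all $i\in\mathcal G_k$, $k=1,\dots,K_0$, where $K_0$ is finite. Let $\hat F,\hat B$ be the penalized PCA (PPCA) estimators with tuning parameter $\lambda>0$, and let $\hat{\mathcal G}(K_0)$ be the partition produced by the AHC algorithm applied to $\hat B$ with group number $K_0$ (all as in the context). Let $H=\Omega(F^\top\hat F/T)\Lambda_r^{-1}$, where $\Omega=B^\top D^{-1}B/N$ and $\Lambda_r$ is the diagonal matrix of the $r$ leading eigenvalues of $XD^{-1}X^\top/(NT)$, and let $$d_n=\min_{1\le k_1\ne k_2\le K_0}\ \min_{i\in\mathcal G_{k_1},\,j\in\mathcal G_{k_2}}\|H^\top(b_i-b_j)\|.$$ Suppose: (A1) For all $t\le T$, $l\le r$: $E(f_{tl})=0$, $E(f_{tl}^2)=1$, $E(f_{tl}^4)\le M$ for some constant $M>0$. Moreover $F^\top F/T=I_r$ almost surely, and $E\|v^\top F\|^2\le M$ for every $v\in\mathbb{R}^T$ with $\|v\|=1$. (A2) $|b_{jl}|\le M$ for all $j\le N$, $l\le r$. Moreover $N^{-1}B^\top B\to\Sigma_B$, with $c_1\ge\lambda_1(\Sigma_B)>\dots>\lambda_r(\Sigma_B)\ge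 c_2$ for some constants $c_1,c_2>0$. (A3) $E=P_1SP_2$, where $S=(\epsilon_{tj})_{T\times N}$ has independent entries with $E(\epsilon_{tj})=0$, $E(\epsilon_{tj}^2)=1$, $E(\epsilon_{tj}^4)\le M$, and $P_1\in\mathbb{R}^{T\times T}$, $P_2\in\mathbb{R}^{N\times N}$ are deterministic. There are positive constants $c_1,c_2$ with $c_2\le\lambda_t(P_1^\top P_1)\le c_1$ for all $t\le T$ and $c_2\le\lambda_j(P_2^\top P_2)\le c_1$ for all $j\le N$. In addition, $S$ and $F$ are independent. Suppose further that $\max\{\sqrt{N/T},\,N^{-1/2}\}=o(d_n)$, that the number of groups $K_0$ is known, and that the tuning parameter satisfies $\lambda\asymp\lambda_1^*:=N/(T\|B^*\|_F^2)$. Then $$P\big(\hat{\mathcal G}(K_0)=\mathcal G(K_0)\big)\to1\qquad\text{as }N,T\to\infty .$$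
   Context: Asymptotics are as $N,T\to\infty$; $r$ is fixed and given. Only $X$ is observed; $B$ is deterministic. $\|\cdot\|_F$ is the Frobenius norm, $\|\cdot\|$ the spectral norm (Euclidean norm for vectors), $\|\cdot\|_1$ the $\ell_1$ norm, $\lambda_j(\cdot)$ the $j$-th largest eigenvalue; $a\asymp b$ means the two quantities are of the same order up to positive constants. Partitions are compared as unordered collections of sets. Let $A$ be the $N\times N$ all-ones matrix, $\Pi_N=I_N-N^{-1}A$ and $D=I_N+\lambda\Pi_N$. PPCA estimators: $\hat F$ is $\sqrt T$ times the matrix whose columns are orthonormal eigenvectors of $XD^{-1}X^\top$ associated with its $r$ largest eigenvalues (in descending order), and $\hat B=(\hat b_1,\dots,\hat b_N)^\top=T^{-1}D^{-1}X^\top\hat F$. (Equivalently, $(\hat B,\hat F)$ minimizes $\frac1{TN}\|X-FB^\top\|_F^2+\frac{\lambda}{N}\mathrm{Tr}(B^\top\Pi_NB)$ subject to $F^\top F/T=I_r$.) $B^*=\mathrm{diag}(1,\dots,1,0)\,U^\top B$, where $D^{-1}=U\Lambda_DU^\top$ is a spectral decomposition of $D^{-1}=\frac{\lambda}{(1+\lambda)N}A+\frac1{1+\lambda}I_N$ with the last column of $U$ corresponding to the eigenvalue $1$ (eigenvector proportional to the all-ones vector); thus $\|B^*\|_F=\|\Pi_NB\|_F$. AHC (agglomerative hierarchical clustering) algorithm with group number $K$: let $\hat\Delta_{ij}=\frac1r\|\hat b_i-\hat b_j\|_1$. Start with the $N$ singleton groups. Repeatedly merge the two groups $\mathcal A,\mathcal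 B$ with the smallest complete-linkage distance $\mathcal D(\mathcal A,\mathcal B)=\max_{i\in\mathcal A,j\in\mathcal B}\hat\Delta_{ij}$, until exactly $K$ groups remain. The resulting partition is $\hat{\mathcal G}(K)$. *)

theory Defs
  imports
    "HOL-Probability.Probability"
    "HOL-Library.Landau_Symbols"
    "HOL-Library.Disjoint_Sets"
    "Jordan_Normal_Form.Matrix"
    "Jordan_Normal_Form.Char_Poly"
    "Jordan_Normal_Form.Gauss_Jordan_Elimination"
begin

no_notation inner (infix \<open>\<bullet>\<close> 70)
no_notation Finite_Cartesian_Product.vec_nth (infixl \<open>$\<close> 90)
hide_const (open) Finite_Cartesian_Product.vec Finite_Cartesian_Product.row
  Finite_Cartesian_Product.column

section \<open>Matrices\<close>

text \<open>Matrices and vectors are those of Jordan_Normal_Form, so all row, column and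
  eigenvalue indices start from 0.\<close>

text \<open>The inverse of an invertible matrix; an unspecified value for a singular one.\<close>

definition minv :: "real mat \<Rightarrow> real mat" where
  "minv A = the (mat_inverse A)"

definition fro_norm :: "real mat \<Rightarrow> real" where
  "fro_norm A = sqrt (\<Sum>i<dim_row A. \<Sum>j<dim_col A. (A $$ (i,j))\<^sup>2)"

definition euc_norm :: "real Matrix.vec \<Rightarrow> real" where
  "euc_norm v = sqrt (\<Sum>i<dim_vec v. (v $ i)\<^sup>2)"

definition l1_norm :: "real Matrix.vec \<Rightarrow> real" where
  "l1_norm v = (\<Sum>i<dim_vec v. \<bar>v $ i\<bar>)"

text \<open>The \<open>j\<close>-th largest eigenvalue, counted with algebraic multiplicity and from
  \<open>j = 0\<close>. Only used for symmetric matrices, whose characteristic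
  polynomial splits over the reals.\<close>

definition nth_eig :: "real mat \<Rightarrow> nat \<Rightarrow> real" where
  "nth_eig A j = rev (sorted_list_of_multiset (proots (char_poly A))) ! j"

section \<open>Penalized PCA\<close>

definition ones_mat :: "nat \<Rightarrow> real mat" where
  "ones_mat N = Matrix.mat N N (\<lambda>_. 1)"

definition Pi_mat :: "nat \<Rightarrow> real mat" where
  "Pi_mat N = 1\<^sub>m N - (1 / real N) \<cdot>\<^sub>m ones_mat N"

definition D_mat :: "nat \<Rightarrow> real \<Rightarrow> real mat" where
  "D_mat N lam = 1\<^sub>m N + lam \<cdot>\<^sub>m Pi_mat N"

text \<open>\<open>ppca_F N T r lam X Fhat\<close>: \<open>Fhat\<close> is \<open>sqrt T\<close> times a matrix whose columns are
  orthonormal eigenvectors of \<open>X D^{-1} X'\<close> for its \<open>r\<close> largest eigenvalues. This is a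
  relation because the eigenvectors are at best unique up to sign.\<close>

definition ppca_F ::
  "nat \<Rightarrow> nat \<Rightarrow> nat \<Rightarrow> real \<Rightarrow> real mat \<Rightarrow> real mat \<Rightarrow> bool" where
  "ppca_F N T r lam X Fhat \<longleftrightarrow>
    (let W = X * minv (D_mat N lam) * transpose_mat X in
     \<exists>Q \<in> carrier_mat T r.
       transpose_mat Q * Q = 1\<^sub>m r \<and>
       (\<forall>l<r. eigenvector W (col Q l) (nth_eig W l)) \<and>
       Fhat = sqrt (real T) \<cdot>\<^sub>m Q)"

definition ppca_B :: "nat \<Rightarrow> nat \<Rightarrow> real \<Rightarrow> real mat \<Rightarrow> real mat \<Rightarrow> real mat" where
  "ppca_B N T lam X Fhat =
    (1 / real T) \<cdot>\<^sub>m (minv (D_mat N lam) * transpose_mat X * Fhat)"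

definition Omega_mat :: "nat \<Rightarrow> real \<Rightarrow> real mat \<Rightarrow> real mat" where
  "Omega_mat N lam B = (1 / real N) \<cdot>\<^sub>m (transpose_mat B * minv (D_mat N lam) * B)"

definition Lambda_mat :: "nat \<Rightarrow> nat \<Rightarrow> nat \<Rightarrow> real \<Rightarrow> real mat \<Rightarrow> real mat" where
  "Lambda_mat N T r lam X =
    mat_diag r (nth_eig
      ((1 / (real N * real T)) \<cdot>\<^sub>m (X * minv (D_mat N lam) * transpose_mat X)))"

definition H_mat ::
  "nat \<Rightarrow> nat \<Rightarrow> nat \<Rightarrow> real \<Rightarrow> real mat \<Rightarrow> real mat \<Rightarrow> real mat \<Rightarrow> real mat \<Rightarrow> real mat" where
  "H_mat N T r lam B X F Fhat =
    Omega_mat N lam B * ((1 / real T) \<cdot>\<^sub>m (transpose_mat F * Fhat))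
      * minv (Lambda_mat N T r lam X)"

text \<open>\<open>spec_U N lam U\<close>: \<open>D^{-1} = U diag(\<delta>) U'\<close> with \<open>U\<close> orthogonal and last
  eigenvalue 1. For \<open>lam > 0\<close> that eigenvalue is simple, hence the last column of \<open>U\<close>
  is automatically proportional to the all-ones vector.\<close>

definition spec_U :: "nat \<Rightarrow> real \<Rightarrow> real mat \<Rightarrow> bool" where
  "spec_U N lam U \<longleftrightarrow>
    U \<in> carrier_mat N N \<and> transpose_mat U * U = 1\<^sub>m N \<and> U * transpose_mat U = 1\<^sub>m N \<and>
    (\<exists>\<delta>. minv (D_mat N lam) = U * mat_diag N \<delta> * transpose_mat U \<and> \<delta> (N - 1) = 1)"

definition B_star :: "nat \<Rightarrow> real mat \<Rightarrow> real mat \<Rightarrow> real mat" where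
  "B_star N U B =
    mat_diag N (\<lambda>i. if i = N - 1 then 0 else 1) * transpose_mat U * B"

section \<open>Agglomerative hierarchical clustering\<close>

definition Delta_hat :: "nat \<Rightarrow> real mat \<Rightarrow> nat \<Rightarrow> nat \<Rightarrow> real" where
  "Delta_hat r Bhat i j = (1 / real r) * l1_norm (Matrix.row Bhat i - Matrix.row Bhat j)"

definition linkage :: "(nat \<Rightarrow> nat \<Rightarrow> real) \<Rightarrow> nat set \<Rightarrow> nat set \<Rightarrow> real" where
  "linkage \<Delta> A B = Max {\<Delta> i j |i j. i \<in> A \<and> j \<in> B}"

definition ahc_step ::
  "(nat \<Rightarrow> nat \<Rightarrow> real) \<Rightarrow> nat set set \<Rightarrow> nat set set \<Rightarrow> bool" where
  "ahc_step \<Delta> P P' \<longleftrightarrow>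
    (\<exists>A\<in>P. \<exists>B\<in>P. A \<noteq> B \<and>
       (\<forall>A'\<in>P. \<forall>B'\<in>P. A' \<noteq> B' \<longrightarrow> linkage \<Delta> A B \<le> linkage \<Delta> A' B') \<and>
       P' = insert (A \<union> B) (P - {A, B}))"

text \<open>A relation rather than a function: ties between closest pairs of groups may be
  broken arbitrarily.\<close>

definition ahc :: "(nat \<Rightarrow> nat \<Rightarrow> real) \<Rightarrow> nat \<Rightarrow> nat \<Rightarrow> nat set set \<Rightarrow> bool" where
  "ahc \<Delta> N K P \<longleftrightarrow> (ahc_step \<Delta>)\<^sup>*\<^sup>* ((\<lambda>i. {i}) ` {..<N}) P \<and> card P = K"

section \<open>The grouped factor model\<close>

definition random_mat :: "'w measure \<Rightarrow> nat \<Rightarrow> nat \<Rightarrow> ('w \<Rightarrow> real mat) \<Rightarrow> bool" where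
  "random_mat M m n Z \<longleftrightarrow>
    (\<forall>\<omega>\<in>space M. Z \<omega> \<in> carrier_mat m n) \<and>
    (\<forall>i<m. \<forall>j<n. (\<lambda>\<omega>. Z \<omega> $$ (i,j)) \<in> borel_measurable M)"

text \<open>The entries as an element of a product space, to speak about independence of
  two random matrices.\<close>

definition entries :: "nat \<Rightarrow> nat \<Rightarrow> ('w \<Rightarrow> real mat) \<Rightarrow> 'w \<Rightarrow> nat \<times> nat \<Rightarrow> real" where
  "entries m n Z \<omega> = (\<lambda>p \<in> {..<m} \<times> {..<n}. Z \<omega> $$ p)"

definition indep_mats ::
  "'w measure \<Rightarrow> nat \<Rightarrow> nat \<Rightarrow> ('w \<Rightarrow> real mat) \<Rightarrow> nat \<Rightarrow> nat \<Rightarrow> ('w \<Rightarrow> real mat) \<Rightarrow> bool" where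
  "indep_mats M m n Y p q Z \<longleftrightarrow>
    prob_space.indep_var M
      (\<Pi>\<^sub>M ij \<in> {..<m} \<times> {..<n}. borel) (entries m n Y)
      (\<Pi>\<^sub>M ij \<in> {..<p} \<times> {..<q}. borel) (entries p q Z)"

text \<open>The minimal separation \<open>d_n\<close> of two groups, after rotation by \<open>H\<close>. It is the minimum of
  an empty set, hence unspecified, if there is only one group; but then
  \<open>B\<^sup>* = 0\<close> and the rate \<open>N / (T \<parallel>B\<^sup>*\<parallel>\<^sup>2)\<close> is undefined.\<close>

definition d_sep :: "nat set set \<Rightarrow> real mat \<Rightarrow> real mat \<Rightarrow> real" where
  "d_sep \<G> B H =
    Min {euc_norm (transpose_mat H *\<^sub>v (Matrix.row B i - Matrix.row B j)) |i j A A'.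
           A \<in> \<G> \<and> A' \<in> \<G> \<and> A \<noteq> A' \<and> i \<in> A \<and> j \<in> A'}"

end

theory Submission
  imports Defs
begin

text \<open>Write \<open>G = F / sqrt T\<close> and \<open>Q = Fhat / sqrt T\<close>. Up to the factor \<open>1 / (1 + lam)\<close>,
  which does not affect the clustering, the difference of two rows of the estimated loadings is
  \<open>Q\<^sup>T G (b\<^sub>i - b\<^sub>j)\<close> plus noise of size at most \<open>2 |E\<^sup>T Q| / sqrt T\<close>. The signal is
  comparable to \<open>|b\<^sub>i - b\<^sub>j|\<close>, hence at least of order \<open>d\<^sub>n\<close>, because \<open>Q\<close> and \<open>G\<close> span almost
  the same space and \<open>H\<close> is bounded. For the noise, inserting the eigenvector equation of
  \<open>X D\<^sup>-\<^sup>1 X\<^sup>T\<close> into \<open>E\<^sup>T Q\<close> bounds \<open>|E\<^sup>T Q|\<close> by \<open>|E\<^sup>T G|\<close>, \<open>|E\<^sup>T E D\<^sup>-\<^sup>1 B| / (N sqrt T)\<close> and a small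
  multiple of itself. So second moments of these Frobenius norms suffice, no sharp bound on the
  spectral norm of \<open>E\<close> is needed, and the noise is of order \<open>sqrt (N / T) + 1 / sqrt N\<close>.\<close>

section \<open>Agglomerative clustering of well separated groups\<close>

text \<open>The columns of \<open>Q\<close> depend on the noise, so no moment of
  \<open>E\<^sup>T Q\<close> can be computed directly. The eigenvector equation trades
  \<open>Q\<close> for \<open>G\<close>, which is independent of the noise, and for the
  deterministic \<open>D\<^sup>-\<^sup>1 B\<close>. What remains is
  \<open>E\<^sup>T E D\<^sup>-\<^sup>1 E\<^sup>T Q\<close>, divided by an eigenvalue of order at
  least \<open>N T\<close>. This remainder is harmless because the Frobenius norm of
  \<open>E\<^sup>T E\<close> is of order \<open>N sqrt T + T sqrt N\<close>; the squared Frobenius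
  norm of \<open>E\<close> would only give the order \<open>N T\<close>. The same comparison puts
  every column of \<open>Q\<close> close to the column space of \<open>G\<close>; columns are never
  matched one by one, only the two spaces are compared. Randomness enters through three Frobenius
  norms, each controlled by Markov's inequality with failure probability \<open>1 / K\<close>,
  through a null set where the factors are not orthonormal, and through the event that the rate is
  at most a small multiple of the random separation. On the intersection of these events the
  argument is deterministic.\<close>

definition refines_part :: "'a set set \<Rightarrow> 'a set set \<Rightarrow> bool" where
  "refines_part P Q \<longleftrightarrow> (\<forall>A\<in>P. \<exists>C\<in>Q. A \<subseteq> C)"

lemma linkage_ge:
  assumes "finite A" "finite B" "i \<in> A" "j \<in> B"
  shows "\<Delta> i j \<le> linkage \<Delta> A B"
proof -
  have "{\<Delta> i j |i j. i \<in> A \<and> j \<in> B} = (\<lambda>(i,j). \<Delta> i j) ` (A \<times> B)" by auto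
  then show ?thesis unfolding linkage_def using assms by (intro Max_ge) auto
qed

lemma linkage_attained:
  assumes "finite A" "finite B" "A \<noteq> {}" "B \<noteq> {}"
  shows "\<exists>i\<in>A. \<exists>j\<in>B. linkage \<Delta> A B = \<Delta> i j"
proof -
  have eq: "{\<Delta> i j |i j. i \<in> A \<and> j \<in> B} = (\<lambda>(i,j). \<Delta> i j) ` (A \<times> B)" by auto
  have "linkage \<Delta> A B \<in> (\<lambda>(i,j). \<Delta> i j) ` (A \<times> B)"
    unfolding linkage_def eq using assms by (intro Max_in) auto
  then show ?thesis by auto
qed

lemma partition_on_merge:
  assumes P: "partition_on S P" and A: "A \<in> P" and B: "B \<in> P"
  shows "partition_on S (insert (A \<union> B) (P - {A, B}))"
proof (rule partition_onI)
  show "\<Union> (insert (A \<union> B) (P - {A, B})) = S"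
    using partition_onD1[OF P] A B by auto
  show "{} \<notin> insert (A \<union> B) (P - {A, B})"
    using partition_onD3[OF P] A by auto
  fix p p' assume pp: "p \<in> insert (A \<union> B) (P - {A, B})" "p' \<in> insert (A \<union> B) (P - {A, B})"
    and ne: "p \<noteq> p'"
  have dj: "\<And>x y. x \<in> P \<Longrightarrow> y \<in> P \<Longrightarrow> x \<noteq> y \<Longrightarrow> x \<inter> y = {}"
    using partition_onD2[OF P] by (auto simp: disjoint_def)
  have off: "q \<inter> (A \<union> B) = {}" if "q \<in> P - {A, B}" for q
    using that dj[of q A] dj[of q B] A B by (simp add: Int_Un_distrib)
  have "p \<inter> p' = {}"
  proof (cases "p = A \<union> B \<or> p' = A \<union> B")
    case True
    then show ?thesis using pp ne off by (metis Int_commute insertE)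
  next
    case False
    then have "p \<in> P" "p' \<in> P" using pp by simp_all
    then show ?thesis using dj ne by simp
  qed
  then show "disjnt p p'" by (simp add: disjnt_def)
qed

lemma card_merge:
  assumes P: "partition_on S P" and fin: "finite P" and A: "A \<in> P" and B: "B \<in> P" and ne: "A \<noteq> B"
  shows "Suc (card (insert (A \<union> B) (P - {A, B}))) = card P"
proof -
  have dj: "\<And>x y. x \<in> P \<Longrightarrow> y \<in> P \<Longrightarrow> x \<noteq> y \<Longrightarrow> x \<inter> y = {}"
    using partition_onD2[OF P] by (auto simp: disjoint_def)
  have ne0: "A \<noteq> {}" "B \<noteq> {}" using partition_onD3[OF P] A B by auto
  \<comment> \<open>Were the union already a block, the merge would lose two blocks instead of
    one.\<close>
  have "A \<union> B \<notin> P"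
  proof
    assume u: "A \<union> B \<in> P"
    have "A \<union> B = A" using dj[OF u A] ne0 by auto
    moreover have "A \<union> B = B" using dj[OF u B] ne0 by auto
    ultimately show False using ne by simp
  qed
  then have "card (insert (A \<union> B) (P - {A, B})) = Suc (card (P - {A,B}))" using fin by simp
  moreover have "card (P - {A,B}) + card {A,B} = card P"
    using A B fin by (metis Diff_subset card_Diff_subset empty_subsetI finite.emptyI finite_insert insert_subset le_add_diff_inverse2 card_mono)
  ultimately show ?thesis using ne by simp
qed

text \<open>Sending each block of \<open>P\<close> to the block of \<open>Q\<close> around it is
  onto, because the blocks of \<open>P\<close> cover every point. By the cardinalities it is also
  injective, so a block of \<open>Q\<close> cannot contain points of two blocks of
  \<open>P\<close>.\<close>

lemma refines_card_eq:
  assumes P: "partition_on S P" and Q: "partition_on S Q" and fin: "finite P"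
    and ref: "refines_part P Q" and card: "card P \<le> card Q"
  shows "P = Q"
proof -
  have djQ: "\<And>x y. x \<in> Q \<Longrightarrow> y \<in> Q \<Longrightarrow> x \<noteq> y \<Longrightarrow> x \<inter> y = {}"
    using partition_onD2[OF Q] by (auto simp: disjoint_def)
  obtain f where f: "\<And>A. A \<in> P \<Longrightarrow> f A \<in> Q \<and> A \<subseteq> f A"
    using ref unfolding refines_part_def by metis
  have surj: "C \<in> f ` P" if C: "C \<in> Q" for C
  proof -
    obtain x where x: "x \<in> C" using partition_onD3[OF Q] C by fastforce
    then have "x \<in> \<Union>P" using partition_onD1[OF P] partition_onD1[OF Q] C by auto
    then obtain A where A: "A \<in> P" "x \<in> A" by auto
    then have "f A = C" using f djQ[of "f A" C] C x by auto
    then show ?thesis using A by auto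
  qed
  then have im: "f ` P = Q" using f by auto
  then have inj: "inj_on f P" using card fin by (metis card_image_le eq_card_imp_inj_on le_antisym)
  have fA: "f A = A" if A: "A \<in> P" for A
  proof
    show "A \<subseteq> f A" using f A by auto
    show "f A \<subseteq> A"
    proof
      fix x assume x: "x \<in> f A"
      have "x \<in> \<Union>P" using x f[OF A] partition_onD1[OF P] partition_onD1[OF Q] by auto
      then obtain A' where A': "A' \<in> P" "x \<in> A'" by auto
      then have "f A' = f A" using f[OF A'(1)] f[OF A] djQ[of "f A'" "f A"] x by auto
      then have "A' = A" using inj A A' by (auto dest: inj_onD)
      then show "x \<in> A" using A' by simp
    qed
  qed
  then have "f ` P = P" by force
  then show ?thesis using im by simp
qed

text \<open>Invariant: while at least \<open>K\<close> groups remain, the current partition refines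
  the true one. If more than \<open>K\<close> groups are present, two of them lie in the same true
  group, and their linkage is a within-group distance. A pair from different true groups has larger
  linkage and so is not a closest pair. Since the separation is strict, ties cannot hurt. A
  refinement with exactly \<open>K\<close> blocks is the true partition.\<close>

theorem ahc_eq_groups:
  assumes part: "partition_on {..<N} \<G>" and card: "card \<G> = K" and ahc: "ahc \<Delta> N K P"
    and sep: "\<And>A A' C i j k l. A \<in> \<G> \<Longrightarrow> A' \<in> \<G> \<Longrightarrow> C \<in> \<G> \<Longrightarrow> A \<noteq> A' \<Longrightarrow> i \<in> C \<Longrightarrow> j \<in> C \<Longrightarrow>
      k \<in> A \<Longrightarrow> l \<in> A' \<Longrightarrow> \<Delta> i j < \<Delta> k l"
  shows "P = \<G>"
proof -
  let ?P0 = "(\<lambda>i. {i}) ` {..<N}"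
  have finG: "finite \<G>" using finite_elements[OF _ part] by simp
  have "partition_on {..<N} R \<and> finite R \<and> (K \<le> card R \<longrightarrow> refines_part R \<G>)"
    if "(ahc_step \<Delta>)\<^sup>*\<^sup>* ?P0 R" for R
    using that
  proof (induction rule: rtranclp_induct)
    case base
    have "partition_on {..<N} ?P0" by (rule partition_onI) auto
    moreover have "refines_part ?P0 \<G>" unfolding refines_part_def using partition_onD1[OF part] by blast
    ultimately show ?case by simp
  next
    case (step R R')
    then have R: "partition_on {..<N} R" and fin: "finite R"
      and IH: "K \<le> card R \<Longrightarrow> refines_part R \<G>" by auto
    from step(2) obtain A B where A: "A \<in> R" and B: "B \<in> R" and AB: "A \<noteq> B"
      and mn: "\<And>A' B'. A'\<in>R \<Longrightarrow> B'\<in>R \<Longrightarrow> A' \<noteq> B' \<Longrightarrow> linkage \<Delta> A B \<le> linkage \<Delta> A' B'"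
      and R': "R' = insert (A \<union> B) (R - {A, B})" unfolding ahc_step_def by blast
    have finel: "finite A'" "A' \<noteq> {}" if "A' \<in> R" for A'
    proof -
      have "A' \<subseteq> {..<N}" using that partition_onD1[OF R] by blast
      then show "finite A'" by (rule finite_subset) simp
      show "A' \<noteq> {}" using that partition_onD3[OF R] by blast
    qed
    \<comment> \<open>At least \<open>K\<close> groups after the merge means more than
      \<open>K\<close> before it, which is what the pigeonhole argument uses.\<close>
    have "refines_part R' \<G>" if "K \<le> card R'"
    proof -
      have cR: "K < card R" using card_merge[OF R fin A B AB] that unfolding R' by simp
      then have ref: "refines_part R \<G>" using IH by simp
      then obtain f where f: "\<And>A. A \<in> R \<Longrightarrow> f A \<in> \<G> \<and> A \<subseteq> f A"
        unfolding refines_part_def by metis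
      have "card (f ` R) \<le> card \<G>" using f finG by (intro card_mono) auto
      then have "card (f ` R) < card R" using cR card by simp
      then have "\<not> inj_on f R" using pigeonhole by blast
      then obtain A1 B1 where 1: "A1 \<in> R" "B1 \<in> R" "A1 \<noteq> B1" "f A1 = f B1"
        by (auto simp: inj_on_def)
      obtain i j where ij: "i \<in> A1" "j \<in> B1" "linkage \<Delta> A1 B1 = \<Delta> i j"
        using linkage_attained[of A1 B1 \<Delta>, OF finel(1)[OF 1(1)] finel(1)[OF 1(2)] finel(2)[OF 1(1)] finel(2)[OF 1(2)]] by blast
      have "f A = f B"
      proof (rule ccontr)
        assume fne: "f A \<noteq> f B"
        obtain k l where kl: "k \<in> A" "l \<in> B" using finel(2)[OF A] finel(2)[OF B] by blast
        have "\<Delta> i j < \<Delta> k l"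
        proof (rule sep[of "f A" "f B" "f A1"])
          show "f A \<in> \<G>" "f B \<in> \<G>" "f A1 \<in> \<G>" using f A B 1 by auto
          show "i \<in> f A1" using f[OF 1(1)] ij by blast
          show "j \<in> f A1" unfolding 1(4) using f[OF 1(2)] ij by blast
          show "k \<in> f A" using f[OF A] kl by blast
          show "l \<in> f B" using f[OF B] kl by blast
        qed (rule fne)
        also have "\<dots> \<le> linkage \<Delta> A B" using linkage_ge[OF finel(1)[OF A] finel(1)[OF B] kl] .
        also have "\<dots> \<le> linkage \<Delta> A1 B1" by (rule mn[OF 1(1-3)])
        finally show False using ij by simp
      qed
      then have "A \<union> B \<subseteq> f A" using f[OF A] f[OF B] by simp
      then show ?thesis using ref f[OF A] unfolding R' refines_part_def by blast
    qed
    then show ?case using partition_on_merge[OF R A B] fin unfolding R' by simp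
  qed
  then have "partition_on {..<N} P" "finite P" "refines_part P \<G>" "card P = K"
    using ahc unfolding ahc_def by auto
  then show ?thesis using refines_card_eq[OF _ part] card by simp
qed

section \<open>Norms and the spectral theorem\<close>

lemma scalar_prod_sum: "v \<bullet> w = (\<Sum>i<dim_vec w. v $ i * w $ i)"
  by (simp add: scalar_prod_def lessThan_atLeast0)

lemma mult_mat_vec_index:
  assumes "A \<in> carrier_mat m n" "x \<in> carrier_vec n" "i < m"
  shows "(A *\<^sub>v x) $ i = (\<Sum>j<n. A $$ (i,j) * x $ j)"
  using assms by (simp add: scalar_prod_sum)

lemma mult_mat_index:
  assumes "A \<in> carrier_mat m k" "B \<in> carrier_mat k n" "i < m" "j < n"
  shows "(A * B) $$ (i,j) = (\<Sum>l<k. A $$ (i,l) * B $$ (l,j))"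
  using assms by (simp add: scalar_prod_sum)

lemma euc_norm_L2: "euc_norm v = L2_set (\<lambda>i. v $ i) {..<dim_vec v}"
  by (simp add: euc_norm_def L2_set_def)

lemma fro_norm_L2: "fro_norm A = L2_set (\<lambda>p. A $$ p) ({..<dim_row A} \<times> {..<dim_col A})"
  by (simp add: fro_norm_def L2_set_def sum.cartesian_product)

lemma euc_norm_nonneg [simp]: "0 \<le> euc_norm v"
  by (simp add: euc_norm_L2)

lemma fro_norm_nonneg [simp]: "0 \<le> fro_norm A"
  by (simp add: fro_norm_L2)

lemma euc_norm_sq: "(euc_norm v)^2 = v \<bullet> v"
  by (simp add: euc_norm_def scalar_prod_sum sum_nonneg power2_eq_square)

lemma euc_norm_sq_sum: "(euc_norm v)^2 = (\<Sum>i<dim_vec v. (v $ i)^2)"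
  by (simp add: euc_norm_def sum_nonneg)

lemma fro_norm_sq: "(fro_norm A)^2 = (\<Sum>i<dim_row A. \<Sum>j<dim_col A. (A $$ (i,j))^2)"
  by (simp add: fro_norm_def sum_nonneg)

lemma fro_norm_sq_cols: "(fro_norm A)^2 = (\<Sum>j<dim_col A. (euc_norm (col A j))^2)"
  by (simp add: fro_norm_sq euc_norm_sq_sum sum.swap[of _ "{..<dim_row A}"])

lemma fro_norm_transpose [simp]: "fro_norm (A\<^sup>T) = fro_norm A"
proof -
  have "(fro_norm (A\<^sup>T))^2 = (fro_norm A)^2"
    unfolding fro_norm_sq by (simp add: sum.swap[of _ "{..<dim_row A}"])
  then show ?thesis by (simp add: power2_eq_iff_nonneg)
qed

lemma cauchy_schwarz_vec:
  assumes "dim_vec u = dim_vec v"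
  shows "\<bar>u \<bullet> v\<bar> \<le> euc_norm u * euc_norm v"
proof -
  have "\<bar>u \<bullet> v\<bar> \<le> (\<Sum>i<dim_vec v. \<bar>u $ i\<bar> * \<bar>v $ i\<bar>)"
    unfolding scalar_prod_sum by (rule order_trans[OF sum_abs]) (simp add: abs_mult)
  also have "\<dots> \<le> euc_norm u * euc_norm v"
    unfolding euc_norm_L2 assms by (rule L2_set_mult_ineq)
  finally show ?thesis .
qed

lemma euc_norm_triangle:
  assumes "dim_vec u = dim_vec v"
  shows "euc_norm (u + v) \<le> euc_norm u + euc_norm v"
  using L2_set_triangle_ineq[of "\<lambda>i. u $ i" "\<lambda>i. v $ i" "{..<dim_vec v}"] assms
  by (simp add: euc_norm_L2 L2_set_def)

lemma euc_norm_smult [simp]: "euc_norm (c \<cdot>\<^sub>v v) = \<bar>c\<bar> * euc_norm v"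
proof -
  have "(euc_norm (c \<cdot>\<^sub>v v))^2 = (\<bar>c\<bar> * euc_norm v)^2"
    by (simp add: euc_norm_sq_sum power_mult_distrib sum_distrib_left)
  then show ?thesis by (simp add: power2_eq_iff_nonneg)
qed

lemma euc_norm_minus_le:
  assumes "dim_vec u = dim_vec v"
  shows "euc_norm (u - v) \<le> euc_norm u + euc_norm v"
  using euc_norm_triangle[of u "-1 \<cdot>\<^sub>v v"] assms
    euc_norm_smult[of "-1" v] by (simp add: euc_norm_def)

text \<open>Cauchy-Schwarz in every row. The Frobenius norm stands in for the spectral norm because
  its square is a sum over entries, whose expectation can be computed.\<close>

lemma euc_norm_mult_le:
  assumes A: "A \<in> carrier_mat m n" and x: "x \<in> carrier_vec n"
  shows "euc_norm (A *\<^sub>v x) \<le> fro_norm A * euc_norm x"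
proof (rule power2_le_imp_le)
  have "(euc_norm (A *\<^sub>v x))^2 = (\<Sum>i<m. (row A i \<bullet> x)^2)"
    using A by (simp add: euc_norm_sq_sum)
  also have "\<dots> \<le> (\<Sum>i<m. (euc_norm (row A i))^2 * (euc_norm x)^2)"
  proof (rule sum_mono)
    fix i
    have "\<bar>row A i \<bullet> x\<bar>\<^sup>2 \<le> (euc_norm (row A i) * euc_norm x)^2"
      using A x by (intro power_mono cauchy_schwarz_vec) auto
    then show "(row A i \<bullet> x)^2 \<le> (euc_norm (row A i))^2 * (euc_norm x)^2"
      by (simp add: power_mult_distrib)
  qed
  also have "\<dots> = (fro_norm A * euc_norm x)^2"
    using A by (simp add: power_mult_distrib fro_norm_sq euc_norm_sq_sum[of "row _ _"] flip: sum_distrib_right)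
  finally show "(euc_norm (A *\<^sub>v x))^2 \<le> (fro_norm A * euc_norm x)^2" .
qed simp

lemma scalar_prod_adjoint:
  assumes "A \<in> carrier_mat m n" "x \<in> carrier_vec n" "y \<in> carrier_vec m"
  shows "(A *\<^sub>v x) \<bullet> y = x \<bullet> (A\<^sup>T *\<^sub>v (y :: real vec))"
  using assms transpose_vec_mult_scalar[of A m n x y]
  by (metis comm_scalar_prod mult_mat_vec_carrier transpose_carrier_mat)

lemma euc_norm_mult_sq:
  assumes A: "A \<in> carrier_mat m n" and x: "x \<in> carrier_vec n"
  shows "(euc_norm (A *\<^sub>v x))^2 = x \<bullet> ((A\<^sup>T * A) *\<^sub>v x)"
  unfolding euc_norm_sq using scalar_prod_adjoint[OF A x, of "A *\<^sub>v x"] A x by simp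

text \<open>Meant for \<open>A = E\<close>. Bounding \<open>E\<close> by its own Frobenius norm, of
  order \<open>sqrt (N T)\<close>, would leave noise as large as the signal; the Gram matrix has a
  Frobenius norm of smaller order than \<open>N T\<close>.\<close>

lemma euc_norm_mult_gram_le:
  assumes A: "A \<in> carrier_mat m n" and x: "x \<in> carrier_vec n"
  shows "(euc_norm (A *\<^sub>v x))^2 \<le> fro_norm (A\<^sup>T * A) * (euc_norm x)^2"
proof -
  let ?G = "A\<^sup>T * A"
  have G: "?G \<in> carrier_mat n n" using A by simp
  have "(euc_norm (A *\<^sub>v x))^2 \<le> euc_norm x * euc_norm (?G *\<^sub>v x)"
    unfolding euc_norm_mult_sq[OF A x]
    by (rule order_trans[OF abs_ge_self cauchy_schwarz_vec]) (use A x in simp)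
  also have "\<dots> \<le> euc_norm x * (fro_norm ?G * euc_norm x)"
    by (intro mult_left_mono euc_norm_mult_le[OF G x]) simp
  finally show ?thesis by (simp add: power2_eq_square mult_ac)
qed

section \<open>Matrices with orthonormal columns and their projections\<close>

lemma euc_norm_isometry:
  assumes Q: "Q \<in> carrier_mat m n" and x: "x \<in> carrier_vec n" and o: "Q\<^sup>T * Q = 1\<^sub>m n"
  shows "euc_norm (Q *\<^sub>v x) = euc_norm x"
proof -
  have "(euc_norm (Q *\<^sub>v x))^2 = (euc_norm x)^2"
    unfolding euc_norm_mult_sq[OF Q x] o using x by (simp add: euc_norm_sq)
  then show ?thesis by (simp add: power2_eq_iff_nonneg)
qed

lemma projection_pythagoras:
  assumes Q: "Q \<in> carrier_mat m n" and x: "x \<in> carrier_vec m" and o: "Q\<^sup>T * Q = 1\<^sub>m n"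
  shows "(euc_norm (x - Q *\<^sub>v (Q\<^sup>T *\<^sub>v x)))^2
    = (euc_norm x)^2 - (euc_norm (Q\<^sup>T *\<^sub>v x))^2"
proof -
  let ?y = "Q\<^sup>T *\<^sub>v x"
  have y: "?y \<in> carrier_vec n" and Qy: "Q *\<^sub>v ?y \<in> carrier_vec m" using Q x by auto
  have 1: "x \<bullet> (Q *\<^sub>v ?y) = ?y \<bullet> ?y"
    using transpose_vec_mult_scalar[OF Q y x] by simp
  have 2: "(Q *\<^sub>v ?y) \<bullet> x = ?y \<bullet> ?y" using 1 comm_scalar_prod[OF x Qy] by simp
  have 3: "(Q *\<^sub>v ?y) \<bullet> (Q *\<^sub>v ?y) = ?y \<bullet> ?y"
    using euc_norm_isometry[OF Q y o] by (simp flip: euc_norm_sq)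
  show ?thesis unfolding euc_norm_sq
    using x Qy 1 2 3 by (simp add: minus_scalar_prod_distrib scalar_prod_minus_distrib)
qed

lemma euc_norm_transpose_isometry_le:
  assumes Q: "Q \<in> carrier_mat m n" and x: "x \<in> carrier_vec m" and o: "Q\<^sup>T * Q = 1\<^sub>m n"
  shows "euc_norm (Q\<^sup>T *\<^sub>v x) \<le> euc_norm x"
proof (rule power2_le_imp_le)
  have "0 \<le> (euc_norm x)^2 - (euc_norm (Q\<^sup>T *\<^sub>v x))^2"
    unfolding projection_pythagoras[OF assms, symmetric] by simp
  then show "(euc_norm (Q\<^sup>T *\<^sub>v x))^2 \<le> (euc_norm x)^2" by simp
qed simp

section \<open>Diagonalization of real symmetric matrices\<close>

text \<open>Over the complex numbers the polynomial splits. For a complex eigenvector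
  \<open>v\<close> the Hermitian form \<open>s\<close> of \<open>A\<close> at \<open>v\<close>
  equals its own conjugate, and it is also the eigenvalue times the squared length of
  \<open>v\<close>; so the eigenvalue is real.\<close>

lemma symmetric_char_poly_splits:
  assumes A: "A \<in> carrier_mat n n" and sym: "A\<^sup>T = (A :: real mat)"
  shows "\<exists>es. char_poly A = (\<Prod>e\<leftarrow>es. [:- e, 1:])"
proof -
  interpret h: map_poly_inj_comm_ring_hom "of_real :: real \<Rightarrow> complex" by unfold_locales auto
  let ?C = "map_mat (of_real :: real \<Rightarrow> complex) A"
  have C: "?C \<in> carrier_mat n n" using A by simp
  obtain as where as: "char_poly ?C = (\<Prod>a\<leftarrow>as. [:- a, 1:])" using char_poly_factorized[OF C] by auto
  have symA: "A $$ (i,j) = A $$ (j,i)" if "i < n" "j < n" for i j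
    using arg_cong[OF sym, of "\<lambda>B. B $$ (i,j)"] that A by simp
  have real: "a \<in> \<real>" if a: "a \<in> set as" for a
  proof -
    have "poly (char_poly ?C) a = 0" unfolding as poly_prod_list using a
      by (auto simp: prod_list_zero_iff o_def)
    then have "eigenvalue ?C a" by (simp add: eigenvalue_root_char_poly[OF C])
    then obtain v where v: "v \<in> carrier_vec n" "v \<noteq> 0\<^sub>v n" "?C *\<^sub>v v = a \<cdot>\<^sub>v v"
      unfolding eigenvalue_def eigenvector_def using C by auto
    define s where "s = (\<Sum>i<n. \<Sum>j<n. cnj (v $ i) * (of_real (A $$ (i,j)) * v $ j))"
    have ev: "(\<Sum>j<n. of_real (A $$ (i,j)) * v $ j) = a * v $ i" if "i < n" for i
      using arg_cong[OF v(3), of "\<lambda>w. w $ i"] that A v(1) by (simp add: scalar_prod_sum)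
    have "(\<Sum>j<n. cnj (v $ i) * (of_real (A $$ (i,j)) * v $ j)) = a * of_real ((cmod (v $ i))^2)"
      if "i < n" for i
      unfolding sum_distrib_left[symmetric] ev[OF that] complex_norm_square by simp
    then have "s = a * (\<Sum>i<n. of_real ((cmod (v $ i))^2))"
      unfolding s_def sum_distrib_left[of a] by (intro sum.cong) auto
    moreover have "cnj s = s"
      unfolding s_def by (subst sum.swap) (auto simp: symA mult_ac intro!: sum.cong)
    then have "s \<in> \<real>" by (simp add: Reals_cnj_iff)
    moreover have "(\<Sum>i<n. of_real ((cmod (v $ i))^2)) \<noteq> (0 :: complex)"
    proof
      assume "(\<Sum>i<n. of_real ((cmod (v $ i))^2)) = (0 :: complex)"
      then have "(\<Sum>i<n. (cmod (v $ i))^2) = 0" by (simp flip: of_real_sum of_real_power)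
      then have "\<forall>i<n. v $ i = 0" by (subst (asm) sum_nonneg_eq_0_iff) auto
      then have "v = 0\<^sub>v n" using v(1) by (intro eq_vecI) auto
      then show False using v(2) by simp
    qed
    ultimately have "a = s / (\<Sum>i<n. of_real ((cmod (v $ i))^2))" by simp
    also have "\<dots> \<in> \<real>" using \<open>s \<in> \<real>\<close> by (intro Reals_divide sum_in_Reals) auto
    finally show ?thesis .
  qed
  have "map_poly of_real (char_poly A) = (\<Prod>a\<leftarrow>as. [:- a, 1:])"
    unfolding as[symmetric] by (rule of_real_hom.char_poly_hom[OF A, symmetric])
  also have "\<dots> = (\<Prod>a\<leftarrow>as. map_poly of_real [:- Re a, 1:])"
    using real by (intro arg_cong[where f = prod_list] map_cong) (auto simp: of_real_Re)
  also have "\<dots> = map_poly of_real (\<Prod>a\<leftarrow>as. [:- Re a, 1:])"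
    by (simp add: h.hom_prod_list o_def)
  finally have "char_poly A = (\<Prod>a\<leftarrow>as. [:- Re a, 1:])" by simp
  then have "char_poly A = (\<Prod>e\<leftarrow>map Re as. [:- e, 1:])" by (simp add: o_def)
  then show ?thesis by blast
qed

text \<open>For \<open>u = 0\<close> the quotient is \<open>0 / 0 = 0\<close> and the reflection is the identity, as needed below
  for a unit vector that already is the first basis vector.\<close>

definition householder :: "nat \<Rightarrow> real Matrix.vec \<Rightarrow> real mat" where
  "householder n u = Matrix.mat n n (\<lambda>(i,j). (if i = j then 1 else 0) - 2 * u $ i * u $ j / (u \<bullet> u))"

lemma householder_carrier [simp]: "householder n u \<in> carrier_mat n n"
  by (simp add: householder_def)

lemma transpose_householder: "(householder n u)\<^sup>T = householder n u"
  by (rule eq_matI) (auto simp: householder_def)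

lemma householder_square:
  assumes u: "u \<in> carrier_vec n"
  shows "householder n u * householder n u = 1\<^sub>m n"
proof (rule eq_matI)
  fix i j assume "i < dim_row (1\<^sub>m n)" "j < dim_col (1\<^sub>m n)"
  then have i: "i < n" and j: "j < n" by auto
  define c where "c = 2 / (u \<bullet> u)"
  have uu: "(\<Sum>k<n. u $ k * u $ k) = u \<bullet> u" using u by (simp add: scalar_prod_sum)
  have cc: "c * c * (u \<bullet> u) = 2 * c" by (simp add: c_def)
  have H: "householder n u $$ (i,j) = (if i = j then 1 else 0) - c * u $ i * u $ j" if "i < n" "j < n" for i j
    using that by (simp add: householder_def c_def)
  have "(householder n u * householder n u) $$ (i,j)
      = (\<Sum>k<n. ((if i = k then 1 else 0) - c * u $ i * u $ k) * ((if k = j then 1 else 0) - c * u $ k * u $ j))"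
    using i j by (subst mult_mat_index[of _ n n _ n]) (auto simp: H)
  also have "\<dots> = (\<Sum>k<n. (if i = k then (if k = j then 1 else 0) - c * u $ k * u $ j else 0)
      - (if k = j then c * u $ i * u $ k else 0) + c * c * u $ i * u $ j * (u $ k * u $ k))"
    by (intro sum.cong) (auto simp: algebra_simps)
  also have "\<dots> = (if i = j then 1 else 0) - 2 * c * u $ i * u $ j + (c * c * (u \<bullet> u)) * u $ i * u $ j"
    using i j by (simp add: sum.distrib sum_subtractf sum.delta' uu flip: sum_distrib_left)
  also have "\<dots> = 1\<^sub>m n $$ (i,j)" using i j unfolding cc by simp
  finally show "(householder n u * householder n u) $$ (i,j) = 1\<^sub>m n $$ (i,j)" .
qed (simp_all add: householder_def)

text \<open>The reflection that exchanges the unit vectors \<open>unit_vec n 0\<close> and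
  \<open>v\<close>; the first column is the image of the former. Since \<open>v\<close> has length
  one, \<open>u = unit_vec n 0 - v\<close> satisfies \<open>u \<bullet> u = 2 * u $ 0\<close>, so
  the correction subtracted in the first column is exactly \<open>u\<close>.\<close>

lemma householder_first_col:
  assumes v: "v \<in> carrier_vec n" and n: "0 < n" and unit: "v \<bullet> v = 1"
  shows "col (householder n (unit_vec n 0 - v)) 0 = v"
proof (rule eq_vecI)
  let ?u = "unit_vec n 0 - v"
  have u: "?u \<in> carrier_vec n" using v by simp
  have uu: "?u \<bullet> ?u = 2 * (1 - v $ 0)"
    using v n unit by (simp add: minus_scalar_prod_distrib[of _ n] scalar_prod_minus_distrib[of _ n])
  fix i assume "i < dim_vec v"
  then have i: "i < n" using v by simp
  have ui: "?u $ i = (if i = 0 then 1 else 0) - v $ i" and u0: "?u $ 0 = 1 - v $ 0"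
    using i n v by auto
  have "?u $ i = 0" if "v $ 0 = 1"
  proof -
    have "(\<Sum>k<n. (?u $ k)^2) = ?u \<bullet> ?u"
      unfolding scalar_prod_sum using carrier_vecD[OF u] by (simp add: power2_eq_square)
    then have "(\<Sum>k<n. (?u $ k)^2) = 0" unfolding uu that by simp
    then show ?thesis using i by (subst (asm) sum_nonneg_eq_0_iff) auto
  qed
  have prod: "2 * ?u $ i * ?u $ 0 = ?u $ i * (?u \<bullet> ?u)" unfolding uu u0 by simp
  have "col (householder n ?u) 0 $ i = (if i = 0 then 1 else 0) - 2 * ?u $ i * ?u $ 0 / (?u \<bullet> ?u)"
    using i n by (simp add: householder_def)
  also have "\<dots> = v $ i" unfolding prod
    using \<open>v $ 0 = 1 \<Longrightarrow> ?u $ i = 0\<close> ui uu by (cases "v $ 0 = 1") auto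
  finally show "col (householder n ?u) 0 $ i = v $ i" .
qed (use v in \<open>simp add: householder_def\<close>)

lemma length_char_poly_linear_factors:
  assumes "A \<in> carrier_mat n n" "char_poly A = (\<Prod>e\<leftarrow>es. [:- e, 1:] :: real poly)"
  shows "length es = n"
proof -
  have "degree (\<Prod>e\<leftarrow>es. [:- e, 1:] :: real poly) = length es"
    using degree_linear_factors[of uminus es] by simp
  then show ?thesis using degree_monic_char_poly[OF assms(1)] assms(2) by simp
qed

text \<open>Deflation along the list of roots. A reflection moves a unit eigenvector to the first
  basis vector; by symmetry both the first row and the first column then vanish off the corner, and
  the remaining block is symmetric with the remaining roots. The list prescribes the order of the
  eigenvalues on the diagonal.\<close>

lemma symmetric_diagonalization:
  assumes "A \<in> carrier_mat n n" "A\<^sup>T = (A :: real mat)" "char_poly A = (\<Prod>e\<leftarrow>es. [:- e, 1:])"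
  shows "\<exists>V \<in> carrier_mat n n. V\<^sup>T * V = 1\<^sub>m n \<and> V * V\<^sup>T = 1\<^sub>m n \<and>
    A = V * mat_diag n (\<lambda>i. es ! i) * V\<^sup>T"
  using assms
proof (induction es arbitrary: n A)
  case Nil
  then have n: "n = 0" using length_char_poly_linear_factors[OF Nil(1) Nil(3)] by simp
  show ?case by (rule bexI[of _ "1\<^sub>m n"]) (use Nil(1) n in auto)
next
  case (Cons e es)
  define m where "m = n - 1"
  have n: "n = Suc m" using length_char_poly_linear_factors[OF Cons(2) Cons(4)] by (auto simp: m_def)
  note A = Cons(2)
  note assoc = assoc_mult_mat[of _ n n _ n _ n]
  have "eigenvalue A e" by (simp add: eigenvalue_root_char_poly[OF A] Cons(4))
  then obtain v0 where v0: "v0 \<in> carrier_vec n" "v0 \<noteq> 0\<^sub>v n" "A *\<^sub>v v0 = e \<cdot>\<^sub>v v0"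
    unfolding eigenvalue_def eigenvector_def using A by auto
  define v where "v = (1 / euc_norm v0) \<cdot>\<^sub>v v0"
  have pos: "euc_norm v0 \<noteq> 0"
  proof
    assume "euc_norm v0 = 0"
    then have "\<forall>i<n. v0 $ i = 0" using v0(1) by (simp add: euc_norm_L2 L2_set_eq_0_iff)
    then have "v0 = 0\<^sub>v n" using v0(1) by (intro eq_vecI) auto
    then show False using v0(2) by simp
  qed
  have v: "v \<in> carrier_vec n" using v0 by (simp add: v_def)
  have vv: "v \<bullet> v = 1" using pos v0(1) by (simp add: v_def flip: euc_norm_sq)
  have Av: "A *\<^sub>v v = e \<cdot>\<^sub>v v" unfolding v_def using A v0 by (simp add: mult_mat_vec smult_smult_assoc mult.commute)
  define W where "W = householder n (unit_vec n 0 - v)"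
  have u: "unit_vec n 0 - v \<in> carrier_vec n" using v by simp
  have W: "W \<in> carrier_mat n n" and WT: "W\<^sup>T = W" and WW: "W * W = 1\<^sub>m n"
    using householder_square[OF u] by (auto simp: W_def transpose_householder)
  have W0: "col W 0 = v" unfolding W_def using householder_first_col[OF v _ vv] n by simp
  define A' where "A' = W * A * W"
  have A': "A' \<in> carrier_mat n n" using A W by (simp add: A'_def)
  have A'T: "A'\<^sup>T = A'" unfolding A'_def using A W WT Cons(3)
    by (simp add: transpose_mult[of _ n n _ n])
  have AA': "A = W * A' * W"
  proof -
    have "W * A' * W = W * (W * A * W) * W" by (simp add: A'_def)
    also have "\<dots> = (W * W) * A * (W * W)" using A W by (simp add: assoc)
    also have "\<dots> = A" unfolding WW using A by simp
    finally show ?thesis by simp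
  qed
  have col0: "col A' 0 = e \<cdot>\<^sub>v unit_vec n 0"
  proof -
    have "col A' 0 = (W * A) *\<^sub>v col W 0" unfolding A'_def using A W n by (subst col_mult2[of _ n n _ n]) auto
    also have "\<dots> = W *\<^sub>v (A *\<^sub>v v)" unfolding W0 using W A v by simp
    also have "\<dots> = e \<cdot>\<^sub>v (W *\<^sub>v v)" unfolding Av using W v by (simp add: mult_mat_vec)
    also have "W *\<^sub>v v = col (W * W) 0" unfolding W0[symmetric] using W n by (subst col_mult2[of _ n n _ n]) auto
    also have "\<dots> = unit_vec n 0" unfolding WW using n by simp
    finally show ?thesis .
  qed
  define A3 where "A3 = Matrix.mat m m (\<lambda>(i,j). A' $$ (Suc i, Suc j))"
  have A3: "A3 \<in> carrier_mat m m" by (simp add: A3_def)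
  have symA': "A' $$ (i,j) = A' $$ (j,i)" if "i < n" "j < n" for i j
    using arg_cong[OF A'T, of "\<lambda>B. B $$ (i,j)"] that A' by simp
  have A3T: "A3\<^sup>T = A3" by (rule eq_matI) (auto simp: A3_def symA' n)
  have A'0: "A' $$ (i,0) = (if i = 0 then e else 0)" if "i < n" for i
    using arg_cong[OF col0, of "\<lambda>w. w $ i"] that A' n by simp
  have A'0r: "A' $$ (0,j) = (if j = 0 then e else 0)" if "j < n" for j
    using symA'[of 0 j] A'0[OF that] that n by simp
  let ?E = "Matrix.mat 1 1 (\<lambda>_. e)"
  let ?blk = "\<lambda>a D. four_block_mat a (0\<^sub>m 1 m) (0\<^sub>m m 1) D"
  have A'blk: "A' = ?blk ?E A3"
    by (rule eq_matI) (use A' A'0 A'0r in \<open>auto simp: A3_def n less_Suc_eq_0_disj\<close>)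
  \<comment> \<open>Similarity keeps the characteristic polynomial; cancelling the linear factor of
    \<open>e\<close> leaves that of the smaller block.\<close>
  have "similar_mat_wit A' A W W" using A A' W WW by (intro similar_mat_witI[of W W n]) (simp_all add: A'_def)
  then have "similar_mat A' A" unfolding similar_mat_def by blast
  then have "[:-e,1:] * (\<Prod>e\<leftarrow>es. [:- e, 1:]) = char_poly A'" using char_poly_similar Cons(4) by force
  also have "\<dots> = char_poly ?E * char_poly A3"
    unfolding A'blk by (rule char_poly_four_block_zeros_col) (auto simp: A3)
  also have "char_poly ?E = [:-e,1:]" by (simp add: char_poly_defs det_def sign_def)
  finally have "char_poly A3 = (\<Prod>e\<leftarrow>es. [:- e, 1:])"
    by (metis mult_cancel_left pCons_eq_0_iff zero_neq_one)
  from Cons(1)[OF A3 A3T this] obtain V3 where V3: "V3 \<in> carrier_mat m m"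
    and o1: "V3\<^sup>T * V3 = 1\<^sub>m m" and o2: "V3 * V3\<^sup>T = 1\<^sub>m m"
    and A3V: "A3 = V3 * mat_diag m (\<lambda>i. es ! i) * V3\<^sup>T" by blast
  define V' where "V' = ?blk (1\<^sub>m 1) V3"
  define Dg where "Dg = mat_diag n (\<lambda>i. (e # es) ! i)"
  have V': "V' \<in> carrier_mat n n" and Dg: "Dg \<in> carrier_mat n n" using V3 n by (auto simp: V'_def Dg_def)
  have V'T: "V'\<^sup>T = ?blk (1\<^sub>m 1) (V3\<^sup>T)"
    unfolding V'_def using V3 by (subst transpose_four_block_mat[of _ 1 1 _ m _ m]) auto
  have blkmult: "?blk a D * ?blk b D' = ?blk (a * b) (D * D')"
    if "a \<in> carrier_mat 1 1" "b \<in> carrier_mat 1 1" "D \<in> carrier_mat m m" "D' \<in> carrier_mat m m"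
    for a b D D' :: "real mat"
    using that by (subst mult_four_block_mat[of _ 1 1 _ m _ m _ _ 1 _ m]) auto
  have V'o: "V'\<^sup>T * V' = 1\<^sub>m n" "V' * V'\<^sup>T = 1\<^sub>m n"
    unfolding V'T unfolding V'_def by (subst blkmult; use V3 n in \<open>simp add: o1 o2\<close>)+
  have Dblk: "Dg = ?blk ?E (mat_diag m (\<lambda>i. es ! i))"
    by (rule eq_matI) (auto simp: Dg_def n mat_diag_def less_Suc_eq_0_disj)
  let ?D = "mat_diag m (\<lambda>i. es ! i)"
  have A'V: "A' = V' * Dg * V'\<^sup>T"
  proof -
    have "A' = ?blk (1\<^sub>m 1 * ?E * 1\<^sub>m 1) (V3 * ?D * V3\<^sup>T)" unfolding A'blk A3V by simp
    also have "\<dots> = ?blk (1\<^sub>m 1 * ?E) (V3 * ?D) * ?blk (1\<^sub>m 1) (V3\<^sup>T)"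
      by (rule blkmult[symmetric]) (use V3 in simp_all)
    also have "?blk (1\<^sub>m 1 * ?E) (V3 * ?D) = ?blk (1\<^sub>m 1) V3 * ?blk ?E ?D"
      by (rule blkmult[symmetric]) (use V3 in simp_all)
    finally show ?thesis unfolding V'T unfolding V'_def Dblk .
  qed
  define V where "V = W * V'"
  have VT: "V\<^sup>T = V'\<^sup>T * W" unfolding V_def using W WT V' by (simp add: transpose_mult[of _ n n _ n])
  have V'Tc: "V'\<^sup>T \<in> carrier_mat n n" using V' by simp
  show ?case
  proof (rule bexI[of _ V], intro conjI)
    show "V \<in> carrier_mat n n" using W V' by (simp add: V_def)
    have "V\<^sup>T * V = V'\<^sup>T * (W * W) * V'"
      unfolding VT unfolding V_def using W V' V'Tc Dg by (simp add: assoc)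
    then show "V\<^sup>T * V = 1\<^sub>m n" unfolding WW using V'o carrier_matD[OF V'] by simp
    have "V * V\<^sup>T = W * (V' * V'\<^sup>T) * W"
      unfolding VT unfolding V_def using W V' V'Tc Dg by (simp add: assoc)
    then show "V * V\<^sup>T = 1\<^sub>m n" unfolding V'o using W WW carrier_matD[OF W] by simp
    have "A = W * (V' * Dg * V'\<^sup>T) * W" using AA' A'V by simp
    also have "\<dots> = V * Dg * V\<^sup>T" unfolding VT unfolding V_def using W V' V'Tc Dg by (simp add: assoc)
    finally show "A = V * mat_diag n (\<lambda>i. (e # es) ! i) * V\<^sup>T" by (simp add: Dg_def)
  qed
qed

text \<open>The roots may be listed in any order without changing the product of linear factors.
  Diagonalizing along the decreasing list behind \<open>nth_eig\<close> gives the entries the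
  indices that the estimator refers to.\<close>

theorem spectral_theorem:
  assumes A: "A \<in> carrier_mat n n" and sym: "A\<^sup>T = (A :: real mat)"
  obtains V where "V \<in> carrier_mat n n" "V\<^sup>T * V = 1\<^sub>m n" "V * V\<^sup>T = 1\<^sub>m n"
    "A = V * mat_diag n (nth_eig A) * V\<^sup>T" "\<And>i j. i \<le> j \<Longrightarrow> j < n \<Longrightarrow> nth_eig A j \<le> nth_eig A i"
proof -
  obtain es where es: "char_poly A = (\<Prod>e\<leftarrow>es. [:- e, 1:])" using symmetric_char_poly_splits[OF A sym] by blast
  define es' where "es' = rev (sorted_list_of_multiset (proots (char_poly A)))"
  have nz: "(\<Prod>e\<leftarrow>xs. [:- e, 1:]) \<noteq> (0 :: real poly)" for xs by (auto simp: prod_list_zero_iff)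
  have "proots (\<Prod>e\<leftarrow>xs. [:- e, 1:]) = mset xs" for xs :: "real list"
  proof (induction xs)
    case (Cons a xs)
    have "proots (\<Prod>e\<leftarrow>a # xs. [:- e, 1:]) = proots [:- a, 1:] + proots (\<Prod>e\<leftarrow>xs. [:- e, 1:])"
      unfolding list.map prod_list.Cons by (intro proots_mult nz) simp
    then show ?case unfolding Cons by simp
  qed simp
  then have "mset es' = mset es" unfolding es'_def es by simp
  then have "(\<Prod>e\<leftarrow>es. [:- e, 1:] :: real poly) = (\<Prod>e\<leftarrow>es'. [:- e, 1:])"
    by (metis mset_map prod_mset_prod_list)
  then have es': "char_poly A = (\<Prod>e\<leftarrow>es'. [:- e, 1:])" using es by simp
  have eig: "nth_eig A = (\<lambda>i. es' ! i)" by (simp add: nth_eig_def es'_def fun_eq_iff)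
  obtain V where V: "V \<in> carrier_mat n n" "V\<^sup>T * V = 1\<^sub>m n" "V * V\<^sup>T = 1\<^sub>m n"
    "A = V * mat_diag n (\<lambda>i. es' ! i) * V\<^sup>T" using symmetric_diagonalization[OF A sym es'] by blast
  have len: "length es' = n" using length_char_poly_linear_factors[OF A es'] .
  have "sorted (rev es')" by (simp add: es'_def)
  then have "es' ! j \<le> es' ! i" if "i \<le> j" "j < n" for i j
    using that len by (simp add: sorted_rev_iff_nth_mono)
  then show thesis using that V unfolding eig by blast
qed

lemma dim_mat_diag [simp]: "dim_row (mat_diag n f) = n" "dim_col (mat_diag n f) = n"
  by (simp_all add: mat_diag_def)

lemma mat_diag_mult_vec:
  assumes "y \<in> carrier_vec n" "i < n"
  shows "(mat_diag n f *\<^sub>v y) $ i = f i * (y $ i :: real)"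
  using assms by (subst mult_mat_vec_index[of _ n n]) (auto simp: mat_diag_def if_distrib if_distribR sum.delta cong: if_cong)

section \<open>Quadratic forms and eigenvalue bounds\<close>

lemma spectral_form:
  assumes A: "A \<in> carrier_mat n n" and sym: "A\<^sup>T = (A :: real mat)"
  obtains V where "V \<in> carrier_mat n n" "V\<^sup>T * V = 1\<^sub>m n" "V * V\<^sup>T = 1\<^sub>m n"
    "\<And>x. x \<in> carrier_vec n \<Longrightarrow> x \<bullet> (A *\<^sub>v x) = (\<Sum>i<n. nth_eig A i * ((V\<^sup>T *\<^sub>v x) $ i)^2)"
    "\<And>x. x \<in> carrier_vec n \<Longrightarrow> (euc_norm x)\<^sup>2 = (\<Sum>i<n. ((V\<^sup>T *\<^sub>v x) $ i)^2)"
    "\<And>i j. i \<le> j \<Longrightarrow> j < n \<Longrightarrow> nth_eig A j \<le> nth_eig A i"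
proof (rule spectral_theorem[OF A sym])
  fix V assume V: "V \<in> carrier_mat n n" "V\<^sup>T * V = 1\<^sub>m n" "V * V\<^sup>T = 1\<^sub>m n"
    and AV: "A = V * mat_diag n (nth_eig A) * V\<^sup>T"
    and mono: "\<And>i j. i \<le> j \<Longrightarrow> j < n \<Longrightarrow> nth_eig A j \<le> nth_eig A i"
  have form: "x \<bullet> (A *\<^sub>v x) = (\<Sum>i<n. nth_eig A i * ((V\<^sup>T *\<^sub>v x) $ i)^2)"
    if x: "x \<in> carrier_vec n" for x
  proof -
    let ?y = "V\<^sup>T *\<^sub>v x" and ?D = "mat_diag n (nth_eig A)"
    have y: "?y \<in> carrier_vec n" and VT: "V\<^sup>T \<in> carrier_mat n n" using V x by auto
    have Dy: "?D *\<^sub>v ?y \<in> carrier_vec n" by (rule mult_mat_vec_carrier[OF mat_diag_dim y])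
    have VD: "V * ?D \<in> carrier_mat n n" by (rule mult_carrier_mat[OF V(1) mat_diag_dim])
    have "A *\<^sub>v x = (V * ?D * V\<^sup>T) *\<^sub>v x" using AV by simp
    also have "\<dots> = V *\<^sub>v (?D *\<^sub>v ?y)"
      using assoc_mult_mat_vec[OF VD VT x] assoc_mult_mat_vec[OF V(1) mat_diag_dim y] by simp
    finally have "x \<bullet> (A *\<^sub>v x) = ?y \<bullet> (?D *\<^sub>v ?y)"
      using transpose_vec_mult_scalar[OF V(1) Dy x] by simp
    also have "\<dots> = (\<Sum>i<n. nth_eig A i * (?y $ i)^2)"
      using y carrier_vecD[OF Dy] by (simp add: scalar_prod_sum[of ?y] mat_diag_mult_vec power2_eq_square mult_ac del: index_mult_mat_vec)
    finally show ?thesis .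
  qed
  have nrm: "(euc_norm x)^2 = (\<Sum>i<n. ((V\<^sup>T *\<^sub>v x) $ i)^2)" if x: "x \<in> carrier_vec n" for x
  proof -
    have "euc_norm x = euc_norm (V\<^sup>T *\<^sub>v x)"
      using V x by (intro euc_norm_isometry[of _ n n, symmetric]) auto
    then show ?thesis using V by (simp add: euc_norm_sq_sum del: index_mult_mat_vec)
  qed
  show thesis using that[OF V] form nrm mono by blast
qed

lemma symmetric_form_le:
  assumes A: "A \<in> carrier_mat n n" and sym: "A\<^sup>T = (A :: real mat)"
    and le: "\<And>i. i < n \<Longrightarrow> nth_eig A i \<le> c" and x: "x \<in> carrier_vec n"
  shows "x \<bullet> (A *\<^sub>v x) \<le> c * (euc_norm x)^2"
proof (rule spectral_form[OF A sym], goal_cases)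
  case (1 V)
  show ?thesis unfolding 1(4)[OF x] 1(5)[OF x] sum_distrib_left by (intro sum_mono mult_right_mono le) auto
qed

lemma symmetric_form_ge:
  assumes A: "A \<in> carrier_mat n n" and sym: "A\<^sup>T = (A :: real mat)"
    and le: "c \<le> nth_eig A (n - 1)" and x: "x \<in> carrier_vec n"
  shows "c * (euc_norm x)^2 \<le> x \<bullet> (A *\<^sub>v x)"
proof (rule spectral_form[OF A sym], goal_cases)
  case (1 V)
  have "c \<le> nth_eig A i" if "i < n" for i
    using 1(6)[of i "n - 1"] le that by force
  then show ?thesis unfolding 1(4)[OF x] 1(5)[OF x] sum_distrib_left by (intro sum_mono mult_right_mono) auto
qed

text \<open>Zero rows pad the matrix to a square one, which is singular. Its kernel vectors are
  kernel vectors of the wide matrix.\<close>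

lemma wide_matrix_kernel:
  assumes C: "(C :: real mat) \<in> carrier_mat l r" and "l < r"
  shows "\<exists>a \<in> carrier_vec r. a \<noteq> 0\<^sub>v r \<and> C *\<^sub>v a = 0\<^sub>v l"
proof -
  define M where "M = Matrix.mat r r (\<lambda>(i,j). if i < l then C $$ (i,j) else 0)"
  have M: "M \<in> carrier_mat r r" by (simp add: M_def)
  \<comment> \<open>Row \<open>l\<close> is the first padded row, so the unit vector at
    \<open>l\<close> is annihilated by the transpose.\<close>
  have "M\<^sup>T *\<^sub>v unit_vec r l = 0\<^sub>v r"
    by (rule eq_vecI) (use assms in \<open>auto simp: M_def\<close>)
  then have "det (M\<^sup>T) = 0"
    using assms M by (subst det_0_iff_vec_prod_zero[of _ r]) (auto intro!: exI[of _ "unit_vec r l"])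
  then have "det M = 0" by (simp add: det_transpose[OF M])
  then obtain a where a: "a \<in> carrier_vec r" "a \<noteq> 0\<^sub>v r" "M *\<^sub>v a = 0\<^sub>v r"
    using det_0_iff_vec_prod_zero[OF M] by blast
  have "C *\<^sub>v a = 0\<^sub>v l"
  proof (rule eq_vecI)
    fix i assume "i < dim_vec (0\<^sub>v l)"
    then have i: "i < l" by simp
    have "(M *\<^sub>v a) $ i = (\<Sum>j<r. M $$ (i,j) * a $ j)"
      using i assms by (intro mult_mat_vec_index[OF M a(1)]) simp
    also have "\<dots> = (\<Sum>j<r. C $$ (i,j) * a $ j)" using i assms by (intro sum.cong) (auto simp: M_def)
    also have "\<dots> = (C *\<^sub>v a) $ i" by (rule mult_mat_vec_index[OF C a(1) i, symmetric])
    finally have "(M *\<^sub>v a) $ i = (C *\<^sub>v a) $ i" .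
    then show "(C *\<^sub>v a) $ i = 0\<^sub>v l $ i" unfolding a(3) using i assms by simp
  qed (use C in simp)
  then show ?thesis using a by blast
qed

text \<open>One half of the Courant-Fischer principle. Among the \<open>r\<close> dimensions spanned
  by \<open>G\<close> there is a nonzero vector orthogonal to the first \<open>l < r\<close>
  eigenvectors. At this vector the form is at most the eigenvalue with index \<open>l\<close> times
  the squared length.\<close>

lemma nth_eig_ge_subspace:
  assumes A: "A \<in> carrier_mat n n" and sym: "A\<^sup>T = (A :: real mat)"
    and G: "G \<in> carrier_mat n r" and o: "G\<^sup>T * G = 1\<^sub>m r" and rn: "r \<le> n"
    and ge: "\<And>a. a \<in> carrier_vec r \<Longrightarrow> c * (euc_norm a)^2 \<le> (G *\<^sub>v a) \<bullet> (A *\<^sub>v (G *\<^sub>v a))"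
    and l: "l < r"
  shows "c \<le> nth_eig A l"
proof (rule spectral_form[OF A sym])
  fix V assume V: "V \<in> carrier_mat n n"
    and f: "\<And>x. x \<in> carrier_vec n \<Longrightarrow> x \<bullet> (A *\<^sub>v x) = (\<Sum>i<n. nth_eig A i * ((V\<^sup>T *\<^sub>v x) $ i)^2)"
    and g: "\<And>x. x \<in> carrier_vec n \<Longrightarrow> (euc_norm x)\<^sup>2 = (\<Sum>i<n. ((V\<^sup>T *\<^sub>v x) $ i)^2)"
    and mono: "\<And>i j. i \<le> j \<Longrightarrow> j < n \<Longrightarrow> nth_eig A j \<le> nth_eig A i"
  \<comment> \<open>The first \<open>l\<close> rows of \<open>V\<^sup>T G\<close>: a kernel vector
    \<open>a\<close> makes \<open>G a\<close> orthogonal to the first \<open>l\<close>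
    eigenvectors.\<close>
  define C where "C = Matrix.mat l r (\<lambda>p. (V\<^sup>T * G) $$ p)"
  have C: "C \<in> carrier_mat l r" by (simp add: C_def)
  obtain a where a: "a \<in> carrier_vec r" "a \<noteq> 0\<^sub>v r" "C *\<^sub>v a = 0\<^sub>v l"
    using wide_matrix_kernel[OF C l] by blast
  let ?x = "G *\<^sub>v a"
  have x: "?x \<in> carrier_vec n" using G a by simp
  have VG: "V\<^sup>T * G \<in> carrier_mat n r" using V G by simp
  have VTx: "V\<^sup>T *\<^sub>v ?x = (V\<^sup>T * G) *\<^sub>v a"
    using V G a by (intro assoc_mult_mat_vec[symmetric]) auto
  have zero: "(V\<^sup>T *\<^sub>v ?x) $ i = 0" if i: "i < l" for i
  proof -
    have "((V\<^sup>T * G) *\<^sub>v a) $ i = (\<Sum>j<r. (V\<^sup>T * G) $$ (i,j) * a $ j)"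
      using i l rn by (intro mult_mat_vec_index[OF VG a(1)]) simp
    also have "\<dots> = (\<Sum>j<r. C $$ (i,j) * a $ j)" using i by (intro sum.cong) (auto simp: C_def)
    also have "\<dots> = (C *\<^sub>v a) $ i" using i by (intro mult_mat_vec_index[OF C a(1), symmetric])
    finally show ?thesis unfolding VTx a(3) using i by simp
  qed
  have "c * (euc_norm a)^2 \<le> (\<Sum>i<n. nth_eig A i * ((V\<^sup>T *\<^sub>v ?x) $ i)^2)"
    using ge[OF a(1)] f[OF x] by simp
  also have "\<dots> \<le> (\<Sum>i<n. nth_eig A l * ((V\<^sup>T *\<^sub>v ?x) $ i)^2)"
  proof (rule sum_mono)
    fix i assume "i \<in> {..<n}"
    then show "nth_eig A i * ((V\<^sup>T *\<^sub>v ?x) $ i)^2 \<le> nth_eig A l * ((V\<^sup>T *\<^sub>v ?x) $ i)^2"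
      using zero[of i] mono[of l i] by (cases "i < l") (auto intro: mult_right_mono)
  qed
  also have "\<dots> = nth_eig A l * (euc_norm ?x)^2" by (simp only: g[OF x] sum_distrib_left)
  also have "euc_norm ?x = euc_norm a" by (rule euc_norm_isometry[OF G a(1) o])
  finally have le: "c * (euc_norm a)^2 \<le> nth_eig A l * (euc_norm a)^2" .
  have "euc_norm a \<noteq> 0"
  proof
    assume "euc_norm a = 0"
    then have "\<forall>i<r. a $ i = 0" using a(1) by (simp add: euc_norm_L2 L2_set_eq_0_iff)
    then have "a = 0\<^sub>v r" using a(1) by (intro eq_vecI) auto
    then show False using a(2) by simp
  qed
  then have "0 < (euc_norm a)^2" by simp
  then show ?thesis using le by simp
qed

lemma gram_eig_bound:
  assumes P: "P \<in> carrier_mat m n" and le: "\<And>i. i < n \<Longrightarrow> nth_eig (P\<^sup>T * P) i \<le> c"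
    and x: "x \<in> carrier_vec n"
  shows "(euc_norm (P *\<^sub>v x))^2 \<le> c * (euc_norm x)^2"
  unfolding euc_norm_mult_sq[OF P x]
  using P x by (intro symmetric_form_le le) (auto simp: transpose_mult[of _ n m _ n])

text \<open>Avoids singular values: the squared norm of \<open>P\<^sup>T x\<close> is the product of
  \<open>x\<close> with \<open>P (P\<^sup>T x)\<close>. Cauchy-Schwarz and the bound for
  \<open>P\<close> give an inequality from which one norm of \<open>P\<^sup>T x\<close>
  cancels.\<close>

lemma adjoint_bound:
  assumes P: "P \<in> carrier_mat m n" and le: "\<And>x. x \<in> carrier_vec n \<Longrightarrow> (euc_norm (P *\<^sub>v x))\<^sup>2 \<le> c * (euc_norm x)^2"
    and x: "x \<in> carrier_vec m" and c: "0 \<le> c"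
  shows "(euc_norm (P\<^sup>T *\<^sub>v x))^2 \<le> c * (euc_norm x)^2"
proof -
  let ?y = "P\<^sup>T *\<^sub>v x"
  have y: "?y \<in> carrier_vec n" using P x by simp
  have "?y \<bullet> ?y = x \<bullet> (P *\<^sub>v ?y)" using transpose_vec_mult_scalar[OF P y x] .
  then have "(euc_norm ?y)^2 \<le> euc_norm x * euc_norm (P *\<^sub>v ?y)"
    unfolding euc_norm_sq using cauchy_schwarz_vec[of x "P *\<^sub>v ?y"] P x by simp
  then have "((euc_norm ?y)^2)^2 \<le> (euc_norm x * euc_norm (P *\<^sub>v ?y))^2" by (intro power_mono) auto
  also have "\<dots> \<le> (euc_norm x)^2 * (c * (euc_norm ?y)^2)"
    unfolding power_mult_distrib by (intro mult_left_mono le[OF y]) simp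
  finally have *: "(euc_norm ?y)^2 * (euc_norm ?y)^2 \<le> (c * (euc_norm x)^2) * (euc_norm ?y)^2"
    by (simp add: power2_eq_square mult_ac)
  show ?thesis
  proof (cases "euc_norm ?y = 0")
    case True
    then show ?thesis using c by simp
  next
    case False
    then have "0 < (euc_norm ?y)^2" by simp
    then show ?thesis by (rule mult_right_le_imp_le[OF *])
  qed
qed

section \<open>The penalty matrix\<close>

lemma minv_eq:
  assumes A: "A \<in> carrier_mat n n" and B: "B \<in> carrier_mat n n" and AB: "A * B = 1\<^sub>m n" and BA: "B * A = 1\<^sub>m n"
  shows "minv A = B"
proof (cases "mat_inverse A")
  case None
  have "A \<in> Units (ring_mat TYPE(real) n ())"
    using A B AB BA unfolding Units_def ring_mat_def by auto
  then show ?thesis using mat_inverse(1)[OF A None, of "()"] by blast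
next
  case (Some C)
  then have C: "A * C = 1\<^sub>m n" "C \<in> carrier_mat n n" using mat_inverse(2)[OF A] by auto
  have "C = (B * A) * C" unfolding BA using C by simp
  also have "\<dots> = B" using assoc_mult_mat[OF B A C(2)] C(1) B by simp
  finally show ?thesis unfolding minv_def Some by simp
qed

lemma minv_diag:
  assumes "\<And>i. i < n \<Longrightarrow> f i \<noteq> 0"
  shows "minv (mat_diag n f) = mat_diag n (\<lambda>i. 1 / f i)"
proof (rule minv_eq)
  have "mat_diag n (\<lambda>i. f i * (1 / f i)) = 1\<^sub>m n" by (rule eq_matI) (use assms in \<open>auto simp: mat_diag_def\<close>)
  then show "mat_diag n f * mat_diag n (\<lambda>i. 1 / f i) = 1\<^sub>m n" "mat_diag n (\<lambda>i. 1 / f i) * mat_diag n f = 1\<^sub>m n"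
    by (simp_all add: mult.commute)
qed simp_all

section \<open>The inverse penalty as shrinkage towards the mean\<close>

text \<open>The identity on multiples of the all-ones vector, division by \<open>1 + lam\<close> on
  their orthogonal complement.\<close>

definition D_inv :: "nat \<Rightarrow> real \<Rightarrow> real mat" where
  "D_inv N lam = Matrix.mat N N (\<lambda>(i,j). (if i = j then 1 / (1 + lam) else 0) + lam / ((1 + lam) * real N))"

lemma D_inv_carrier [simp]: "D_inv N lam \<in> carrier_mat N N"
  by (simp add: D_inv_def)

lemma transpose_D_inv [simp]: "(D_inv N lam)\<^sup>T = D_inv N lam"
  by (rule eq_matI) (auto simp: D_inv_def)

lemma D_mat_carrier [simp]: "D_mat N lam \<in> carrier_mat N N"
  by (simp add: D_mat_def Pi_mat_def ones_mat_def minus_carrier_mat)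

lemma D_mat_D_inv:
  assumes N: "0 < N" and lam: "0 < lam"
  shows "D_mat N lam * D_inv N lam = 1\<^sub>m N"
proof (rule eq_matI)
  fix i j assume "i < dim_row (1\<^sub>m N)" "j < dim_col (1\<^sub>m N)"
  then have i: "i < N" and j: "j < N" by auto
  define a where "a = 1 / (1 + lam)"
  define b where "b = lam / ((1 + lam) * real N)"
  define c where "c = lam / real N"
  have D: "D_mat N lam $$ (i,k) = (if i = k then 1 + lam else 0) - c" if "k < N" for k
    using i that by (simp add: D_mat_def Pi_mat_def ones_mat_def c_def algebra_simps)
  have Di: "D_inv N lam $$ (k,j) = (if k = j then a else 0) + b" if "k < N" for k
    using j that by (simp add: D_inv_def a_def b_def)
  have "(D_mat N lam * D_inv N lam) $$ (i,j) = (\<Sum>k<N. ((if i = k then 1 + lam else 0) - c) * ((if k = j then a else 0) + b))"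
    using i j by (subst mult_mat_index[OF D_mat_carrier D_inv_carrier]) (auto simp: D Di)
  also have "\<dots> = (\<Sum>k<N. (if i = k then (1 + lam) * ((if k = j then a else 0) + b) else 0) - (if k = j then c * a else 0) - c * b)"
    by (intro sum.cong) (auto simp: algebra_simps)
  also have "\<dots> = (1 + lam) * ((if i = j then a else 0) + b) - c * a - real N * c * b"
    using i j by (simp add: sum_subtractf)
  also have "\<dots> = (if i = j then 1 else 0)"
  proof -
    have 1: "(1 + lam) * a = 1" and 2: "c * a = b" and 3: "real N * c = lam"
      using lam N by (simp_all add: a_def b_def c_def)
    have 4: "(1 + lam) * (z + b) - b - lam * b = (1 + lam) * z" for z by (simp add: algebra_simps)
    show ?thesis unfolding 2 3 4 using 1 by simp
  qed
  finally show "(D_mat N lam * D_inv N lam) $$ (i,j) = 1\<^sub>m N $$ (i,j)" using i j by simp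
qed (use carrier_matD[OF D_mat_carrier[of N lam]] carrier_matD[OF D_inv_carrier[of N lam]] in simp_all)

lemma transpose_D_mat [simp]: "(D_mat N lam)\<^sup>T = D_mat N lam"
  by (rule eq_matI) (auto simp: D_mat_def Pi_mat_def ones_mat_def)

lemma minv_D_mat:
  assumes "0 < N" and "0 < lam"
  shows "minv (D_mat N lam) = D_inv N lam"
proof (rule minv_eq[OF D_mat_carrier D_inv_carrier D_mat_D_inv[OF assms]])
  show "D_inv N lam * D_mat N lam = 1\<^sub>m N"
    using arg_cong[OF D_mat_D_inv[OF assms], of transpose_mat]
    by (simp add: transpose_mult[OF D_mat_carrier D_inv_carrier])
qed

text \<open>A convex combination of the entry and the mean of all entries. The mean is common to all
  coordinates, so it cancels in the difference of two of them.\<close>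

lemma D_inv_mult_vec:
  assumes x: "x \<in> carrier_vec N" and i: "i < N"
  shows "(D_inv N lam *\<^sub>v x) $ i = x $ i / (1 + lam) + lam / (1 + lam) * ((\<Sum>j<N. x $ j) / real N)"
proof -
  have "(D_inv N lam *\<^sub>v x) $ i = (\<Sum>j<N. D_inv N lam $$ (i,j) * x $ j)"
    by (rule mult_mat_vec_index[OF D_inv_carrier x i])
  also have "\<dots> = (\<Sum>j<N. (if i = j then x $ j / (1 + lam) else 0) + lam / ((1 + lam) * real N) * x $ j)"
    using i by (intro sum.cong) (auto simp: D_inv_def algebra_simps)
  also have "\<dots> = x $ i / (1 + lam) + lam / ((1 + lam) * real N) * (\<Sum>j<N. x $ j)"
    using i by (simp add: sum.distrib sum_distrib_left)
  finally show ?thesis by simp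
qed

lemma sum_sq_le_euc_norm:
  assumes x: "x \<in> carrier_vec N" and N: "0 < N"
  shows "(\<Sum>j<N. x $ j)^2 / real N \<le> (euc_norm x)^2"
proof -
  have "(\<Sum>j<N. x $ j)^2 \<le> real N * (\<Sum>j<N. (x $ j)^2)"
    using sum_squared_le_sum_of_squares[of "\<lambda>j. x $ j" "{..<N}"] N by (simp add: mult.commute)
  then show ?thesis using x N by (simp add: euc_norm_sq_sum field_simps)
qed

lemma D_inv_form:
  assumes x: "x \<in> carrier_vec N"
  shows "x \<bullet> (D_inv N lam *\<^sub>v x) = (euc_norm x)^2 / (1 + lam) + lam / (1 + lam) * ((\<Sum>j<N. x $ j)^2 / real N)"
proof -
  have "x \<bullet> (D_inv N lam *\<^sub>v x) = (\<Sum>i<N. x $ i * (x $ i / (1 + lam) + lam / (1 + lam) * ((\<Sum>j<N. x $ j) / real N)))"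
    using carrier_matD[OF D_inv_carrier[of N lam]]
    by (simp add: scalar_prod_sum[of x] D_inv_mult_vec[OF x] del: index_mult_mat_vec)
  also have "\<dots> = (\<Sum>i<N. (x $ i)^2) / (1 + lam) + lam / (1 + lam) * ((\<Sum>j<N. x $ j) / real N) * (\<Sum>j<N. x $ j)"
    by (simp add: distrib_left sum.distrib power2_eq_square sum_divide_distrib sum_distrib_left mult_ac)
  finally show ?thesis using x by (simp add: euc_norm_sq_sum power2_eq_square[of "sum _ _"])
qed

lemma convex_weights_eq:
  assumes "0 < lam"
  shows "e / (1 + lam) + lam / (1 + lam) * e = (e :: real)"
proof -
  have "e / (1 + lam) + lam / (1 + lam) * e = ((1 + lam) * e) / (1 + lam)"
    by (simp add: add_divide_distrib distrib_right)
  then show ?thesis using assms by simp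
qed

lemma D_inv_form_le:
  assumes x: "x \<in> carrier_vec N" and N: "0 < N" and lam: "0 < lam"
  shows "x \<bullet> (D_inv N lam *\<^sub>v x) \<le> (euc_norm x)^2"
proof -
  have "x \<bullet> (D_inv N lam *\<^sub>v x) \<le> (euc_norm x)^2 / (1 + lam) + lam / (1 + lam) * (euc_norm x)^2"
    unfolding D_inv_form[OF x] using lam sum_sq_le_euc_norm[OF x N] by (intro add_left_mono mult_left_mono) auto
  also have "\<dots> = (euc_norm x)^2" by (rule convex_weights_eq[OF lam])
  finally show ?thesis .
qed

text \<open>The eigenvalues of \<open>D_inv\<close> lie in the unit interval, hence its square is
  below it. The difference of the two sides is \<open>p * q\<close> times the squared norm of the
  centered vector, nonnegative by Cauchy-Schwarz.\<close>

lemma D_inv_norm_le_form: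
  assumes x: "x \<in> carrier_vec N" and N: "0 < N" and lam: "0 < lam"
  shows "(euc_norm (D_inv N lam *\<^sub>v x))^2 \<le> x \<bullet> (D_inv N lam *\<^sub>v x)"
proof -
  define p where "p = 1 / (1 + lam)"
  define q where "q = lam / (1 + lam)"
  define S where "S = (\<Sum>j<N. x $ j)"
  have pq: "p = 1 - q" "0 \<le> q" "q \<le> 1" using lam by (auto simp: p_def q_def field_simps)
  have "(euc_norm (D_inv N lam *\<^sub>v x))^2 = (\<Sum>i<N. (p * x $ i + q * (S / real N))^2)"
    using carrier_matD[OF D_inv_carrier[of N lam]]
    by (simp add: euc_norm_sq_sum D_inv_mult_vec[OF x] p_def q_def S_def del: index_mult_mat_vec)
  also have "\<dots> = (\<Sum>i<N. p^2 * (x $ i)^2 + 2 * p * q * (S / real N) * x $ i + (q * (S / real N))^2)"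
    by (intro sum.cong) (auto simp: power2_eq_square algebra_simps)
  also have "\<dots> = p^2 * (\<Sum>i<N. (x $ i)^2) + 2 * p * q * (S / real N) * S + real N * (q * (S / real N))^2"
    unfolding sum.distrib sum_distrib_left[symmetric] S_def by simp
  also have "\<dots> = p^2 * (euc_norm x)^2 + (2 * p * q + q^2) * (S^2 / real N)"
  proof -
    have "real N * (q * (S / real N))^2 = q^2 * (S^2 / real N)"
      using N by (simp add: power2_eq_square field_simps)
    moreover have "2 * p * q * (S / real N) * S = 2 * p * q * (S^2 / real N)"
      by (simp add: power2_eq_square)
    moreover have "(\<Sum>i<N. (x $ i)^2) = (euc_norm x)^2" using x by (simp add: euc_norm_sq_sum)
    ultimately show ?thesis by (simp only: distrib_right)
  qed
  finally have 1: "(euc_norm (D_inv N lam *\<^sub>v x))^2 = p^2 * (euc_norm x)^2 + (2 * p * q + q^2) * (S^2 / real N)" .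
  have 2: "x \<bullet> (D_inv N lam *\<^sub>v x) = p * (euc_norm x)^2 + q * (S^2 / real N)"
    unfolding D_inv_form[OF x] by (simp add: p_def q_def S_def)
  have id: "(1 - q) * e + q * t - ((1 - q)^2 * e + (2 * (1 - q) * q + q^2) * t) = (1 - q) * q * (e - t)" for e t :: real
    by (simp add: power2_eq_square algebra_simps)
  have "x \<bullet> (D_inv N lam *\<^sub>v x) - (euc_norm (D_inv N lam *\<^sub>v x))^2 = p * q * ((euc_norm x)^2 - S^2 / real N)"
    unfolding 1 2 pq(1) by (rule id)
  also have "\<dots> \<ge> 0" using sum_sq_le_euc_norm[OF x N] pq by (intro mult_nonneg_nonneg) (auto simp: S_def)
  finally show ?thesis by simp
qed

lemma D_inv_norm_le:
  assumes x: "x \<in> carrier_vec N" and N: "0 < N" and lam: "0 < lam"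
  shows "euc_norm (D_inv N lam *\<^sub>v x) \<le> euc_norm x"
  by (rule power2_le_imp_le[OF order_trans[OF D_inv_norm_le_form[OF assms] D_inv_form_le[OF assms]]]) simp

section \<open>Centered loadings and the signal surviving the penalty\<close>

text \<open>The last column of \<open>U\<close> is fixed by \<open>D_inv\<close>, hence constant,
  and it has length one. The last coordinate of \<open>U\<^sup>T x\<close> therefore carries exactly
  the mean of \<open>x\<close>, and leaving it out centers \<open>x\<close>.\<close>

lemma spec_U_last_col:
  assumes sp: "spec_U N lam U" and N: "0 < N" and lam: "0 < lam" and x: "x \<in> carrier_vec N"
  shows "(\<Sum>i<N - 1. ((U\<^sup>T *\<^sub>v x) $ i)^2) = (euc_norm x)^2 - (\<Sum>j<N. x $ j)^2 / real N"
proof -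
  obtain \<delta> where U: "U \<in> carrier_mat N N" and o: "U\<^sup>T * U = 1\<^sub>m N" "U * U\<^sup>T = 1\<^sub>m N"
    and DU: "D_inv N lam = U * mat_diag N \<delta> * U\<^sup>T" and d1: "\<delta> (N - 1) = 1"
    using sp minv_D_mat[OF N lam] unfolding spec_U_def by auto
  define u where "u = col U (N - 1)"
  have u: "u \<in> carrier_vec N" unfolding u_def by (rule carrier_vecI) (use U in simp)
  have last: "N - 1 < N" using N by simp
  have Dg: "mat_diag N \<delta> \<in> carrier_mat N N" and UT: "U\<^sup>T \<in> carrier_mat N N" using U by simp_all
  have "D_inv N lam * U = U * mat_diag N \<delta> * (U\<^sup>T * U)"
    unfolding DU by (rule assoc_mult_mat[OF mult_carrier_mat[OF U Dg] UT U])
  also have "\<dots> = U * mat_diag N \<delta>" unfolding o by (rule right_mult_one_mat[OF mult_carrier_mat[OF U Dg]])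
  finally have DUU: "D_inv N lam * U = U * mat_diag N \<delta>" .
  have "D_inv N lam *\<^sub>v u = col (D_inv N lam * U) (N - 1)"
    unfolding u_def by (rule col_mult2[OF D_inv_carrier U last, symmetric])
  also have "\<dots> = u" unfolding DUU u_def mat_diag_mult_right[OF U]
    by (rule eq_vecI) (use U N d1 in auto)
  finally have Du: "D_inv N lam *\<^sub>v u = u" .
  define m where "m = (\<Sum>j<N. u $ j) / real N"
  \<comment> \<open>An entry equal to its own shrinkage towards the mean is the mean;
    \<open>lam > 0\<close> is what makes the shrinkage proper.\<close>
  have um: "u $ i = m" if i: "i < N" for i
  proof -
    have "u $ i = u $ i / (1 + lam) + lam / (1 + lam) * m"
      using D_inv_mult_vec[OF u i, of lam] unfolding Du m_def .
    then have "lam / (1 + lam) * u $ i = lam / (1 + lam) * m" using convex_weights_eq[OF lam, of "u $ i"] by linarith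
    then show ?thesis using lam by simp
  qed
  have "u \<bullet> u = 1"
    using arg_cong[OF o(1), of "\<lambda>A. A $$ (N - 1, N - 1)"] U N by (simp add: u_def)
  then have Nm: "real N * m^2 = 1" using u by (simp add: scalar_prod_sum um power2_eq_square)
  have "(U\<^sup>T *\<^sub>v x) $ (N - 1) = m * (\<Sum>j<N. x $ j)"
  proof -
    have "(U\<^sup>T *\<^sub>v x) $ (N - 1) = u \<bullet> x" using U N by (simp add: u_def)
    also have "\<dots> = m * (\<Sum>j<N. x $ j)" using x by (simp add: scalar_prod_sum um sum_distrib_left)
    finally show ?thesis .
  qed
  then have "((U\<^sup>T *\<^sub>v x) $ (N - 1))^2 = m^2 * (\<Sum>j<N. x $ j)^2" by (simp add: power_mult_distrib)
  also have "m^2 = 1 / real N" using Nm N by (simp add: field_simps)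
  finally have lastsq: "((U\<^sup>T *\<^sub>v x) $ (N - 1))^2 = (\<Sum>j<N. x $ j)^2 / real N" by simp
  have "(euc_norm x)^2 = (euc_norm (U\<^sup>T *\<^sub>v x))^2"
    using euc_norm_isometry[OF UT x] o U by simp
  also have "\<dots> = (\<Sum>i<Suc (N - 1). ((U\<^sup>T *\<^sub>v x) $ i)^2)"
    using U N by (simp add: euc_norm_sq_sum del: index_mult_mat_vec sum.lessThan_Suc)
  also have "\<dots> = (\<Sum>i<N - 1. ((U\<^sup>T *\<^sub>v x) $ i)^2) + (\<Sum>j<N. x $ j)^2 / real N"
    using lastsq by simp
  finally show ?thesis by simp
qed

text \<open>The left side is the squared length of the centered vector \<open>B a\<close>, which is
  also that of \<open>B_star N U B\<close> applied to \<open>a\<close>. If \<open>B_star\<close> is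
  small, \<open>B a\<close> is nearly constant.\<close>

lemma B_star_norm:
  assumes sp: "spec_U N lam U" and N: "0 < N" and lam: "0 < lam" and B: "B \<in> carrier_mat N r" and a: "a \<in> carrier_vec r"
  shows "(euc_norm (B *\<^sub>v a))^2 - (\<Sum>j<N. (B *\<^sub>v a) $ j)^2 / real N \<le> (fro_norm (B_star N U B))^2 * (euc_norm a)^2"
proof -
  let ?J = "mat_diag N (\<lambda>i. if i = N - 1 then 0 else 1 :: real)"
  have U: "U \<in> carrier_mat N N" using sp by (simp add: spec_U_def)
  then have UT: "U\<^sup>T \<in> carrier_mat N N" by simp
  have J: "?J \<in> carrier_mat N N" by simp
  have Ba: "B *\<^sub>v a \<in> carrier_vec N" using B a by simp
  have UBa: "U\<^sup>T *\<^sub>v (B *\<^sub>v a) \<in> carrier_vec N" using UT Ba by (rule mult_mat_vec_carrier)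
  have Bs: "B_star N U B \<in> carrier_mat N r"
    unfolding B_star_def using J UT B by (meson mult_carrier_mat)
  have "B_star N U B *\<^sub>v a = (?J * U\<^sup>T) *\<^sub>v (B *\<^sub>v a)"
    unfolding B_star_def by (rule assoc_mult_mat_vec[OF mult_carrier_mat[OF J UT] B a])
  also have "\<dots> = ?J *\<^sub>v (U\<^sup>T *\<^sub>v (B *\<^sub>v a))" by (rule assoc_mult_mat_vec[OF J UT Ba])
  finally have eq: "B_star N U B *\<^sub>v a = ?J *\<^sub>v (U\<^sup>T *\<^sub>v (B *\<^sub>v a))" .
  have "(euc_norm (B_star N U B *\<^sub>v a))^2
      = (\<Sum>i<Suc (N - 1). ((if i = N - 1 then 0 else 1) * (U\<^sup>T *\<^sub>v (B *\<^sub>v a)) $ i)^2)"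
    unfolding eq euc_norm_sq_sum using N J
    by (intro sum.cong) (auto simp: mat_diag_mult_vec[OF UBa] simp del: index_mult_mat_vec)
  also have "\<dots> = (\<Sum>i<N - 1. ((U\<^sup>T *\<^sub>v (B *\<^sub>v a)) $ i)^2)"
    by (simp del: index_mult_mat_vec)
  also have "\<dots> = (euc_norm (B *\<^sub>v a))^2 - (\<Sum>j<N. (B *\<^sub>v a) $ j)^2 / real N"
    by (rule spec_U_last_col[OF sp N lam Ba])
  finally have "(euc_norm (B *\<^sub>v a))^2 - (\<Sum>j<N. (B *\<^sub>v a) $ j)^2 / real N = (euc_norm (B_star N U B *\<^sub>v a))^2" by simp
  also have "\<dots> \<le> (fro_norm (B_star N U B) * euc_norm a)^2"
    by (intro power_mono euc_norm_mult_le[OF Bs a]) simp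
  finally show ?thesis by (simp add: power_mult_distrib)
qed

text \<open>At most half of the signal is lost in either case. For \<open>lam \<le> 1\<close> the
  shrinkage factor is at least one half. Otherwise centering removes at most
  \<open>\<kappa> / 2\<close> times the squared length of \<open>a\<close>, so the mean part of
  \<open>B a\<close>, on which \<open>D_inv\<close> is the identity, keeps the other half.\<close>

lemma D_inv_form_ge:
  assumes sp: "spec_U N lam U" and N: "0 < N" and lam: "0 < lam" and B: "B \<in> carrier_mat N r" and a: "a \<in> carrier_vec r"
    and k: "\<kappa> * (euc_norm a)^2 \<le> (euc_norm (B *\<^sub>v a))^2"
    and cs: "lam \<le> 1 \<or> (fro_norm (B_star N U B))\<^sup>2 \<le> \<kappa> / 2"
  shows "\<kappa> / 2 * (euc_norm a)^2 \<le> (B *\<^sub>v a) \<bullet> (D_inv N lam *\<^sub>v (B *\<^sub>v a))"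
proof -
  let ?x = "B *\<^sub>v a"
  have x: "?x \<in> carrier_vec N" using B a by simp
  let ?m = "(\<Sum>j<N. ?x $ j)^2 / real N"
  have m0: "0 \<le> ?m" by simp
  show ?thesis
  proof (cases "lam \<le> 1")
    case True
    have "\<kappa> / 2 * (euc_norm a)^2 \<le> (euc_norm ?x)^2 / 2" using k by simp
    also have "\<dots> \<le> (euc_norm ?x)^2 / (1 + lam)" using True lam by (intro divide_left_mono) auto
    also have "\<dots> \<le> ?x \<bullet> (D_inv N lam *\<^sub>v ?x)" unfolding D_inv_form[OF x] using lam m0 by simp
    finally show ?thesis .
  next
    case False
    then have s: "(fro_norm (B_star N U B))^2 \<le> \<kappa> / 2" using cs by simp
    have "(euc_norm ?x)^2 - ?m \<le> \<kappa> / 2 * (euc_norm a)^2"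
      by (rule order_trans[OF B_star_norm[OF sp N lam B a] mult_right_mono[OF s]]) simp
    then have "\<kappa> / 2 * (euc_norm a)^2 \<le> ?m" using k by linarith
    also have "\<dots> = ?m / (1 + lam) + lam / (1 + lam) * ?m" by (rule convex_weights_eq[OF lam, symmetric])
    also have "\<dots> \<le> ?x \<bullet> (D_inv N lam *\<^sub>v ?x)" unfolding D_inv_form[OF x]
      using lam sum_sq_le_euc_norm[OF x N] by (intro add_right_mono divide_right_mono) auto
    finally show ?thesis .
  qed
qed

section \<open>Deterministic analysis of the PPCA estimator\<close>

lemma smult_mat_mult_vec:
  assumes A: "A \<in> carrier_mat m n" and x: "x \<in> carrier_vec n"
  shows "(k \<cdot>\<^sub>m A) *\<^sub>v x = k \<cdot>\<^sub>v (A *\<^sub>v (x :: real Matrix.vec))"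
proof (rule eq_vecI)
  fix i assume "i < dim_vec (k \<cdot>\<^sub>v (A *\<^sub>v x))"
  then have i: "i < m" using A by simp
  have kA: "k \<cdot>\<^sub>m A \<in> carrier_mat m n" using A by simp
  have "((k \<cdot>\<^sub>m A) *\<^sub>v x) $ i = k * (A *\<^sub>v x) $ i"
    unfolding mult_mat_vec_index[OF kA x i] mult_mat_vec_index[OF A x i] sum_distrib_left
    using A i by (intro sum.cong) auto
  then show "((k \<cdot>\<^sub>m A) *\<^sub>v x) $ i = (k \<cdot>\<^sub>v (A *\<^sub>v x)) $ i" using A i by simp
qed (use A in simp)

text \<open>The form is a weighted sum of two kinds of squares, that of the length and that of the
  sum of entries; the scalar inequality \<open>sq\<close> is applied to each. It prevents noise
  \<open>v\<close> from cancelling a signal \<open>u\<close>.\<close>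

lemma D_inv_form_split:
  assumes u: "u \<in> carrier_vec N" and v: "v \<in> carrier_vec N" and lam: "0 < lam"
  shows "u \<bullet> (D_inv N lam *\<^sub>v u) \<le> 2 * ((u + v) \<bullet> (D_inv N lam *\<^sub>v (u + v))) + 2 * (v \<bullet> (D_inv N lam *\<^sub>v v))"
proof -
  have sq: "a^2 \<le> 2 * (a + b)^2 + 2 * b^2" for a b :: real
  proof -
    have "0 \<le> (a + 2 * b)^2" by simp
    then show ?thesis by (simp add: power2_eq_square algebra_simps)
  qed
  have uv: "u + v \<in> carrier_vec N" using u v by simp
  have div: "(2 * a + 2 * b) / d = 2 * (a / d) + 2 * (b / d)" for a b d :: real by (simp add: add_divide_distrib)
  have mul: "p * (2 * a + 2 * b) = 2 * (p * a) + 2 * (p * b)" for a b p :: real by (simp add: distrib_left)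
  have 1: "(euc_norm u)^2 \<le> 2 * (euc_norm (u + v))^2 + 2 * (euc_norm v)^2"
  proof -
    have "(\<Sum>i<N. (u $ i)^2) \<le> (\<Sum>i<N. 2 * (u $ i + v $ i)^2 + 2 * (v $ i)^2)" by (intro sum_mono sq)
    then show ?thesis using u v by (simp add: euc_norm_sq_sum sum.distrib sum_distrib_left)
  qed
  have 2: "(\<Sum>j<N. u $ j)^2 \<le> 2 * (\<Sum>j<N. (u + v) $ j)^2 + 2 * (\<Sum>j<N. v $ j)^2"
    using sq[of "\<Sum>j<N. u $ j" "\<Sum>j<N. v $ j"] u v by (simp add: sum.distrib)
  have 3: "(euc_norm u)^2 / (1 + lam) \<le> (2 * (euc_norm (u + v))^2 + 2 * (euc_norm v)^2) / (1 + lam)"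
    using 1 lam by (intro divide_right_mono) auto
  have 4: "lam / (1 + lam) * ((\<Sum>j<N. u $ j)^2 / real N)
      \<le> lam / (1 + lam) * ((2 * (\<Sum>j<N. (u + v) $ j)^2 + 2 * (\<Sum>j<N. v $ j)^2) / real N)"
    using 2 lam by (intro mult_left_mono divide_right_mono) auto
  have fin: "a + b \<le> 2 * (a1 + b1) + 2 * (a2 + b2)" if "a \<le> 2 * a1 + 2 * a2" "b \<le> 2 * b1 + 2 * b2"
    for a b a1 a2 b1 b2 :: real using that by (simp add: distrib_left)
  show ?thesis
    unfolding D_inv_form[OF u] D_inv_form[OF v] D_inv_form[OF uv]
    by (rule fin[OF 3[unfolded div] 4[unfolded div mul]])
qed

text \<open>One outcome of the sample. \<open>G\<close> and \<open>Q\<close> are the true and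
  estimated factors scaled to orthonormal columns, \<open>\<kappa>\<close> is the signal strength
  that the penalty leaves, and \<open>e1\<close>, \<open>e2\<close>, \<open>e3\<close> bound the
  three noise norms. That such bounds hold with high probability is shown separately.\<close>

locale ppca_event =
  fixes N T r :: nat and lam :: real and G Q E B X W :: "real mat" and \<kappa> \<beta> e1 e2 e3 c :: real
  assumes N: "0 < N" and T: "0 < T" and lam: "0 < lam" and rT: "r \<le> T"
    and G: "G \<in> carrier_mat T r" and GG: "G\<^sup>T * G = 1\<^sub>m r"
    and Q: "Q \<in> carrier_mat T r" and QQ: "Q\<^sup>T * Q = 1\<^sub>m r"
    and B: "B \<in> carrier_mat N r" and E: "E \<in> carrier_mat T N"
    and X: "X = sqrt (real T) \<cdot>\<^sub>m (G * B\<^sup>T) + E"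
    and W: "W = X * D_inv N lam * X\<^sup>T"
    and eig: "\<And>l. l < r \<Longrightarrow> eigenvector W (col Q l) (nth_eig W l)"
    and \<kappa>: "0 < \<kappa>" and c: "c = \<kappa> / 4"
    and sig: "\<And>a. a \<in> carrier_vec r \<Longrightarrow> \<kappa> * real N * (euc_norm a)^2 \<le> (B *\<^sub>v a) \<bullet> (D_inv N lam *\<^sub>v (B *\<^sub>v a))"
    and \<beta>: "0 < \<beta>" and B_le: "fro_norm B \<le> \<beta> * sqrt (real N)"
    and e1: "fro_norm (G\<^sup>T * E) \<le> e1" and e1_small: "e1^2 \<le> c * real N * real T"
    and e2: "fro_norm (E\<^sup>T * E * (D_inv N lam * B)) \<le> e2"
    and e3: "fro_norm (E\<^sup>T * E) \<le> e3" and e3_small: "e3 \<le> c * real N * real T / 2"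
      "real r * e3 \<le> 3 / 4 * (c * real N * real T)"
begin

lemma c_pos: "0 < c" using \<kappa> c by simp

lemma cNT_pos: "0 < c * real N * real T" using c_pos N T by simp

lemma X_carrier: "X \<in> carrier_mat T N"
  using G B E by (simp add: X)

lemma W_carrier: "W \<in> carrier_mat T T"
  unfolding W by (rule mult_carrier_mat[OF mult_carrier_mat[OF X_carrier D_inv_carrier]]) (simp add: X_carrier)

lemma W_sym: "W\<^sup>T = W"
proof -
  have XT: "X\<^sup>T \<in> carrier_mat N T" using X_carrier by simp
  have "W\<^sup>T = X * (X * D_inv N lam)\<^sup>T"
    unfolding W by (simp add: transpose_mult[OF mult_carrier_mat[OF X_carrier D_inv_carrier] XT])
  also have "\<dots> = X * (D_inv N lam * X\<^sup>T)"
    by (simp add: transpose_mult[OF X_carrier D_inv_carrier])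
  also have "\<dots> = W" unfolding W by (rule assoc_mult_mat[OF X_carrier D_inv_carrier XT, symmetric])
  finally show ?thesis .
qed

lemma X_mult: "y \<in> carrier_vec N \<Longrightarrow> X *\<^sub>v y = sqrt (real T) \<cdot>\<^sub>v (G *\<^sub>v (B\<^sup>T *\<^sub>v y)) + E *\<^sub>v y"
proof -
  assume y: "y \<in> carrier_vec N"
  have BT: "B\<^sup>T \<in> carrier_mat r N" using B by simp
  have GB: "G * B\<^sup>T \<in> carrier_mat T N" using G BT by simp
  have "X *\<^sub>v y = (sqrt (real T) \<cdot>\<^sub>m (G * B\<^sup>T)) *\<^sub>v y + E *\<^sub>v y"
    unfolding X by (rule add_mult_distrib_mat_vec[OF _ E y]) (use GB in simp)
  also have "(sqrt (real T) \<cdot>\<^sub>m (G * B\<^sup>T)) *\<^sub>v y = sqrt (real T) \<cdot>\<^sub>v ((G * B\<^sup>T) *\<^sub>v y)"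
    by (rule smult_mat_mult_vec[OF GB y])
  also have "(G * B\<^sup>T) *\<^sub>v y = G *\<^sub>v (B\<^sup>T *\<^sub>v y)"
    by (rule assoc_mult_mat_vec[OF G BT y])
  finally show ?thesis .
qed

lemma XT_mult: "x \<in> carrier_vec T \<Longrightarrow> X\<^sup>T *\<^sub>v x = sqrt (real T) \<cdot>\<^sub>v (B *\<^sub>v (G\<^sup>T *\<^sub>v x)) + E\<^sup>T *\<^sub>v x"
proof -
  assume x: "x \<in> carrier_vec T"
  have GT: "G\<^sup>T \<in> carrier_mat r T" and ET: "E\<^sup>T \<in> carrier_mat N T" using G E by simp_all
  have BG: "B * G\<^sup>T \<in> carrier_mat N T" using B GT by simp
  have "X\<^sup>T = sqrt (real T) \<cdot>\<^sub>m (B * G\<^sup>T) + E\<^sup>T"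
    by (rule eq_matI) (use G B E in \<open>auto simp: X scalar_prod_sum mult.commute intro!: sum.cong\<close>)
  then have "X\<^sup>T *\<^sub>v x = (sqrt (real T) \<cdot>\<^sub>m (B * G\<^sup>T)) *\<^sub>v x + E\<^sup>T *\<^sub>v x"
    using add_mult_distrib_mat_vec[OF _ ET x, of "sqrt (real T) \<cdot>\<^sub>m (B * G\<^sup>T)"] BG by simp
  also have "(sqrt (real T) \<cdot>\<^sub>m (B * G\<^sup>T)) *\<^sub>v x = sqrt (real T) \<cdot>\<^sub>v ((B * G\<^sup>T) *\<^sub>v x)"
    by (rule smult_mat_mult_vec[OF BG x])
  also have "(B * G\<^sup>T) *\<^sub>v x = B *\<^sub>v (G\<^sup>T *\<^sub>v x)"
    by (rule assoc_mult_mat_vec[OF B GT x])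
  finally show ?thesis .
qed

lemma W_mult: "x \<in> carrier_vec T \<Longrightarrow> W *\<^sub>v x = X *\<^sub>v (D_inv N lam *\<^sub>v (X\<^sup>T *\<^sub>v x))"
proof -
  assume x: "x \<in> carrier_vec T"
  have XT: "X\<^sup>T \<in> carrier_mat N T" using X_carrier by simp
  have XTx: "X\<^sup>T *\<^sub>v x \<in> carrier_vec N" by (rule mult_mat_vec_carrier[OF XT x])
  show ?thesis unfolding W assoc_mult_mat_vec[OF mult_carrier_mat[OF X_carrier D_inv_carrier] XT x]
    by (rule assoc_mult_mat_vec[OF X_carrier D_inv_carrier XTx])
qed

lemma W_form:
  assumes x: "x \<in> carrier_vec T"
  shows "x \<bullet> (W *\<^sub>v x) = (X\<^sup>T *\<^sub>v x) \<bullet> (D_inv N lam *\<^sub>v (X\<^sup>T *\<^sub>v x))"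
proof -
  have XTx: "X\<^sup>T *\<^sub>v x \<in> carrier_vec N" using X_carrier x by simp
  show ?thesis unfolding W_mult[OF x]
    by (rule transpose_vec_mult_scalar[OF X_carrier mult_mat_vec_carrier[OF D_inv_carrier XTx] x, symmetric])
qed

text \<open>\<open>X\<^sup>T\<close> maps \<open>G a\<close> to the signal \<open>sqrt T\<close>
  times \<open>B a\<close>, plus the noise \<open>E\<^sup>T G a\<close>. After
  \<open>D_inv_form_split\<close> the form is at least \<open>\<kappa> / 2 - c\<close> times
  \<open>N T\<close> and the squared length; \<open>c = \<kappa> / 4\<close> makes this equal to
  \<open>c\<close>.\<close>

lemma W_form_ge:
  assumes a: "a \<in> carrier_vec r"
  shows "c * real N * real T * (euc_norm a)^2 \<le> (G *\<^sub>v a) \<bullet> (W *\<^sub>v (G *\<^sub>v a))"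
proof -
  let ?x = "G *\<^sub>v a" and ?q = "\<lambda>v. v \<bullet> (D_inv N lam *\<^sub>v v)"
  have x: "?x \<in> carrier_vec T" using G a by simp
  have GT: "G\<^sup>T \<in> carrier_mat r T" and ET: "E\<^sup>T \<in> carrier_mat N T" using G E by simp_all
  have Ba: "B *\<^sub>v a \<in> carrier_vec N" using B a by simp
  let ?u = "sqrt (real T) \<cdot>\<^sub>v (B *\<^sub>v a)" and ?v = "E\<^sup>T *\<^sub>v ?x"
  have u: "?u \<in> carrier_vec N" and v: "?v \<in> carrier_vec N" using Ba ET x by simp_all
  have "G\<^sup>T *\<^sub>v ?x = (G\<^sup>T * G) *\<^sub>v a" by (rule assoc_mult_mat_vec[OF GT G a, symmetric])
  then have Xx: "X\<^sup>T *\<^sub>v ?x = ?u + ?v" unfolding XT_mult[OF x] GG using a by simp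
  have "?q ?u = real T * ?q (B *\<^sub>v a)"
    using Ba mult_mat_vec_carrier[OF D_inv_carrier Ba, of lam] T
    by (simp add: mult_mat_vec[OF D_inv_carrier Ba] mult.assoc[symmetric])
  then have qu: "real T * (\<kappa> * real N * (euc_norm a)^2) \<le> ?q ?u"
    using mult_left_mono[OF sig[OF a], of "real T"] by simp
  have "?v = (E\<^sup>T * G) *\<^sub>v a" by (rule assoc_mult_mat_vec[OF ET G a, symmetric])
  also have "E\<^sup>T * G = (G\<^sup>T * E)\<^sup>T"
    by (simp add: transpose_mult[OF GT E])
  finally have "euc_norm ?v \<le> fro_norm ((G\<^sup>T * E)\<^sup>T) * euc_norm a"
    using euc_norm_mult_le[of "(G\<^sup>T * E)\<^sup>T" N r a] GT E a by simp
  also have "\<dots> \<le> e1 * euc_norm a" using e1 by (intro mult_right_mono) simp_all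
  finally have "(euc_norm ?v)^2 \<le> (e1 * euc_norm a)^2" by (intro power_mono) simp_all
  also have "\<dots> \<le> c * real N * real T * (euc_norm a)^2"
    unfolding power_mult_distrib using e1_small by (intro mult_right_mono) simp_all
  finally have qv: "?q ?v \<le> c * real N * real T * (euc_norm a)^2"
    using D_inv_form_le[OF v N lam] by linarith
  have "?q ?u \<le> 2 * ?q (?u + ?v) + 2 * ?q ?v" by (rule D_inv_form_split[OF u v lam])
  then show ?thesis unfolding W_form[OF x] Xx using qu qv unfolding c by (simp add: algebra_simps)
qed

lemma W_eig_ge:
  assumes "l < r"
  shows "c * real N * real T \<le> nth_eig W l"
  by (rule nth_eig_ge_subspace[OF W_carrier W_sym G GG rT _ assms]) (rule W_form_ge)

text \<open>\<open>nth_eig\<close> reads off the roots of a characteristic polynomial. Instead of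
  tracking how these scale with the matrix, the subspace bound is applied afresh.\<close>

lemma scaled_eig_ge:
  assumes l: "l < r"
  shows "c \<le> nth_eig ((1 / (real N * real T)) \<cdot>\<^sub>m W) l"
proof (rule nth_eig_ge_subspace[OF _ _ G GG rT _ l])
  let ?s = "1 / (real N * real T)"
  show "?s \<cdot>\<^sub>m W \<in> carrier_mat T T" using W_carrier by simp
  show "(?s \<cdot>\<^sub>m W)\<^sup>T = ?s \<cdot>\<^sub>m W"
  proof -
    have "(?s \<cdot>\<^sub>m W)\<^sup>T = ?s \<cdot>\<^sub>m W\<^sup>T" by (rule eq_matI) auto
    then show ?thesis by (simp add: W_sym)
  qed
  fix a :: "real Matrix.vec" assume a: "a \<in> carrier_vec r"
  let ?x = "G *\<^sub>v a"
  have x: "?x \<in> carrier_vec T" using G a by simp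
  have "(?s \<cdot>\<^sub>m W) *\<^sub>v ?x = ?s \<cdot>\<^sub>v (W *\<^sub>v ?x)" by (rule smult_mat_mult_vec[OF W_carrier x])
  then have "?x \<bullet> ((?s \<cdot>\<^sub>m W) *\<^sub>v ?x) = ?s * (?x \<bullet> (W *\<^sub>v ?x))"
    using x mult_mat_vec_carrier[OF W_carrier x] by simp
  moreover have "?s * (c * real N * real T * (euc_norm a)^2) \<le> ?s * (?x \<bullet> (W *\<^sub>v ?x))"
    by (rule mult_left_mono[OF W_form_ge[OF a]]) simp
  moreover have "?s * (c * real N * real T * (euc_norm a)^2) = c * (euc_norm a)^2" using N T by simp
  ultimately show "c * (euc_norm a)^2 \<le> ?x \<bullet> ((?s \<cdot>\<^sub>m W) *\<^sub>v ?x)" by linarith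
qed

section \<open>Noise along the leading eigenvectors\<close>

text \<open>\<open>sqrt T\<close> times column \<open>l\<close> of the estimated loadings.
  \<open>X\<close> maps it back to the eigenvalue times the eigenvector, so it links the loadings
  with both factor spaces.\<close>

definition y :: "nat \<Rightarrow> real Matrix.vec" where
  "y l = D_inv N lam *\<^sub>v (X\<^sup>T *\<^sub>v col Q l)"

lemma q_carrier: "l < r \<Longrightarrow> col Q l \<in> carrier_vec T"
  using Q by (intro carrier_vecI) simp

lemma q_norm: "l < r \<Longrightarrow> euc_norm (col Q l) = 1"
proof -
  assume l: "l < r"
  have "col Q l \<bullet> col Q l = (Q\<^sup>T * Q) $$ (l,l)" using Q l by simp
  then have "(euc_norm (col Q l))^2 = 1" unfolding euc_norm_sq QQ using l by simp
  then show ?thesis using euc_norm_nonneg[of "col Q l"] by (simp add: power2_eq_1_iff)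
qed

lemma y_carrier: "l < r \<Longrightarrow> y l \<in> carrier_vec N"
  unfolding y_def using X_carrier q_carrier
  by (intro mult_mat_vec_carrier[OF D_inv_carrier]) simp

lemma X_y: "l < r \<Longrightarrow> X *\<^sub>v y l = nth_eig W l \<cdot>\<^sub>v col Q l"
  unfolding y_def using W_mult[OF q_carrier] eig[of l] by (simp add: eigenvector_def)

text \<open>The form of \<open>D_inv\<close> at \<open>X\<^sup>T q\<close> is the form of
  \<open>W\<close> at the unit eigenvector \<open>q\<close>, that is, the eigenvalue; and
  \<open>D_inv_norm_le_form\<close> bounds the norm by that form.\<close>

lemma y_norm_sq: "l < r \<Longrightarrow> (euc_norm (y l))\<^sup>2 \<le> nth_eig W l"
proof -
  assume l: "l < r"
  let ?q = "col Q l"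
  have q: "?q \<in> carrier_vec T" by (rule q_carrier[OF l])
  have "X\<^sup>T *\<^sub>v ?q \<in> carrier_vec N" using X_carrier q by simp
  then have "(euc_norm (y l))^2 \<le> ?q \<bullet> (W *\<^sub>v ?q)"
    unfolding W_form[OF q] y_def by (rule D_inv_norm_le_form[OF _ N lam])
  also have "W *\<^sub>v ?q = nth_eig W l \<cdot>\<^sub>v ?q" using eig[OF l] by (simp add: eigenvector_def)
  also have "?q \<bullet> (nth_eig W l \<cdot>\<^sub>v ?q) = nth_eig W l * (euc_norm ?q)^2"
    using q by (simp add: euc_norm_sq)
  finally show ?thesis by (simp add: q_norm[OF l])
qed

lemma eig_pos: "l < r \<Longrightarrow> 0 < nth_eig W l"
  using W_eig_ge[of l] cNT_pos by linarith

lemma y_norm: "l < r \<Longrightarrow> euc_norm (y l) \<le> sqrt (nth_eig W l)"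
  using y_norm_sq by (intro real_le_rsqrt)

lemma y_eq: "l < r \<Longrightarrow> y l = sqrt (real T) \<cdot>\<^sub>v ((D_inv N lam * B) *\<^sub>v (G\<^sup>T *\<^sub>v col Q l))
    + D_inv N lam *\<^sub>v (E\<^sup>T *\<^sub>v col Q l)"
proof -
  assume l: "l < r"
  let ?q = "col Q l"
  have q: "?q \<in> carrier_vec T" by (rule q_carrier[OF l])
  have g: "G\<^sup>T *\<^sub>v ?q \<in> carrier_vec r" and z: "E\<^sup>T *\<^sub>v ?q \<in> carrier_vec N" using G E q by simp_all
  have Bg: "B *\<^sub>v (G\<^sup>T *\<^sub>v ?q) \<in> carrier_vec N" by (rule mult_mat_vec_carrier[OF B g])
  show ?thesis unfolding y_def XT_mult[OF q]
    using mult_add_distrib_mat_vec[OF D_inv_carrier _ z, of "sqrt (real T) \<cdot>\<^sub>v (B *\<^sub>v (G\<^sup>T *\<^sub>v ?q))"] Bg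
      mult_mat_vec[OF D_inv_carrier Bg] assoc_mult_mat_vec[OF D_inv_carrier B g] by simp
qed

text \<open>What the eigenvector equation leaves after division by the eigenvalue, which is at least
  \<open>c * N * T\<close>. The outer factors 2 stem from absorbing half of the left side.\<close>

definition \<zeta> :: real where
  "\<zeta> = 2 * (e1 * \<beta> / sqrt c) + 2 * (e2 / (c * real N * sqrt (real T)))"

text \<open>The quantity to be bounded occurs on both sides of the estimate; the condition on \<open>e3\<close> makes
  its coefficient on the right at most one half.\<close>

lemma noise_projection_le:
  assumes l: "l < r"
  shows "euc_norm (E\<^sup>T *\<^sub>v col Q l) \<le> \<zeta>"
proof -
  let ?q = "col Q l" and ?w = "nth_eig W l"
  let ?EE = "E\<^sup>T * E" and ?EG = "E\<^sup>T * G" and ?DB = "D_inv N lam * B" and ?e = "E\<^sup>T *\<^sub>v ?q"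
  let ?b = "B\<^sup>T *\<^sub>v y l" and ?t = "sqrt (real T)" and ?n = "sqrt (real N)" and ?D = "D_inv N lam"
  define z where "z = euc_norm ?e"
  have q: "?q \<in> carrier_vec T" by (rule q_carrier[OF l])
  have yc: "y l \<in> carrier_vec N" by (rule y_carrier[OF l])
  have w: "0 < ?w" "c * real N * real T \<le> ?w" using eig_pos[OF l] W_eig_ge[OF l] .
  have ET: "E\<^sup>T \<in> carrier_mat N T" and GT: "G\<^sup>T \<in> carrier_mat r T"
    and BT: "B\<^sup>T \<in> carrier_mat r N" using E G B by simp_all
  have By: "?b \<in> carrier_vec r" by (rule mult_mat_vec_carrier[OF BT yc])
  have GBy: "G *\<^sub>v ?b \<in> carrier_vec T" by (rule mult_mat_vec_carrier[OF G By])
  have Ey: "E *\<^sub>v y l \<in> carrier_vec T" by (rule mult_mat_vec_carrier[OF E yc])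
  have EEc: "?EE \<in> carrier_mat N N" by (rule mult_carrier_mat[OF ET E])
  have DB: "?DB \<in> carrier_mat N r" by (rule mult_carrier_mat[OF D_inv_carrier B])
  \<comment> \<open>\<open>E\<^sup>T\<close> applied to the eigenvector equation
    \<open>X y = w q\<close>, with \<open>X\<close> split into factor part and noise.\<close>
  have ev: "?w \<cdot>\<^sub>v ?e = ?t \<cdot>\<^sub>v (?EG *\<^sub>v ?b) + ?EE *\<^sub>v y l"
  proof -
    have "?w \<cdot>\<^sub>v ?e = E\<^sup>T *\<^sub>v (X *\<^sub>v y l)"
      unfolding X_y[OF l] using mult_mat_vec[OF ET q] by simp
    also have "\<dots> = E\<^sup>T *\<^sub>v (?t \<cdot>\<^sub>v (G *\<^sub>v ?b)) + E\<^sup>T *\<^sub>v (E *\<^sub>v y l)"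
      unfolding X_mult[OF yc] by (rule mult_add_distrib_mat_vec[OF ET _ Ey]) (use GBy in simp)
    also have "E\<^sup>T *\<^sub>v (?t \<cdot>\<^sub>v (G *\<^sub>v ?b))
        = ?t \<cdot>\<^sub>v (?EG *\<^sub>v ?b)"
      unfolding mult_mat_vec[OF ET GBy] assoc_mult_mat_vec[OF ET G By] ..
    also have "E\<^sup>T *\<^sub>v (E *\<^sub>v y l) = ?EE *\<^sub>v y l"
      by (rule assoc_mult_mat_vec[OF ET E yc, symmetric])
    finally show ?thesis .
  qed
  have EG: "fro_norm ?EG \<le> e1"
  proof -
    have "?EG = (G\<^sup>T * E)\<^sup>T" by (simp add: transpose_mult[OF GT E])
    then show ?thesis using e1 by simp
  qed
  have e10: "0 \<le> e1" and e20: "0 \<le> e2" and e30: "0 \<le> e3" using e1 e2 e3 fro_norm_nonneg order_trans by blast+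
  have part1: "euc_norm (?EG *\<^sub>v ?b) \<le> e1 * (\<beta> * ?n * sqrt ?w)"
  proof -
    have "euc_norm (?EG *\<^sub>v ?b) \<le> fro_norm ?EG * euc_norm ?b"
      by (rule euc_norm_mult_le[OF mult_carrier_mat[OF ET G] By])
    also have "\<dots> \<le> e1 * (fro_norm (B\<^sup>T) * euc_norm (y l))"
      by (intro mult_mono EG euc_norm_mult_le[OF BT yc] e10) simp
    also have "\<dots> \<le> e1 * (\<beta> * ?n * sqrt ?w)"
      using B_le y_norm[OF l] \<beta> by (intro mult_left_mono[OF _ e10] mult_mono) simp_all
    finally show ?thesis .
  qed
  have part2: "euc_norm (?EE *\<^sub>v y l) \<le> ?t * e2 + e3 * z"
  proof -
    let ?g = "G\<^sup>T *\<^sub>v ?q"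
    have g: "?g \<in> carrier_vec r" by (rule mult_mat_vec_carrier[OF GT q])
    have gn: "euc_norm ?g \<le> 1" using euc_norm_transpose_isometry_le[OF G q GG] q_norm[OF l] by simp
    have zc: "?e \<in> carrier_vec N" by (rule mult_mat_vec_carrier[OF ET q])
    have DBg: "?DB *\<^sub>v ?g \<in> carrier_vec N" by (rule mult_mat_vec_carrier[OF DB g])
    have Dz: "?D *\<^sub>v ?e \<in> carrier_vec N" by (rule mult_mat_vec_carrier[OF D_inv_carrier zc])
    \<comment> \<open>Splitting \<open>y\<close> as well brings \<open>?e\<close> back, shrunk by
      \<open>D_inv\<close>; this is the term to be absorbed.\<close>
    have "?EE *\<^sub>v y l = ?EE *\<^sub>v (?t \<cdot>\<^sub>v (?DB *\<^sub>v ?g)) + ?EE *\<^sub>v (?D *\<^sub>v ?e)"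
      unfolding y_eq[OF l] by (rule mult_add_distrib_mat_vec[OF EEc _ Dz]) (use DBg in simp)
    also have "?EE *\<^sub>v (?t \<cdot>\<^sub>v (?DB *\<^sub>v ?g)) = ?t \<cdot>\<^sub>v ((?EE * ?DB) *\<^sub>v ?g)"
      unfolding mult_mat_vec[OF EEc DBg] assoc_mult_mat_vec[OF EEc DB g] ..
    finally have eq: "?EE *\<^sub>v y l = ?t \<cdot>\<^sub>v ((?EE * ?DB) *\<^sub>v ?g) + ?EE *\<^sub>v (?D *\<^sub>v ?e)" .
    have "euc_norm ((?EE * ?DB) *\<^sub>v ?g) \<le> fro_norm (?EE * ?DB) * euc_norm ?g"
      by (rule euc_norm_mult_le[OF mult_carrier_mat[OF EEc DB] g])
    also have "\<dots> \<le> e2 * 1" by (intro mult_mono e2 gn e20) simp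
    finally have p1: "euc_norm ((?EE * ?DB) *\<^sub>v ?g) \<le> e2" by simp
    have "euc_norm (?EE *\<^sub>v (?D *\<^sub>v ?e)) \<le> fro_norm ?EE * euc_norm (?D *\<^sub>v ?e)"
      by (rule euc_norm_mult_le[OF EEc Dz])
    also have "\<dots> \<le> e3 * z" unfolding z_def by (intro mult_mono e3 D_inv_norm_le[OF zc N lam] e30) simp
    finally have p2: "euc_norm (?EE *\<^sub>v (?D *\<^sub>v ?e)) \<le> e3 * z" .
    have "euc_norm (?EE *\<^sub>v y l) \<le> euc_norm (?t \<cdot>\<^sub>v ((?EE * ?DB) *\<^sub>v ?g)) + euc_norm (?EE *\<^sub>v (?D *\<^sub>v ?e))"
      unfolding eq by (rule euc_norm_triangle) simp
    also have "\<dots> \<le> ?t * e2 + e3 * z" using p1 p2 by (intro add_mono) (auto intro: mult_left_mono)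
    finally show ?thesis .
  qed
  have "?w * z = euc_norm (?w \<cdot>\<^sub>v ?e)" unfolding z_def using w by simp
  also have "\<dots> \<le> euc_norm (?t \<cdot>\<^sub>v (?EG *\<^sub>v ?b)) + euc_norm (?EE *\<^sub>v y l)"
    unfolding ev by (rule euc_norm_triangle) simp
  also have "\<dots> \<le> ?t * (e1 * (\<beta> * ?n * sqrt ?w)) + (?t * e2 + e3 * z)"
    using part1 part2 by (intro add_mono) (auto intro: mult_left_mono)
  finally have wz: "?w * z \<le> ?t * (e1 * (\<beta> * ?n * sqrt ?w)) + (?t * e2 + e3 * z)" .
  have z0: "0 \<le> z" by (simp add: z_def)
  have "e3 * z \<le> ?w / 2 * z" using e3_small(1) w(2) z0 by (intro mult_right_mono) auto
  then have "?w * z \<le> 2 * (?t * (e1 * (\<beta> * ?n * sqrt ?w))) + 2 * (?t * e2)"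
    using wz by linarith
  then have "z \<le> (2 * (?t * (e1 * (\<beta> * ?n * sqrt ?w))) + 2 * (?t * e2)) / ?w"
    using w(1) by (simp add: pos_le_divide_eq mult.commute)
  \<comment> \<open>The norm of \<open>y\<close> contributed \<open>sqrt w\<close> to the first
    term, so only a square root of the eigenvalue is left in its denominator; the second term is
    divided by the full eigenvalue.\<close>
  also have "\<dots> = 2 * (e1 * \<beta> * (sqrt (real N * real T) / sqrt ?w)) + 2 * (?t * e2 / ?w)"
  proof -
    have d: "x * sqrt ?w / ?w = x / sqrt ?w" for x
    proof -
      have "x * sqrt ?w / (sqrt ?w * sqrt ?w) = x / sqrt ?w" using w(1) by (intro mult_divide_mult_cancel_right) simp
      then show ?thesis using w(1) by simp
    qed
    have m: "2 * (?t * (e1 * (\<beta> * ?n * sqrt ?w))) = 2 * (?t * (e1 * (\<beta> * ?n))) * sqrt ?w"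
      by simp
    show ?thesis unfolding m add_divide_distrib d by (simp add: real_sqrt_mult mult_ac)
  qed
  also have "\<dots> \<le> \<zeta>" unfolding \<zeta>_def
  proof (intro add_mono mult_left_mono)
    have "sqrt (real N * real T) / sqrt ?w \<le> sqrt (real N * real T) / sqrt (c * real N * real T)"
      using w cNT_pos by (intro divide_left_mono) auto
    also have "\<dots> = 1 / sqrt c" using N T c_pos by (simp add: real_sqrt_mult field_simps)
    finally have "e1 * \<beta> * (sqrt (real N * real T) / sqrt ?w) \<le> e1 * \<beta> * (1 / sqrt c)"
      using e10 \<beta> by (intro mult_left_mono) auto
    then show "e1 * \<beta> * (sqrt (real N * real T) / sqrt ?w) \<le> e1 * \<beta> / sqrt c" by simp
    have "?t * e2 / ?w \<le> ?t * e2 / (c * real N * real T)"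
      using w cNT_pos e20 by (intro divide_left_mono) auto
    also have "\<dots> = e2 / (c * real N * ?t)"
    proof -
      have "c * real N * real T = ?t * (c * real N * ?t)" using T by simp
      then show ?thesis using T by (metis mult_divide_mult_cancel_left of_nat_0_less_iff less_numeral_extra(3) real_sqrt_eq_zero_cancel_iff)
    qed
    finally show "?t * e2 / ?w \<le> e2 / (c * real N * ?t)" .
  qed simp_all
  finally show ?thesis unfolding z_def .
qed

end

section \<open>Comparison of the true and the estimated factor space\<close>

lemma abs_index_le_euc_norm:
  assumes "i < dim_vec v"
  shows "\<bar>v $ i\<bar> \<le> euc_norm v"
proof (rule power2_le_imp_le)
  show "\<bar>v $ i\<bar>\<^sup>2 \<le> (euc_norm v)^2"
    unfolding euc_norm_sq_sum power2_abs using assms by (intro member_le_sum[of i "{..<dim_vec v}" "\<lambda>i. (v $ i)^2"]) auto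
qed simp

text \<open>\<open>G (G\<^sup>T x)\<close> is the point of the column space nearest to
  \<open>x\<close>. The slack is the squared length of \<open>G\<^sup>T x - b\<close>.\<close>

lemma projection_residual_le:
  assumes G: "G \<in> carrier_mat m n" and GG: "G\<^sup>T * G = 1\<^sub>m n"
    and x: "x \<in> carrier_vec m" and b: "b \<in> carrier_vec n"
  shows "(euc_norm x)^2 - (euc_norm (G\<^sup>T *\<^sub>v x))^2 \<le> (euc_norm (x - G *\<^sub>v b))^2"
proof -
  let ?g = "G\<^sup>T *\<^sub>v x"
  have g: "?g \<in> carrier_vec n" and Gb: "G *\<^sub>v b \<in> carrier_vec m" using G x b by simp_all
  have "x \<bullet> (G *\<^sub>v b) = ?g \<bullet> b" by (rule transpose_vec_mult_scalar[OF G b x, symmetric])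
  moreover have "(G *\<^sub>v b) \<bullet> x = x \<bullet> (G *\<^sub>v b)" by (rule comm_scalar_prod[OF Gb x])
  moreover have "(G *\<^sub>v b) \<bullet> (G *\<^sub>v b) = b \<bullet> b"
    using euc_norm_isometry[OF G b GG] by (simp flip: euc_norm_sq)
  moreover have "0 \<le> (euc_norm (?g - b))^2" by simp
  moreover have "b \<bullet> ?g = ?g \<bullet> b" by (rule comm_scalar_prod[OF b g])
  ultimately show ?thesis unfolding euc_norm_sq using x g b Gb
    by (simp add: minus_scalar_prod_distrib[of _ m] scalar_prod_minus_distrib[of _ m]
        minus_scalar_prod_distrib[of _ n] scalar_prod_minus_distrib[of _ n])
qed

lemma d_sep_le:
  assumes part: "partition_on {..<N} \<G>" and "A \<in> \<G>" "A' \<in> \<G>" "A \<noteq> A'" "i \<in> A" "j \<in> A'"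
  shows "d_sep \<G> B H \<le> euc_norm (H\<^sup>T *\<^sub>v (row B i - row B j))"
  unfolding d_sep_def
proof (rule Min_le)
  let ?S = "{euc_norm (H\<^sup>T *\<^sub>v (row B i - row B j)) |i j A A'.
           A \<in> \<G> \<and> A' \<in> \<G> \<and> A \<noteq> A' \<and> i \<in> A \<and> j \<in> A'}"
  let ?f = "\<lambda>(i,j). euc_norm (H\<^sup>T *\<^sub>v (row B i - row B j))"
  have "?S \<subseteq> ?f ` ({..<N} \<times> {..<N})"
  proof
    fix x assume "x \<in> ?S"
    then obtain i j A A' where x: "x = ?f (i,j)" and "A \<in> \<G>" "A' \<in> \<G>" "i \<in> A" "j \<in> A'" by auto
    then have "(i,j) \<in> {..<N} \<times> {..<N}" unfolding partition_onD1[OF part] by auto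
    then show "x \<in> ?f ` ({..<N} \<times> {..<N})" unfolding x by (rule imageI)
  qed
  then show "finite ?S" by (rule finite_subset) simp
  show "euc_norm (H\<^sup>T *\<^sub>v (row B i - row B j)) \<in> ?S"
    unfolding mem_Collect_eq by (rule exI[of _ i], rule exI[of _ j], rule exI[of _ A], rule exI[of _ A']) (use assms in simp)
qed

context ppca_event
begin

text \<open>The eigenvector equation exhibits a point of the column space of \<open>G\<close> at
  distance \<open>|E y| / w\<close> from the eigenvector, with \<open>w\<close> the eigenvalue. Its
  square is at most \<open>e3 / w\<close>, because the Gram bound costs \<open>e3\<close> and the
  squared length of \<open>y\<close> is at most \<open>w\<close>.\<close>

lemma q_near_factors:
  assumes l: "l < r"
  shows "1 - e3 / (c * real N * real T) \<le> (euc_norm (G\<^sup>T *\<^sub>v col Q l))^2"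
proof -
  let ?q = "col Q l" and ?w = "nth_eig W l"
  have q: "?q \<in> carrier_vec T" and yc: "y l \<in> carrier_vec N" using q_carrier y_carrier l by auto
  have w: "0 < ?w" "c * real N * real T \<le> ?w" using eig_pos[OF l] W_eig_ge[OF l] .
  have e30: "0 \<le> e3" using e3 fro_norm_nonneg order_trans by blast
  have By: "B\<^sup>T *\<^sub>v y l \<in> carrier_vec r" using B yc by simp
  define b where "b = (sqrt (real T) / ?w) \<cdot>\<^sub>v (B\<^sup>T *\<^sub>v y l)"
  have b: "b \<in> carrier_vec r" using By by (simp add: b_def)
  have GBy: "G *\<^sub>v (B\<^sup>T *\<^sub>v y l) \<in> carrier_vec T" by (rule mult_mat_vec_carrier[OF G By])
  have Ey: "E *\<^sub>v y l \<in> carrier_vec T" by (rule mult_mat_vec_carrier[OF E yc])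
  have "?q - G *\<^sub>v b = (1 / ?w) \<cdot>\<^sub>v (E *\<^sub>v y l)"
  proof (rule eq_vecI)
    fix i assume "i < dim_vec ((1 / ?w) \<cdot>\<^sub>v (E *\<^sub>v y l))"
    then have i: "i < T" using E by simp
    have "?w * ?q $ i = (X *\<^sub>v y l) $ i" unfolding X_y[OF l] using i carrier_vecD[OF q] by (simp del: index_col)
    also have "\<dots> = sqrt (real T) * (G *\<^sub>v (B\<^sup>T *\<^sub>v y l)) $ i + (E *\<^sub>v y l) $ i"
      unfolding X_mult[OF yc] using i carrier_vecD[OF GBy] carrier_vecD[OF Ey] by (simp del: index_mult_mat_vec)
    finally have "?q $ i = (sqrt (real T) * (G *\<^sub>v (B\<^sup>T *\<^sub>v y l)) $ i + (E *\<^sub>v y l) $ i) / ?w"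
      using w(1) by (metis nonzero_mult_div_cancel_left less_irrefl)
    moreover have "(G *\<^sub>v b) $ i = (sqrt (real T) / ?w) * (G *\<^sub>v (B\<^sup>T *\<^sub>v y l)) $ i"
      unfolding b_def mult_mat_vec[OF G By] using i carrier_vecD[OF GBy] by (simp del: index_mult_mat_vec)
    moreover have "dim_vec (G *\<^sub>v b) = T" using G by simp
    ultimately show "(?q - G *\<^sub>v b) $ i = ((1 / ?w) \<cdot>\<^sub>v (E *\<^sub>v y l)) $ i"
      using i carrier_vecD[OF q] carrier_vecD[OF Ey]
      by (simp add: add_divide_distrib del: index_mult_mat_vec index_col)
  qed (use Q G E in simp)
  then have "1 - (euc_norm (G\<^sup>T *\<^sub>v ?q))^2 \<le> (euc_norm ((1 / ?w) \<cdot>\<^sub>v (E *\<^sub>v y l)))^2"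
    using projection_residual_le[OF G GG q b] q_norm[OF l] by simp
  also have "\<dots> = (euc_norm (E *\<^sub>v y l))^2 / ?w\<^sup>2" by (simp add: power_divide)
  also have "\<dots> \<le> (e3 * ?w) / ?w\<^sup>2"
  proof (intro divide_right_mono)
    have "(euc_norm (E *\<^sub>v y l))^2 \<le> fro_norm (E\<^sup>T * E) * (euc_norm (y l))^2"
      by (rule euc_norm_mult_gram_le[OF E yc])
    also have "\<dots> \<le> e3 * ?w" by (intro mult_mono e3 y_norm_sq[OF l] e30) simp
    finally show "(euc_norm (E *\<^sub>v y l))^2 \<le> e3 * ?w" .
  qed simp
  also have "\<dots> = e3 / ?w" using w(1) by (simp add: power2_eq_square)
  also have "\<dots> \<le> e3 / (c * real N * real T)" using w cNT_pos e30 by (intro divide_left_mono) auto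
  finally show ?thesis by simp
qed

text \<open>\<open>G\<close> and \<open>Q\<close> have equally many orthonormal columns, so \<open>(1 - Q Q\<^sup>T) G\<close> and \<open>(1 - G G\<^sup>T) Q\<close> have the
  same Frobenius norm.\<close>

lemma signal_ge:
  assumes v: "v \<in> carrier_vec r"
  shows "euc_norm v \<le> 2 * euc_norm (Q\<^sup>T *\<^sub>v (G *\<^sub>v v))"
proof -
  let ?P = "Q\<^sup>T * G"
  let ?QP = "Q * ?P" and ?s = "Q\<^sup>T *\<^sub>v (G *\<^sub>v v)" and ?c = "\<lambda>l. Q\<^sup>T *\<^sub>v col G l"
  have QT: "Q\<^sup>T \<in> carrier_mat r T" and GT: "G\<^sup>T \<in> carrier_mat r T" using Q G by simp_all
  have QTG: "?P \<in> carrier_mat r r" by (rule mult_carrier_mat[OF QT G])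
  define K where "K = G - ?QP"
  have QQG: "?QP \<in> carrier_mat T r" by (rule mult_carrier_mat[OF Q QTG])
  have K: "K \<in> carrier_mat T r" unfolding K_def by (rule minus_carrier_mat[OF QQG])
  have Gv: "G *\<^sub>v v \<in> carrier_vec T" by (rule mult_mat_vec_carrier[OF G v])
  have Kv: "K *\<^sub>v v = G *\<^sub>v v - Q *\<^sub>v ?s"
    unfolding K_def minus_mult_distrib_mat_vec[OF G QQG v] assoc_mult_mat_vec[OF Q QTG v] assoc_mult_mat_vec[OF QT G v] ..
  have colK: "(euc_norm (col K l))^2 = 1 - (euc_norm (?c l))^2" if l: "l < r" for l
  proof -
    have g: "col G l \<in> carrier_vec T" using G by (intro carrier_vecI) simp
    have "col G l \<bullet> col G l = (G\<^sup>T * G) $$ (l,l)" using G l by simp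
    then have gn: "(euc_norm (col G l))^2 = 1" unfolding euc_norm_sq GG using l by simp
    have "col K l = col G l - Q *\<^sub>v (?c l)"
    proof -
      have "col K l = col G l - col ?QP l"
        unfolding K_def using carrier_matD[OF QQG] carrier_matD[OF G] l by (intro eq_vecI) (simp_all del: index_mult_mat)
      also have "col ?QP l = Q *\<^sub>v (?c l)"
        unfolding col_mult2[OF Q QTG l] col_mult2[OF QT G l] ..
      finally show ?thesis .
    qed
    then show ?thesis using projection_pythagoras[OF Q g QQ] gn by simp
  qed
  have "(fro_norm K)^2 = (\<Sum>l<r. 1 - (euc_norm (?c l))^2)"
    unfolding fro_norm_sq_cols using K colK by simp
  also have "\<dots> = real r - (\<Sum>l<r. (euc_norm (?c l))^2)" by (simp add: sum_subtractf)
  also have "(\<Sum>l<r. (euc_norm (?c l))^2) = (fro_norm ?P)^2"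
    unfolding fro_norm_sq_cols using G by (simp add: col_mult2[OF QT G])
  also have "\<dots> = (fro_norm (G\<^sup>T * Q))^2"
  proof -
    have "?P = (G\<^sup>T * Q)\<^sup>T" by (simp add: transpose_mult[OF GT Q])
    then show ?thesis by simp
  qed
  also have "\<dots> = (\<Sum>l<r. (euc_norm (G\<^sup>T *\<^sub>v col Q l))^2)"
    unfolding fro_norm_sq_cols using Q by (simp add: col_mult2[OF GT Q])
  finally have "(fro_norm K)^2 = real r - (\<Sum>l<r. (euc_norm (G\<^sup>T *\<^sub>v col Q l))^2)" .
  moreover have "(\<Sum>l<r. 1 - e3 / (c * real N * real T)) \<le> (\<Sum>l<r. (euc_norm (G\<^sup>T *\<^sub>v col Q l))^2)"
    by (intro sum_mono q_near_factors) simp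
  moreover have "(\<Sum>l<r. 1 - e3 / (c * real N * real T)) = real r - real r * e3 / (c * real N * real T)"
    by (simp add: right_diff_distrib)
  moreover have "real r * e3 / (c * real N * real T) \<le> 3 / 4"
    using e3_small(2) cNT_pos by (simp add: divide_le_eq)
  ultimately have K34: "(fro_norm K)^2 \<le> 3 / 4" by linarith
  \<comment> \<open>By Pythagoras, what \<open>Q\<^sup>T G\<close> loses of \<open>v\<close> is the
    length of \<open>K v\<close>. The bound \<open>3 / 4\<close> on the squared norm of
    \<open>K\<close> leaves a quarter of the squared length, hence the factor 2 in the
    claim.\<close>
  have "(euc_norm v)^2 - (euc_norm ?s)^2 = (euc_norm (K *\<^sub>v v))^2"
    unfolding Kv projection_pythagoras[OF Q Gv QQ] euc_norm_isometry[OF G v GG] ..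
  also have "\<dots> \<le> (fro_norm K * euc_norm v)^2" by (intro power_mono euc_norm_mult_le[OF K v]) simp
  also have "\<dots> \<le> 3 / 4 * (euc_norm v)^2"
    unfolding power_mult_distrib by (intro mult_right_mono K34) simp
  finally have "(euc_norm v)^2 \<le> (2 * euc_norm ?s)^2"
    unfolding power_mult_distrib by simp
  then show ?thesis by (rule power2_le_imp_le) simp
qed

section \<open>Boundedness of the rotation in the separation\<close>

lemma euc_norm_B_le: "v \<in> carrier_vec r \<Longrightarrow> euc_norm (B *\<^sub>v v) \<le> \<beta> * sqrt (real N) * euc_norm v"
  using euc_norm_mult_le[OF B] mult_right_mono[OF B_le, of "euc_norm v"] by force

lemma euc_norm_BT_le:
  assumes v: "v \<in> carrier_vec N"
  shows "euc_norm (B\<^sup>T *\<^sub>v v) \<le> \<beta> * sqrt (real N) * euc_norm v"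
proof -
  have "euc_norm (B\<^sup>T *\<^sub>v v) \<le> fro_norm (B\<^sup>T) * euc_norm v"
    using B v by (intro euc_norm_mult_le[of _ r N]) simp_all
  also have "\<dots> \<le> \<beta> * sqrt (real N) * euc_norm v" using B_le by (intro mult_right_mono) simp_all
  finally show ?thesis .
qed

lemma Omega_carrier: "Omega_mat N lam B \<in> carrier_mat r r"
  unfolding Omega_mat_def minv_D_mat[OF N lam] using mult_carrier_mat[OF mult_carrier_mat[OF _ D_inv_carrier] B] B by simp

lemma Omega_bound:
  assumes v: "v \<in> carrier_vec r"
  shows "euc_norm (Omega_mat N lam B *\<^sub>v v) \<le> \<beta>^2 * euc_norm v"
proof -
  have BT: "B\<^sup>T \<in> carrier_mat r N" using B by simp
  have BTD: "B\<^sup>T * D_inv N lam \<in> carrier_mat r N" by (rule mult_carrier_mat[OF BT D_inv_carrier])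
  have Bv: "B *\<^sub>v v \<in> carrier_vec N" by (rule mult_mat_vec_carrier[OF B v])
  have DBv: "D_inv N lam *\<^sub>v (B *\<^sub>v v) \<in> carrier_vec N" by (rule mult_mat_vec_carrier[OF D_inv_carrier Bv])
  have "Omega_mat N lam B *\<^sub>v v = (1 / real N) \<cdot>\<^sub>v (B\<^sup>T *\<^sub>v (D_inv N lam *\<^sub>v (B *\<^sub>v v)))"
    unfolding Omega_mat_def minv_D_mat[OF N lam] smult_mat_mult_vec[OF mult_carrier_mat[OF BTD B] v]
      assoc_mult_mat_vec[OF BTD B v] assoc_mult_mat_vec[OF BT D_inv_carrier Bv] ..
  then have "euc_norm (Omega_mat N lam B *\<^sub>v v) = 1 / real N * euc_norm (B\<^sup>T *\<^sub>v (D_inv N lam *\<^sub>v (B *\<^sub>v v)))"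
    by simp
  also have "\<dots> \<le> 1 / real N * (\<beta> * sqrt (real N) * (\<beta> * sqrt (real N) * euc_norm v))"
  proof (intro mult_left_mono order_trans[OF euc_norm_BT_le[OF DBv]])
    show "euc_norm (D_inv N lam *\<^sub>v (B *\<^sub>v v)) \<le> \<beta> * sqrt (real N) * euc_norm v"
      using D_inv_norm_le[OF Bv N lam] euc_norm_B_le[OF v] by linarith
  qed (use \<beta> in simp_all)
  also have "\<dots> = \<beta>^2 * euc_norm v" using N by (simp add: power2_eq_square field_simps)
  finally show ?thesis .
qed

definition H :: "real mat" where
  "H = H_mat N T r lam B X (sqrt (real T) \<cdot>\<^sub>m G) (sqrt (real T) \<cdot>\<^sub>m Q)"

text \<open>Turns a separation measured after \<open>H\<^sup>T\<close> into one of the loadings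
  themselves. The three factors of \<open>H\<^sup>T\<close> are bounded by \<open>1 / c\<close>, by
  1 (isometry followed by projection) and by \<open>\<beta>\<^sup>2\<close>.\<close>

lemma H_bound:
  assumes v: "v \<in> carrier_vec r"
  shows "euc_norm (H\<^sup>T *\<^sub>v v) \<le> \<beta>^2 / c * euc_norm v"
proof -
  let ?\<Lambda> = "nth_eig ((1 / (real N * real T)) \<cdot>\<^sub>m W)"
  let ?O = "Omega_mat N lam B" and ?L = "mat_diag r (\<lambda>l. 1 / ?\<Lambda> l)"
  have GT: "G\<^sup>T \<in> carrier_mat r T" and QT: "Q\<^sup>T \<in> carrier_mat r T" using G Q by simp_all
  have R: "G\<^sup>T * Q \<in> carrier_mat r r" by (rule mult_carrier_mat[OF GT Q])
  \<comment> \<open>The leading scaled eigenvalues are at least \<open>c > 0\<close>; for a singular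
    diagonal matrix \<open>minv\<close> would be unspecified.\<close>
  have L: "minv (Lambda_mat N T r lam X) = ?L"
    unfolding Lambda_mat_def minv_D_mat[OF N lam] W[symmetric]
    by (rule minv_diag) (use scaled_eig_ge c_pos in force)
  have ss: "sqrt (real T) * (sqrt (real T) * z) = real T * z" for z by (simp flip: mult.assoc)
  have "(1 / real T) \<cdot>\<^sub>m ((sqrt (real T) \<cdot>\<^sub>m G)\<^sup>T * (sqrt (real T) \<cdot>\<^sub>m Q)) = G\<^sup>T * Q"
    by (rule eq_matI) (use G Q T in \<open>auto simp: scalar_prod_sum sum_distrib_left mult_ac ss intro!: sum.cong\<close>)
  then have Heq: "H = ?O * (G\<^sup>T * Q) * ?L" unfolding H_def H_mat_def L by simp
  have OR: "?O * (G\<^sup>T * Q) \<in> carrier_mat r r" by (rule mult_carrier_mat[OF Omega_carrier R])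
  have LT: "?L\<^sup>T = ?L" by (rule eq_matI) (auto simp: mat_diag_def)
  have OT: "?O\<^sup>T \<in> carrier_mat r r" using Omega_carrier by simp
  have RT: "Q\<^sup>T * G \<in> carrier_mat r r" by (rule mult_carrier_mat[OF QT G])
  have HT: "H\<^sup>T = ?L * ((Q\<^sup>T * G) * ?O\<^sup>T)"
    unfolding Heq transpose_mult[OF OR mat_diag_dim] LT transpose_mult[OF Omega_carrier R]
    by (simp add: transpose_mult[OF GT Q])
  let ?o = "?O\<^sup>T *\<^sub>v v"
  have o: "?o \<in> carrier_vec r" by (rule mult_mat_vec_carrier[OF OT v])
  have Go: "G *\<^sub>v ?o \<in> carrier_vec T" by (rule mult_mat_vec_carrier[OF G o])
  have QGo: "Q\<^sup>T *\<^sub>v (G *\<^sub>v ?o) \<in> carrier_vec r" by (rule mult_mat_vec_carrier[OF QT Go])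
  have Hv: "H\<^sup>T *\<^sub>v v = ?L *\<^sub>v (Q\<^sup>T *\<^sub>v (G *\<^sub>v ?o))"
    unfolding HT assoc_mult_mat_vec[OF mat_diag_dim mult_carrier_mat[OF RT OT] v] assoc_mult_mat_vec[OF RT OT v]
      assoc_mult_mat_vec[OF QT G o] ..
  have "(euc_norm (?L *\<^sub>v u))^2 \<le> (1 / c * euc_norm u)^2" if u: "u \<in> carrier_vec r" for u
  proof -
    have "(euc_norm (?L *\<^sub>v u))^2 = (\<Sum>l<r. (1 / ?\<Lambda> l * u $ l)^2)"
      unfolding euc_norm_sq_sum by (intro sum.cong) (simp_all add: mat_diag_mult_vec[OF u] del: index_mult_mat_vec)
    also have "\<dots> \<le> (\<Sum>l<r. (1 / c)^2 * (u $ l)^2)"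
    proof (rule sum_mono)
      fix l assume "l \<in> {..<r}"
      then have "c \<le> ?\<Lambda> l" using scaled_eig_ge by simp
      then have "(1 / ?\<Lambda> l)^2 \<le> (1 / c)^2" using c_pos by (intro power_mono divide_left_mono) auto
      then show "(1 / ?\<Lambda> l * u $ l)^2 \<le> (1 / c)^2 * (u $ l)^2"
        unfolding power_mult_distrib by (intro mult_right_mono) simp_all
    qed
    also have "\<dots> = (1 / c * euc_norm u)^2"
      using u by (simp add: power_mult_distrib power_divide euc_norm_sq_sum sum_divide_distrib)
    finally show ?thesis .
  qed
  from this[OF QGo] have "euc_norm (H\<^sup>T *\<^sub>v v) \<le> 1 / c * euc_norm (Q\<^sup>T *\<^sub>v (G *\<^sub>v ?o))"
    unfolding Hv by (rule power2_le_imp_le) (use c_pos in simp)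
  also have "\<dots> \<le> 1 / c * euc_norm ?o"
    using euc_norm_transpose_isometry_le[OF Q Go QQ] euc_norm_isometry[OF G o GG] c_pos
    by (intro mult_left_mono) auto
  finally have 1: "euc_norm (H\<^sup>T *\<^sub>v v) \<le> 1 / c * euc_norm ?o" .
  have "(euc_norm ?o)^2 \<le> (\<beta>^2)^2 * (euc_norm v)^2"
  proof (rule adjoint_bound[OF Omega_carrier _ v])
    fix x :: "real Matrix.vec" assume "x \<in> carrier_vec r"
    then have "(euc_norm (?O *\<^sub>v x))^2 \<le> (\<beta>^2 * euc_norm x)^2" by (intro power_mono Omega_bound) simp_all
    then show "(euc_norm (?O *\<^sub>v x))^2 \<le> (\<beta>^2)^2 * (euc_norm x)^2" by (simp add: power_mult_distrib)
  qed simp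
  then have "(euc_norm ?o)^2 \<le> (\<beta>^2 * euc_norm v)^2" by (simp only: power_mult_distrib)
  then have "euc_norm ?o \<le> \<beta>^2 * euc_norm v" by (rule power2_le_imp_le) simp
  then have "1 / c * euc_norm ?o \<le> \<beta>^2 / c * euc_norm v" using c_pos by (simp add: divide_right_mono)
  then show ?thesis using 1 by linarith
qed

section \<open>Distances between estimated loadings\<close>

definition Bhat :: "real mat" where
  "Bhat = ppca_B N T lam X (sqrt (real T) \<cdot>\<^sub>m Q)"

lemma Bhat_carrier: "Bhat \<in> carrier_mat N r"
  unfolding Bhat_def ppca_B_def minv_D_mat[OF N lam]
  using mult_carrier_mat[OF mult_carrier_mat[OF D_inv_carrier, of "X\<^sup>T" N T lam], of "sqrt (real T) \<cdot>\<^sub>m Q" r] X_carrier Q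
  by simp

lemma Bhat_index:
  assumes i: "i < N" and l: "l < r"
  shows "Bhat $$ (i,l) = y l $ i / sqrt (real T)"
proof -
  let ?DX = "D_inv N lam * X\<^sup>T" and ?S = "sqrt (real T) \<cdot>\<^sub>m Q"
  have XT: "X\<^sup>T \<in> carrier_mat N T" using X_carrier by simp
  have DX: "?DX \<in> carrier_mat N T" by (rule mult_carrier_mat[OF D_inv_carrier XT])
  have sQ: "?S \<in> carrier_mat T r" using Q by simp
  have q: "col Q l \<in> carrier_vec T" by (rule q_carrier[OF l])
  have "(?DX * ?S) $$ (i,l) = col (?DX * ?S) l $ i"
    using mult_carrier_mat[OF DX sQ] i l by (simp del: index_mult_mat)
  also have "\<dots> = ((?DX) *\<^sub>v (sqrt (real T) \<cdot>\<^sub>v col Q l)) $ i"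
    unfolding col_mult2[OF DX sQ l] using Q l by simp
  also have "\<dots> = (sqrt (real T) \<cdot>\<^sub>v y l) $ i"
    unfolding mult_mat_vec[OF DX q] assoc_mult_mat_vec[OF D_inv_carrier XT q] y_def ..
  also have "\<dots> = sqrt (real T) * y l $ i" using i y_carrier[OF l] by simp
  finally have "Bhat $$ (i,l) = 1 / real T * (sqrt (real T) * y l $ i)"
    unfolding Bhat_def ppca_B_def minv_D_mat[OF N lam] using mult_carrier_mat[OF DX sQ] i l by (simp del: index_mult_mat)
  also have "\<dots> = y l $ i * (sqrt (real T) / real T)" by simp
  also have "sqrt (real T) / real T = 1 / sqrt (real T)"
    using T by (simp add: sqrt_divide_self_eq inverse_eq_divide)
  finally show ?thesis by simp
qed

lemma Bhat_diff:
  assumes i: "i < N" and j: "j < N" and l: "l < r"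
  shows "\<bar>(1 + lam) * (Bhat $$ (i,l) - Bhat $$ (j,l)) - (Q\<^sup>T *\<^sub>v (G *\<^sub>v (row B i - row B j))) $ l\<bar> \<le> 2 * \<zeta> / sqrt (real T)"
proof -
  let ?v = "row B i - row B j"
  let ?s = "Q\<^sup>T *\<^sub>v (G *\<^sub>v ?v)"
  let ?q = "col Q l"
  have q: "?q \<in> carrier_vec T" by (rule q_carrier[OF l])
  define p where "p = X\<^sup>T *\<^sub>v ?q"
  define z where "z = E\<^sup>T *\<^sub>v ?q"
  let ?g = "G\<^sup>T *\<^sub>v ?q"
  have pc: "p \<in> carrier_vec N" and z: "z \<in> carrier_vec N" and g: "?g \<in> carrier_vec r"
    using X_carrier E G q by (simp_all add: p_def z_def)
  have Bg: "B *\<^sub>v ?g \<in> carrier_vec N" by (rule mult_mat_vec_carrier[OF B g])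
  have bi: "row B i \<in> carrier_vec r" and bj: "row B j \<in> carrier_vec r" using B i j by simp_all
  have v: "?v \<in> carrier_vec r" using bi bj by simp
  have pk: "p $ k = sqrt (real T) * (row B k \<bullet> ?g) + z $ k" if "k < N" for k
  proof -
    have "p $ k = sqrt (real T) * (B *\<^sub>v ?g) $ k + z $ k"
      unfolding p_def XT_mult[OF q] z_def[symmetric] using that carrier_vecD[OF Bg] carrier_vecD[OF z] by (simp del: index_mult_mat_vec)
    then show ?thesis using that B by simp
  qed
  have "?v \<bullet> ?g = ?s $ l"
  proof -
    have Gv: "G *\<^sub>v ?v \<in> carrier_vec T" by (rule mult_mat_vec_carrier[OF G v])
    have "?v \<bullet> ?g = (G *\<^sub>v ?v) \<bullet> ?q"
      by (rule scalar_prod_adjoint[OF G v q, symmetric])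
    also have "\<dots> = ?q \<bullet> (G *\<^sub>v ?v)" by (rule comm_scalar_prod[OF Gv q])
    finally show ?thesis using Q l by simp
  qed
  then have sgn: "row B i \<bullet> ?g - row B j \<bullet> ?g = ?s $ l"
    using minus_scalar_prod_distrib[OF bi bj g] by simp
  \<comment> \<open>The mean term of \<open>D_inv_mult_vec\<close> is the same for both indices and
    cancels.\<close>
  have "y l $ i - y l $ j = (p $ i - p $ j) / (1 + lam)"
    unfolding y_def p_def[symmetric] D_inv_mult_vec[OF pc i] D_inv_mult_vec[OF pc j] by (simp add: diff_divide_distrib)
  then have "(1 + lam) * (y l $ i - y l $ j) = p $ i - p $ j" using lam by simp
  then have "(1 + lam) * (Bhat $$ (i,l) - Bhat $$ (j,l)) = (p $ i - p $ j) / sqrt (real T)"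
    unfolding Bhat_index[OF i l] Bhat_index[OF j l] by (simp flip: diff_divide_distrib)
  also have "p $ i - p $ j = sqrt (real T) * (row B i \<bullet> ?g - row B j \<bullet> ?g) + (z $ i - z $ j)"
    unfolding pk[OF i] pk[OF j] by (simp add: right_diff_distrib)
  also have "\<dots> / sqrt (real T) = (row B i \<bullet> ?g - row B j \<bullet> ?g) + (z $ i - z $ j) / sqrt (real T)"
    using T by (simp add: add_divide_distrib)
  finally have "\<bar>(1 + lam) * (Bhat $$ (i,l) - Bhat $$ (j,l)) - ?s $ l\<bar>
      = \<bar>z $ i - z $ j\<bar> / sqrt (real T)"
    unfolding sgn by (simp add: abs_divide)
  also have "\<dots> \<le> 2 * \<zeta> / sqrt (real T)"
    using abs_index_le_euc_norm[of i z] abs_index_le_euc_norm[of j z] z i j noise_projection_le[OF l]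
    unfolding z_def[symmetric] by (intro divide_right_mono) auto
  finally show ?thesis .
qed

lemma Delta_hat_eq:
  assumes i: "i < N" and j: "j < N"
  shows "Delta_hat r Bhat i j = 1 / real r * (\<Sum>l<r. \<bar>Bhat $$ (i,l) - Bhat $$ (j,l)\<bar>)"
  unfolding Delta_hat_def l1_norm_def using Bhat_carrier i j by simp

lemma Delta_hat_within_le:
  assumes i: "i < N" and j: "j < N" and eq: "row B i = row B j" and r: "0 < r"
  shows "(1 + lam) * Delta_hat r Bhat i j \<le> 2 * \<zeta> / sqrt (real T)"
proof -
  have zero: "(Q\<^sup>T *\<^sub>v (G *\<^sub>v (row B i - row B j))) $ l = 0" if "l < r" for l
  proof -
    have "row B i - row B j = 0\<^sub>v r" unfolding eq using B j by (intro minus_cancel_vec) simp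
    moreover have "G *\<^sub>v 0\<^sub>v r = 0\<^sub>v T" using G by (intro eq_vecI) (auto simp: scalar_prod_sum)
    ultimately show ?thesis using that Q by (simp add: scalar_prod_sum)
  qed
  have "(1 + lam) * Delta_hat r Bhat i j = 1 / real r * (\<Sum>l<r. \<bar>(1 + lam) * (Bhat $$ (i,l) - Bhat $$ (j,l))\<bar>)"
    unfolding Delta_hat_eq[OF i j] using lam by (simp add: abs_mult flip: sum_distrib_left)
  also have "\<dots> \<le> 1 / real r * (\<Sum>l<r. 2 * \<zeta> / sqrt (real T))"
    using Bhat_diff[OF i j] zero by (intro mult_left_mono sum_mono) auto
  also have "\<dots> = 2 * \<zeta> / sqrt (real T)" using r by simp
  finally show ?thesis .
qed

text \<open>\<open>H_bound\<close> and \<open>signal_ge\<close> together give the factor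
  \<open>c / (2 * \<beta>\<^sup>2)\<close>. The Euclidean norm is then bounded by the sum of
  absolute values, and each coordinate gives up the error of \<open>Bhat_diff\<close>.\<close>

lemma Delta_hat_between_ge:
  assumes i: "i < N" and j: "j < N" and r: "0 < r"
  shows "1 / real r * (c / (2 * \<beta>^2) * euc_norm (H\<^sup>T *\<^sub>v (row B i - row B j))) - 2 * \<zeta> / sqrt (real T)
    \<le> (1 + lam) * Delta_hat r Bhat i j"
proof -
  let ?v = "row B i - row B j"
  let ?s = "Q\<^sup>T *\<^sub>v (G *\<^sub>v ?v)"
  have v: "?v \<in> carrier_vec r" using B i j by simp
  have "euc_norm (H\<^sup>T *\<^sub>v ?v) \<le> \<beta>^2 / c * (2 * euc_norm ?s)"
    by (rule order_trans[OF H_bound[OF v] mult_left_mono[OF signal_ge[OF v]]]) (use c_pos in simp)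
  then have "c / (2 * \<beta>^2) * euc_norm (H\<^sup>T *\<^sub>v ?v) \<le> c / (2 * \<beta>^2) * (\<beta>^2 / c * (2 * euc_norm ?s))"
    using c_pos by (intro mult_left_mono) auto
  also have "\<dots> = euc_norm ?s" using c_pos \<beta> by simp
  also have "\<dots> \<le> (\<Sum>l<r. \<bar>?s $ l\<bar>)"
    unfolding euc_norm_L2 using Q by (simp add: L2_set_le_sum_abs del: index_mult_mat_vec)
  also have "\<dots> \<le> (\<Sum>l<r. \<bar>(1 + lam) * (Bhat $$ (i,l) - Bhat $$ (j,l))\<bar> + 2 * \<zeta> / sqrt (real T))"
  proof (rule sum_mono)
    fix l assume "l \<in> {..<r}"
    then have "l < r" by simp
    from Bhat_diff[OF i j this]
    show "\<bar>?s $ l\<bar> \<le> \<bar>(1 + lam) * (Bhat $$ (i,l) - Bhat $$ (j,l))\<bar> + 2 * \<zeta> / sqrt (real T)"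
      by linarith
  qed
  also have "\<dots> = (\<Sum>l<r. \<bar>(1 + lam) * (Bhat $$ (i,l) - Bhat $$ (j,l))\<bar>) + real r * (2 * \<zeta> / sqrt (real T))"
    by (simp add: sum.distrib)
  also have "(\<Sum>l<r. \<bar>(1 + lam) * (Bhat $$ (i,l) - Bhat $$ (j,l))\<bar>) = real r * ((1 + lam) * Delta_hat r Bhat i j)"
    unfolding Delta_hat_eq[OF i j] using lam r by (simp add: abs_mult flip: sum_distrib_left)
  finally have "1 / real r * (c / (2 * \<beta>^2) * euc_norm (H\<^sup>T *\<^sub>v ?v))
      \<le> 1 / real r * (real r * ((1 + lam) * Delta_hat r Bhat i j) + real r * (2 * \<zeta> / sqrt (real T)))"
    by (rule mult_left_mono) simp
  also have "\<dots> = (1 + lam) * Delta_hat r Bhat i j + 2 * \<zeta> / sqrt (real T)" using r by (simp add: distrib_left)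
  finally show ?thesis by simp
qed

text \<open>Distances within a group reach at most \<open>2 * \<zeta> / sqrt T\<close>, those
  between groups fall short of the signal by at most the same amount. The signal must thus exceed
  \<open>4 * \<zeta> / sqrt T\<close>; clearing its factor
  \<open>c / (2 * r * \<beta>\<^sup>2)\<close> produces the 8 in the hypothesis.\<close>

theorem ahc_recovers_groups:
  assumes r: "0 < r" and part: "partition_on {..<N} \<G>" and card: "card \<G> = K"
    and grp: "\<And>A i. A \<in> \<G> \<Longrightarrow> i \<in> A \<Longrightarrow> row B i = bG A"
    and ahc: "ahc (Delta_hat r Bhat) N K P"
    and sep: "8 * real r * \<beta>^2 * \<zeta> / sqrt (real T) < c * d_sep \<G> B H"
  shows "P = \<G>"
proof (rule ahc_eq_groups[OF part card ahc])
  fix A A' C i j k l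
  assume A: "A \<in> \<G>" "A' \<in> \<G>" "C \<in> \<G>" "A \<noteq> A'" and ij: "i \<in> C" "j \<in> C" and kl: "k \<in> A" "l \<in> A'"
  have lt: "i < N" "j < N" "k < N" "l < N" using partition_onD1[OF part] A ij kl by blast+
  let ?h = "euc_norm (H\<^sup>T *\<^sub>v (row B k - row B l))"
  have "8 * real r * \<beta>^2 * \<zeta> / sqrt (real T) < c * ?h"
    by (rule order.strict_trans2[OF sep mult_left_mono[OF d_sep_le[OF part A(1,2,4) kl]]]) (use c_pos in simp)
  then have "1 / (2 * real r * \<beta>^2) * (8 * real r * \<beta>^2 * \<zeta> / sqrt (real T)) < 1 / (2 * real r * \<beta>^2) * (c * ?h)"
    using r \<beta> by (intro mult_strict_left_mono) auto
  then have "2 * (2 * \<zeta> / sqrt (real T)) < 1 / real r * (c / (2 * \<beta>^2) * ?h)"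
    using r \<beta> by (simp add: mult_ac)
  then have "(1 + lam) * Delta_hat r Bhat i j < (1 + lam) * Delta_hat r Bhat k l"
    using Delta_hat_within_le[OF lt(1,2) _ r] grp A ij Delta_hat_between_ge[OF lt(3,4) r] by fastforce
  then show "Delta_hat r Bhat i j < Delta_hat r Bhat k l" using lam by simp
qed

end

section \<open>Second moments of the noise\<close>

lemma integrable_mult_of_squares:
  fixes f g :: "'a \<Rightarrow> real"
  assumes [measurable]: "f \<in> borel_measurable M" "g \<in> borel_measurable M"
    and "integrable M (\<lambda>x. (f x)^2)" "integrable M (\<lambda>x. (g x)^2)"
  shows "integrable M (\<lambda>x. f x * g x)"
proof (rule Bochner_Integration.integrable_bound)
  show "integrable M (\<lambda>x. (f x)^2 + (g x)^2)" using assms by (intro Bochner_Integration.integrable_add)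
  show "AE x in M. norm (f x * g x) \<le> norm ((f x)^2 + (g x)^2)"
  proof (rule AE_I2)
    fix x
    have "2 * (\<bar>f x\<bar> * \<bar>g x\<bar>) \<le> (f x)^2 + (g x)^2"
      using sum_squares_bound[of "\<bar>f x\<bar>" "\<bar>g x\<bar>"] by simp
    moreover have "0 \<le> \<bar>f x\<bar> * \<bar>g x\<bar>" by simp
    ultimately have "\<bar>f x\<bar> * \<bar>g x\<bar> \<le> (f x)^2 + (g x)^2" by linarith
    then show "norm (f x * g x) \<le> norm ((f x)^2 + (g x)^2)" by (simp add: abs_mult)
  qed
qed measurable

context prob_space
begin

text \<open>A dominating integrable function spares measurability proofs for \<open>f\<close> itself.\<close>

definition mean_bounded :: "('a \<Rightarrow> real) \<Rightarrow> real \<Rightarrow> bool" where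
  "mean_bounded f b \<longleftrightarrow> (\<exists>D. integrable M D \<and> (\<forall>w\<in>space M. 0 \<le> f w \<and> f w \<le> D w) \<and> expectation D \<le> b)"

lemma mean_boundedI:
  "integrable M D \<Longrightarrow> (\<And>w. w \<in> space M \<Longrightarrow> 0 \<le> f w) \<Longrightarrow> (\<And>w. w \<in> space M \<Longrightarrow> f w \<le> D w) \<Longrightarrow> expectation D \<le> b
   \<Longrightarrow> mean_bounded f b"
  unfolding mean_bounded_def by blast

lemma mean_bounded_mono:
  assumes "mean_bounded f b" "\<And>w. w \<in> space M \<Longrightarrow> 0 \<le> g w" "\<And>w. w \<in> space M \<Longrightarrow> g w \<le> f w" "b \<le> b'"
  shows "mean_bounded g b'"
  using assms unfolding mean_bounded_def by (meson order_trans)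

lemma mean_bounded_cmult:
  assumes "mean_bounded f b" "0 \<le> c"
  shows "mean_bounded (\<lambda>w. c * f w) (c * b)"
proof -
  obtain D where D: "integrable M D" "\<And>w. w \<in> space M \<Longrightarrow> 0 \<le> f w \<and> f w \<le> D w" "expectation D \<le> b"
    using assms(1) unfolding mean_bounded_def by blast
  show ?thesis
    by (rule mean_boundedI[of "\<lambda>w. c * D w"]) (use D assms(2) in \<open>auto intro: mult_left_mono\<close>)
qed

lemma mean_bounded_sum:
  assumes "\<And>i. i \<in> I \<Longrightarrow> mean_bounded (f i) (b i)"
  shows "mean_bounded (\<lambda>w. \<Sum>i\<in>I. f i w) (\<Sum>i\<in>I. b i)"
proof -
  have "\<forall>i. \<exists>D. i \<in> I \<longrightarrow> integrable M D \<and> (\<forall>w\<in>space M. 0 \<le> f i w \<and> f i w \<le> D w) \<and> expectation D \<le> b i"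
    using assms unfolding mean_bounded_def by blast
  then obtain D where D: "\<And>i. i \<in> I \<Longrightarrow> integrable M (D i) \<and> (\<forall>w\<in>space M. 0 \<le> f i w \<and> f i w \<le> D i w) \<and> expectation (D i) \<le> b i"
    by metis
  show ?thesis
  proof (rule mean_boundedI[of "\<lambda>w. \<Sum>i\<in>I. D i w"])
    show "integrable M (\<lambda>w. \<Sum>i\<in>I. D i w)" using D by (intro Bochner_Integration.integrable_sum) auto
    have "expectation (\<lambda>w. \<Sum>i\<in>I. D i w) = (\<Sum>i\<in>I. expectation (D i))"
      using D by (intro Bochner_Integration.integral_sum) auto
    also have "\<dots> \<le> (\<Sum>i\<in>I. b i)" using D by (intro sum_mono) auto
    finally show "expectation (\<lambda>w. \<Sum>i\<in>I. D i w) \<le> (\<Sum>i\<in>I. b i)" .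
  qed (use D in \<open>auto intro!: sum_nonneg sum_mono\<close>)
qed

text \<open>Markov's inequality for the dominating function. The event is cut out by that function,
  so it is measurable even if \<open>f\<close> is not.\<close>

lemma mean_bounded_event:
  assumes "mean_bounded f b" and k: "0 < k"
  obtains A where "A \<in> events" "1 - b / k \<le> prob A" "\<And>w. w \<in> A \<Longrightarrow> f w < k"
proof -
  obtain D where D: "integrable M D" "\<And>w. w \<in> space M \<Longrightarrow> 0 \<le> f w \<and> f w \<le> D w" "expectation D \<le> b"
    using assms(1) unfolding mean_bounded_def by blast
  have [measurable]: "D \<in> borel_measurable M" using D(1) by simp
  let ?B = "{w \<in> space M. D w \<ge> k}"
  have B: "?B \<in> events" by measurable
  have nn: "\<And>w. w \<in> space M \<Longrightarrow> 0 \<le> D w" using D(2) order_trans by blast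
  have "prob ?B \<le> expectation D / k"
    by (rule integral_Markov_inequality_measure[OF D(1) sets.empty_sets _ k]) (use nn in auto)
  also have "\<dots> \<le> b / k" using D(3) k by (simp add: divide_right_mono)
  finally have "1 - b / k \<le> prob (space M - ?B)" using prob_compl[OF B] by simp
  moreover have "space M - ?B \<in> events" using B by auto
  moreover have "f w < k" if "w \<in> space M - ?B" for w using that D(2)[of w] by auto
  ultimately show thesis using that by blast
qed

section \<open>Second moments under independence\<close>

text \<open>After expanding the square, independence factorizes each mixed moment and orthonormality
  of the first family kills the off-diagonal ones. The members of the second family may be
  correlated with one another.\<close>

lemma bilinear_second_moment:
  fixes f :: "'i \<Rightarrow> 'x \<Rightarrow> real" and g :: "'i \<Rightarrow> 'x \<Rightarrow> real"
  assumes ind: "indep_var MA a MB b" and J: "finite J"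
    and f: "\<And>p. p \<in> J \<Longrightarrow> f p \<in> borel_measurable MA" and g: "\<And>p. p \<in> J \<Longrightarrow> g p \<in> borel_measurable MB"
    and f2: "\<And>p. p \<in> J \<Longrightarrow> integrable M (\<lambda>w. (f p (a w))^2)" and g2: "\<And>p. p \<in> J \<Longrightarrow> integrable M (\<lambda>w. (g p (b w))^2)"
    and orth: "\<And>p q. p \<in> J \<Longrightarrow> q \<in> J \<Longrightarrow> expectation (\<lambda>w. f p (a w) * f q (a w)) = (if p = q then 1 else 0)"
  shows "integrable M (\<lambda>w. (\<Sum>p\<in>J. f p (a w) * g p (b w))^2)"
    and "expectation (\<lambda>w. (\<Sum>p\<in>J. f p (a w) * g p (b w))^2) = (\<Sum>p\<in>J. expectation (\<lambda>w. (g p (b w))^2))"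
proof -
  have a: "a \<in> measurable M MA" and b: "b \<in> measurable M MB"
    using indep_var_rv1[OF ind] indep_var_rv2[OF ind] .
  have fa: "(\<lambda>w. f p (a w)) \<in> borel_measurable M" if "p \<in> J" for p using measurable_compose[OF a f[OF that]] .
  have gb: "(\<lambda>w. g p (b w)) \<in> borel_measurable M" if "p \<in> J" for p using measurable_compose[OF b g[OF that]] .
  have ff: "integrable M (\<lambda>w. f p (a w) * f q (a w))" if "p \<in> J" "q \<in> J" for p q
    using that by (intro integrable_mult_of_squares fa f2)
  have gg: "integrable M (\<lambda>w. g p (b w) * g q (b w))" if "p \<in> J" "q \<in> J" for p q
    using that by (intro integrable_mult_of_squares gb g2)
  have iv: "indep_var borel (\<lambda>w. f p (a w) * f q (a w)) borel (\<lambda>w. g p (b w) * g q (b w))" if "p \<in> J" "q \<in> J" for p q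
    using indep_var_compose[OF ind, of "\<lambda>x. f p x * f q x" borel "\<lambda>x. g p x * g q x" borel] f g that
    by (simp add: o_def)
  have ex: "(\<Sum>p\<in>J. f p (a w) * g p (b w))^2 = (\<Sum>p\<in>J. \<Sum>q\<in>J. (f p (a w) * f q (a w)) * (g p (b w) * g q (b w)))" for w
    by (simp add: power2_eq_square sum_product mult_ac)
  have int: "integrable M (\<lambda>w. (f p (a w) * f q (a w)) * (g p (b w) * g q (b w)))" if "p \<in> J" "q \<in> J" for p q
    by (rule indep_var_integrable[OF iv[OF that] ff[OF that] gg[OF that]])
  show "integrable M (\<lambda>w. (\<Sum>p\<in>J. f p (a w) * g p (b w))^2)"
    unfolding ex using int by (intro Bochner_Integration.integrable_sum)
  have "expectation (\<lambda>w. (\<Sum>p\<in>J. f p (a w) * g p (b w))^2)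
      = (\<Sum>p\<in>J. \<Sum>q\<in>J. expectation (\<lambda>w. (f p (a w) * f q (a w)) * (g p (b w) * g q (b w))))"
    unfolding ex using int by (subst Bochner_Integration.integral_sum) (auto intro!: sum.cong Bochner_Integration.integral_sum Bochner_Integration.integrable_sum)
  also have "\<dots> = (\<Sum>p\<in>J. \<Sum>q\<in>J. if p = q then expectation (\<lambda>w. (g p (b w))^2) else 0)"
    using indep_var_lebesgue_integral[OF iv ff gg] orth by (intro sum.cong) (auto simp: power2_eq_square)
  also have "\<dots> = (\<Sum>p\<in>J. expectation (\<lambda>w. (g p (b w))^2))" using J by (intro sum.cong) auto
  finally show "expectation (\<lambda>w. (\<Sum>p\<in>J. f p (a w) * g p (b w))^2) = (\<Sum>p\<in>J. expectation (\<lambda>w. (g p (b w))^2))" .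
qed

lemma indep_orthonormal:
  assumes ind: "indep_vars (\<lambda>_. borel) Z I" and i: "i \<in> I" and j: "j \<in> I"
    and z2: "\<And>i. i \<in> I \<Longrightarrow> integrable M (\<lambda>w. (Z i w)^2 :: real)"
    and m1: "\<And>i. i \<in> I \<Longrightarrow> expectation (Z i) = 0" and m2: "\<And>i. i \<in> I \<Longrightarrow> expectation (\<lambda>w. (Z i w)^2) = 1"
  shows "expectation (\<lambda>w. Z i w * Z j w) = (if i = j then 1 else 0)"
proof (cases "i = j")
  case True
  then show ?thesis using m2[OF i] by (simp add: power2_eq_square)
next
  case False
  have rv: "Z i \<in> borel_measurable M" if "i \<in> I" for i using ind that by (auto simp: indep_vars_def)
  have "indep_var (PiM {i} (\<lambda>_. borel)) (\<lambda>w. restrict (\<lambda>k. Z k w) {i}) (PiM {j} (\<lambda>_. borel)) (\<lambda>w. restrict (\<lambda>k. Z k w) {j})"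
    using False i j by (intro indep_var_restrict[OF ind]) auto
  from indep_var_compose[OF this, of "\<lambda>f. f i" borel "\<lambda>f. f j" borel]
  have iv: "indep_var borel (Z i) borel (Z j)" by (simp add: o_def)
  have int: "integrable M (Z i)" if "i \<in> I" for i
    using square_integrable_imp_integrable[OF rv[OF that] z2[OF that]] .
  have "expectation (\<lambda>w. Z i w * Z j w) = expectation (Z i) * expectation (Z j)"
    by (rule indep_var_lebesgue_integral[OF iv int[OF i] int[OF j]])
  then show ?thesis using m1 i j False by simp
qed

end

locale white_noise = prob_space +
  fixes T N :: nat and Z :: "nat \<times> nat \<Rightarrow> 'a \<Rightarrow> real" and C :: real
  assumes indep: "indep_vars (\<lambda>_. borel) Z ({..<T} \<times> {..<N})"
    and int4: "\<And>p. p \<in> {..<T} \<times> {..<N} \<Longrightarrow> integrable M (\<lambda>w. (Z p w) ^ 4)"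
    and m1: "\<And>p. p \<in> {..<T} \<times> {..<N} \<Longrightarrow> expectation (Z p) = 0"
    and m2: "\<And>p. p \<in> {..<T} \<times> {..<N} \<Longrightarrow> expectation (\<lambda>w. (Z p w)^2) = 1"
    and m4: "\<And>p. p \<in> {..<T} \<times> {..<N} \<Longrightarrow> expectation (\<lambda>w. (Z p w) ^ 4) \<le> C"
begin

lemma rv: "p \<in> {..<T} \<times> {..<N} \<Longrightarrow> Z p \<in> borel_measurable M"
  using indep by (auto simp: indep_vars_def)

lemma int2: "p \<in> {..<T} \<times> {..<N} \<Longrightarrow> integrable M (\<lambda>w. (Z p w)^2)"
  using square_integrable_imp_integrable[of "\<lambda>w. (Z p w)^2"] rv[of p] int4[of p] by simp

lemmas orthonormal = indep_orthonormal[OF indep _ _ int2 m1 m2]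

lemma linear_second_moment:
  assumes K: "K \<subseteq> {..<T} \<times> {..<N}"
  shows "integrable M (\<lambda>w. (\<Sum>q\<in>K. c q * Z q w)^2)"
    and "expectation (\<lambda>w. (\<Sum>q\<in>K. c q * Z q w)^2) = (\<Sum>q\<in>K. (c q)^2)"
proof -
  have fin: "finite K" using K by (rule finite_subset) simp
  have ex: "(\<Sum>q\<in>K. c q * Z q w)^2 = (\<Sum>p\<in>K. \<Sum>q\<in>K. (c p * c q) * (Z p w * Z q w))" for w
    by (simp add: power2_eq_square sum_product mult_ac)
  have int: "integrable M (\<lambda>w. (c p * c q) * (Z p w * Z q w))" if "p \<in> K" "q \<in> K" for p q
    using that K by (intro integrable_mult_right integrable_mult_of_squares rv int2) auto
  show "integrable M (\<lambda>w. (\<Sum>q\<in>K. c q * Z q w)^2)"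
    unfolding ex using int by (intro Bochner_Integration.integrable_sum)
  have "expectation (\<lambda>w. (\<Sum>q\<in>K. c q * Z q w)^2) = (\<Sum>p\<in>K. \<Sum>q\<in>K. expectation (\<lambda>w. (c p * c q) * (Z p w * Z q w)))"
    unfolding ex using int
    by (subst Bochner_Integration.integral_sum) (auto intro!: sum.cong Bochner_Integration.integral_sum Bochner_Integration.integrable_sum)
  also have "\<dots> = (\<Sum>p\<in>K. \<Sum>q\<in>K. if p = q then (c q)\<^sup>2 else 0)"
  proof (intro sum.cong refl)
    fix p q assume "p \<in> K" "q \<in> K"
    then have "expectation (\<lambda>w. Z p w * Z q w) = (if p = q then 1 else 0)" using K by (intro orthonormal) auto
    then show "expectation (\<lambda>w. (c p * c q) * (Z p w * Z q w)) = (if p = q then (c q)\<^sup>2 else 0)"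
      by (simp add: power2_eq_square)
  qed
  also have "\<dots> = (\<Sum>q\<in>K. (c q)^2)" using fin by (intro sum.cong) auto
  finally show "expectation (\<lambda>w. (\<Sum>q\<in>K. c q * Z q w)^2) = (\<Sum>q\<in>K. (c q)^2)" .
qed

text \<open>Disjoint sets of entries are independent, so this is the bilinear case with single
  entries on one side and linear forms in the other entries on the other side.\<close>

lemma decoupled_second_moment:
  assumes J: "J \<subseteq> {..<T} \<times> {..<N}" and K: "K \<subseteq> {..<T} \<times> {..<N}" and JK: "J \<inter> K = {}"
  shows "integrable M (\<lambda>w. (\<Sum>p\<in>J. Z p w * (\<Sum>q\<in>K. c p q * Z q w))^2)"
    and "expectation (\<lambda>w. (\<Sum>p\<in>J. Z p w * (\<Sum>q\<in>K. c p q * Z q w))^2) = (\<Sum>p\<in>J. \<Sum>q\<in>K. (c p q)^2)"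
proof -
  let ?a = "\<lambda>w. restrict (\<lambda>i. Z i w) J" and ?b = "\<lambda>w. restrict (\<lambda>i. Z i w) K"
  have ind: "indep_var (PiM J (\<lambda>_. borel)) ?a (PiM K (\<lambda>_. borel)) ?b"
    by (rule indep_var_restrict[OF indep JK J K])
  have fin: "finite J" using J by (rule finite_subset) simp
  let ?f = "\<lambda>p x. x p" and ?g = "\<lambda>p x. \<Sum>q\<in>K. c p q * x q"
  have fp: "?f p (?a w) = Z p w" if "p \<in> J" for p w using that by simp
  have gp: "?g p (?b w) = (\<Sum>q\<in>K. c p q * Z q w)" for p w by (intro sum.cong) auto
  have eq: "(\<Sum>p\<in>J. ?f p (?a w) * ?g p (?b w)) = (\<Sum>p\<in>J. Z p w * (\<Sum>q\<in>K. c p q * Z q w))" for w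
    unfolding gp by (intro sum.cong) auto
  have f: "?f p \<in> borel_measurable (PiM J (\<lambda>_. borel))" if "p \<in> J" for p using that by simp
  have g: "?g p \<in> borel_measurable (PiM K (\<lambda>_. borel))" for p by measurable
  have f2: "integrable M (\<lambda>w. (?f p (?a w))^2)" if "p \<in> J" for p
    unfolding fp[OF that] using that J by (intro int2) auto
  have g2: "integrable M (\<lambda>w. (?g p (?b w))^2)" for p
    unfolding gp by (rule linear_second_moment(1)[OF K])
  have orth: "expectation (\<lambda>w. ?f p (?a w) * ?f q (?a w)) = (if p = q then 1 else 0)" if "p \<in> J" "q \<in> J" for p q
    unfolding fp[OF that(1)] fp[OF that(2)] using that J by (intro orthonormal) auto
  note * = bilinear_second_moment[OF ind fin, of ?f ?g, OF f g f2 g2 orth]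
  show "integrable M (\<lambda>w. (\<Sum>p\<in>J. Z p w * (\<Sum>q\<in>K. c p q * Z q w))^2)"
    using *(1) unfolding eq by simp
  show "expectation (\<lambda>w. (\<Sum>p\<in>J. Z p w * (\<Sum>q\<in>K. c p q * Z q w))^2) = (\<Sum>p\<in>J. \<Sum>q\<in>K. (c p q)^2)"
    using *(2) unfolding eq gp linear_second_moment(2)[OF K] by simp
qed

text \<open>In coordinate \<open>j\<close> the terms with \<open>k \<noteq> j\<close> pair column \<open>j\<close> with independent columns, so their
  variance is a sum of squares; the fourth moments only enter through the terms with \<open>k = j\<close>.\<close>

lemma quadratic_image_mean_bounded:
  assumes al: "0 \<le> \<alpha>" and hs: "(\<Sum>t<T. \<Sum>s<T. (a t s)^2) \<le> real T * \<alpha>^2"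
    and form: "\<And>z. \<bar>\<Sum>t<T. \<Sum>s<T. a t s * z t * z s\<bar> \<le> \<alpha> * (\<Sum>t<T. (z t)^2)"
  shows "mean_bounded (\<lambda>w. \<Sum>j<N. (\<Sum>t<T. Z (t,j) w * (\<Sum>s<T. a t s * (\<Sum>k<N. Z (s,k) w * v k)))^2)
    (2 * \<alpha>^2 * (\<Sum>k<N. (v k)^2) * (real N * real T + C * (real T)^2))"
proof -
  let ?V = "\<Sum>k<N. (v k)^2"
  \<comment> \<open>Coordinate \<open>j\<close> of the matrix-vector product
    \<open>Z\<^sup>T a Z v\<close>.\<close>
  let ?f = "\<lambda>j w. \<Sum>t<T. Z (t,j) w * (\<Sum>s<T. a t s * (\<Sum>k<N. Z (s,k) w * v k))"
  have "mean_bounded (\<lambda>w. (?f j w)^2) (2 * (real T * \<alpha>^2 * ?V) + 2 * \<alpha>^2 * (v j)^2 * (C * (real T)^2))" if j: "j < N" for j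
  proof -
    define J where "J = {..<T} \<times> {j}"
    define K where "K = {..<T} \<times> ({..<N} - {j})"
    define c where "c p q = a (fst p) (fst q) * v (snd q)" for p q :: "nat \<times> nat"
    define U where "U w = (\<Sum>p\<in>J. Z p w * (\<Sum>q\<in>K. c p q * Z q w))" for w
    define W where "W w = (\<Sum>t<T. \<Sum>s<T. a t s * Z (t,j) w * Z (s,j) w)" for w
    have JK: "J \<subseteq> {..<T} \<times> {..<N}" "K \<subseteq> {..<T} \<times> {..<N}" "J \<inter> K = {}" using j by (auto simp: J_def K_def)
    have sumJ: "(\<Sum>p\<in>J. h p) = (\<Sum>t<T. h (t,j))" for h :: "nat \<times> nat \<Rightarrow> real"
    proof -
      have "(\<Sum>p\<in>J. h p) = (\<Sum>t<T. \<Sum>k\<in>{j}. h (t,k))" unfolding J_def by (subst sum.cartesian_product) simp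
      then show ?thesis by simp
    qed
    have sumK: "(\<Sum>q\<in>K. h q) = (\<Sum>s<T. \<Sum>k\<in>{..<N} - {j}. h (s,k))" for h :: "nat \<times> nat \<Rightarrow> real"
      unfolding K_def by (simp add: sum.cartesian_product)
    have split: "?f j w = U w + v j * W w" for w
    proof -
      have "(\<Sum>k<N. Z (s,k) w * v k) = Z (s,j) w * v j + (\<Sum>k\<in>{..<N} - {j}. Z (s,k) w * v k)" for s
        using j by (simp add: sum.remove)
      then have "?f j w = (\<Sum>t<T. (\<Sum>s<T. v j * (a t s * Z (t,j) w * Z (s,j) w)) + Z (t,j) w * (\<Sum>s<T. \<Sum>k\<in>{..<N} - {j}. a t s * v k * Z (s,k) w))"
        by (simp add: distrib_left sum.distrib sum_distrib_left mult_ac)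
      also have "\<dots> = v j * W w + U w"
        unfolding U_def W_def sumJ sumK c_def by (simp add: sum.distrib sum_distrib_left)
      finally show ?thesis by simp
    qed
    \<comment> \<open>Dominates the square of \<open>U + v j * W\<close>. The form bound controls
      \<open>W\<close> by \<open>\<alpha>\<close> times a sum of squares, and Cauchy-Schwarz turns
      the square of that sum into \<open>T\<close> times a sum of fourth powers.\<close>
    define D where "D w = 2 * (U w)^2 + 2 * \<alpha>^2 * (v j)^2 * (real T * (\<Sum>t<T. (Z (t,j) w) ^ 4))" for w
    have intU: "integrable M (\<lambda>w. (U w)^2)"
      unfolding U_def by (rule decoupled_second_moment(1)[OF JK])
    have int4s: "integrable M (\<lambda>w. \<Sum>t<T. (Z (t,j) w) ^ 4)"
      using j by (intro Bochner_Integration.integrable_sum int4) auto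
    have EU: "expectation (\<lambda>w. (U w)^2) \<le> real T * \<alpha>^2 * ?V"
    proof -
      have "expectation (\<lambda>w. (U w)^2) = (\<Sum>t<T. \<Sum>s<T. (a t s)^2 * (\<Sum>k\<in>{..<N} - {j}. (v k)^2))"
        unfolding U_def decoupled_second_moment(2)[OF JK] unfolding sumJ sumK c_def
        by (simp add: power_mult_distrib sum_distrib_left)
      also have "\<dots> = (\<Sum>t<T. \<Sum>s<T. (a t s)^2) * (\<Sum>k\<in>{..<N} - {j}. (v k)^2)"
        by (simp add: sum_distrib_right)
      also have "\<dots> \<le> (real T * \<alpha>^2) * ?V"
        by (intro mult_mono hs sum_mono2 sum_nonneg) auto
      finally show ?thesis .
    qed
    have E4: "expectation (\<lambda>w. \<Sum>t<T. (Z (t,j) w) ^ 4) \<le> real T * C"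
    proof -
      have "expectation (\<lambda>w. \<Sum>t<T. (Z (t,j) w) ^ 4) = (\<Sum>t<T. expectation (\<lambda>w. (Z (t,j) w) ^ 4))"
        using j by (intro Bochner_Integration.integral_sum int4) auto
      also have "\<dots> \<le> (\<Sum>t<T. C)" using j by (intro sum_mono m4) auto
      finally show ?thesis by simp
    qed
    show ?thesis
    proof (rule mean_boundedI[of D])
      show "integrable M D" unfolding D_def using intU int4s by simp
      have "expectation D = 2 * expectation (\<lambda>w. (U w)^2) + 2 * \<alpha>^2 * (v j)^2 * (real T * expectation (\<lambda>w. \<Sum>t<T. (Z (t,j) w) ^ 4))"
        unfolding D_def using intU int4s by (subst Bochner_Integration.integral_add) simp_all
      also have "\<dots> \<le> 2 * (real T * \<alpha>^2 * ?V) + 2 * \<alpha>^2 * (v j)^2 * (real T * (real T * C))"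
        by (intro add_mono mult_left_mono EU E4) simp_all
      finally show "expectation D \<le> 2 * (real T * \<alpha>^2 * ?V) + 2 * \<alpha>^2 * (v j)^2 * (C * (real T)^2)"
        by (simp add: power2_eq_square mult_ac)
      fix w
      have "(W w)^2 \<le> (\<alpha> * (\<Sum>t<T. (Z (t,j) w)^2))^2"
        using power_mono[OF form[of "\<lambda>t. Z (t,j) w"], of 2] by (simp add: W_def)
      also have "\<dots> \<le> \<alpha>^2 * (real T * (\<Sum>t<T. (Z (t,j) w) ^ 4))"
      proof -
        have "(\<Sum>t<T. (Z (t,j) w)^2)^2 \<le> (\<Sum>t<T. ((Z (t,j) w)^2)^2) * real T"
          using sum_squared_le_sum_of_squares[where f = "\<lambda>t. (Z (t,j) w)^2" and I = "{..<T}"] by simp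
        then show ?thesis unfolding power_mult_distrib by (intro mult_left_mono) (simp_all add: mult.commute)
      qed
      finally have "(v j)^2 * (W w)^2 \<le> (v j)^2 * (\<alpha>^2 * (real T * (\<Sum>t<T. (Z (t,j) w) ^ 4)))"
        by (rule mult_left_mono) simp
      moreover have "(U w + v j * W w)^2 \<le> 2 * (U w)^2 + 2 * ((v j)^2 * (W w)^2)"
      proof -
        have "0 \<le> (U w - v j * W w)^2" by simp
        then show ?thesis by (simp add: power2_eq_square algebra_simps)
      qed
      moreover have "D w = 2 * (U w)^2 + 2 * ((v j)^2 * (\<alpha>^2 * (real T * (\<Sum>t<T. (Z (t,j) w) ^ 4))))"
        unfolding D_def by simp
      ultimately show "(?f j w)^2 \<le> D w" unfolding split by linarith
    qed simp
  qed
  then have "mean_bounded (\<lambda>w. \<Sum>j<N. (?f j w)^2) (\<Sum>j<N. 2 * (real T * \<alpha>^2 * ?V) + 2 * \<alpha>^2 * (v j)^2 * (C * (real T)^2))"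
    by (intro mean_bounded_sum) auto
  moreover have "(\<Sum>j<N. 2 * (real T * \<alpha>^2 * ?V) + 2 * \<alpha>^2 * (v j)^2 * (C * (real T)^2))
      = 2 * \<alpha>^2 * ?V * (real N * real T + C * (real T)^2)"
    by (simp add: sum.distrib distrib_left mult_ac flip: sum_distrib_left sum_distrib_right)
  ultimately show ?thesis by simp
qed

end

section \<open>Noise correlated across time and units\<close>

locale noise_matrix = prob_space +
  fixes T N :: nat and S :: "'a \<Rightarrow> real mat" and C c :: real and P1 P2 :: "real mat" and E :: "'a \<Rightarrow> real mat"
  assumes noise: "white_noise M T N (\<lambda>p w. S w $$ p) C"
    and S: "\<And>w. w \<in> space M \<Longrightarrow> S w \<in> carrier_mat T N"
    and P1: "P1 \<in> carrier_mat T T" and P2: "P2 \<in> carrier_mat N N" and c: "0 \<le> c"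
    and P1_le: "\<And>x. x \<in> carrier_vec T \<Longrightarrow> (euc_norm (P1 *\<^sub>v x))\<^sup>2 \<le> c * (euc_norm x)^2"
    and P2_le: "\<And>x. x \<in> carrier_vec N \<Longrightarrow> (euc_norm (P2 *\<^sub>v x))\<^sup>2 \<le> c * (euc_norm x)^2"
    and E: "\<And>w. w \<in> space M \<Longrightarrow> E w = P1 * S w * P2"
begin

lemma P1T_le: "x \<in> carrier_vec T \<Longrightarrow> (euc_norm (P1\<^sup>T *\<^sub>v x))\<^sup>2 \<le> c * (euc_norm x)^2"
  by (rule adjoint_bound[OF P1 P1_le _ c])

lemma P2T_le: "x \<in> carrier_vec N \<Longrightarrow> (euc_norm (P2\<^sup>T *\<^sub>v x))\<^sup>2 \<le> c * (euc_norm x)^2"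
  by (rule adjoint_bound[OF P2 P2_le _ c])

lemma E_carrier: "w \<in> space M \<Longrightarrow> E w \<in> carrier_mat T N"
  unfolding E by (rule mult_carrier_mat[OF mult_carrier_mat[OF P1 S] P2])

lemma ET_mult:
  assumes w: "w \<in> space M" and x: "x \<in> carrier_vec T"
  shows "(E w)\<^sup>T *\<^sub>v x = P2\<^sup>T *\<^sub>v ((S w)\<^sup>T *\<^sub>v (P1\<^sup>T *\<^sub>v x))"
proof -
  have P1T: "P1\<^sup>T \<in> carrier_mat T T" and ST: "(S w)\<^sup>T \<in> carrier_mat N T"
    and P2T: "P2\<^sup>T \<in> carrier_mat N N" using P1 S[OF w] P2 by simp_all
  have "(E w)\<^sup>T = P2\<^sup>T * ((S w)\<^sup>T * P1\<^sup>T)"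
    unfolding E[OF w] transpose_mult[OF mult_carrier_mat[OF P1 S[OF w]] P2] transpose_mult[OF P1 S[OF w]] ..
  then show ?thesis
    unfolding assoc_mult_mat_vec[OF ST P1T x, symmetric]
    using assoc_mult_mat_vec[OF P2T mult_carrier_mat[OF ST P1T] x] by simp
qed

text \<open>With \<open>A = P1\<^sup>T P1\<close> and \<open>v = P2 b\<close> the vector is
  \<open>P2\<^sup>T S\<^sup>T A S v\<close>, so \<open>quadratic_image_mean_bounded\<close> applies
  with \<open>\<alpha> = c\<close>. Of the factor \<open>c ^ 4\<close>, two powers come from
  \<open>A\<close>, one from \<open>v\<close> and one from the outer
  \<open>P2\<^sup>T\<close>.\<close>

lemma gram_noise_mean_bounded:
  assumes b: "b \<in> carrier_vec N"
  shows "mean_bounded (\<lambda>w. (euc_norm (((E w)\<^sup>T * E w) *\<^sub>v b))^2)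
    (2 * c ^ 4 * (euc_norm b)^2 * (real N * real T + C * (real T)^2))"
proof -
  let ?L = "real N * real T + C * (real T)^2"
  interpret Z: white_noise M T N "\<lambda>p w. S w $$ p" C by (rule noise)
  have P1T: "P1\<^sup>T \<in> carrier_mat T T" using P1 by simp
  define A where "A = P1\<^sup>T * P1"
  have A: "A \<in> carrier_mat T T" unfolding A_def by (rule mult_carrier_mat[OF P1T P1])
  define v where "v = P2 *\<^sub>v b"
  have v: "v \<in> carrier_vec N" unfolding v_def by (rule mult_mat_vec_carrier[OF P2 b])
  define f where "f w = (\<Sum>j<N. (\<Sum>t<T. S w $$ (t,j) * (\<Sum>s<T. A $$ (t,s) * (\<Sum>k<N. S w $$ (s,k) * v $ k)))^2)" for w
  \<comment> \<open>Each column of \<open>A\<close> is the image of a unit vector and has length at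
    most \<open>c\<close>.\<close>
  have hs: "(\<Sum>t<T. \<Sum>s<T. (A $$ (t,s))^2) \<le> real T * c^2"
  proof -
    have "(\<Sum>t<T. \<Sum>s<T. (A $$ (t,s))^2) = (\<Sum>s<T. (euc_norm (col A s))^2)"
      using A fro_norm_sq[of A] fro_norm_sq_cols[of A] by simp
    also have "\<dots> \<le> (\<Sum>s<T. c^2)"
    proof (rule sum_mono)
      fix s assume "s \<in> {..<T}"
      then have s: "s < T" by simp
      have u: "unit_vec T s \<in> carrier_vec T" by simp
      have Pu: "P1 *\<^sub>v unit_vec T s \<in> carrier_vec T" by (rule mult_mat_vec_carrier[OF P1 u])
      have "col A s = A *\<^sub>v unit_vec T s" using A s by (intro eq_vecI) simp_all
      also have "\<dots> = P1\<^sup>T *\<^sub>v (P1 *\<^sub>v unit_vec T s)"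
        unfolding A_def by (rule assoc_mult_mat_vec[OF P1T P1 u])
      finally have "(euc_norm (col A s))^2 \<le> c * (euc_norm (P1 *\<^sub>v unit_vec T s))^2" using P1T_le[OF Pu] by simp
      also have "\<dots> \<le> c * (c * (euc_norm (unit_vec T s))^2)" by (intro mult_left_mono P1_le u c)
      also have "(euc_norm (unit_vec T s))^2 = 1" unfolding euc_norm_sq using s by simp
      finally show "(euc_norm (col A s))^2 \<le> c^2" by (simp add: power2_eq_square)
    qed
    finally show ?thesis by simp
  qed
  have form: "\<bar>\<Sum>t<T. \<Sum>s<T. A $$ (t,s) * z t * z s\<bar> \<le> c * (\<Sum>t<T. (z t)^2)" for z :: "nat \<Rightarrow> real"
  proof -
    let ?z = "Matrix.vec T z"
    have z: "?z \<in> carrier_vec T" by simp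
    have "(\<Sum>t<T. \<Sum>s<T. A $$ (t,s) * z t * z s) = ?z \<bullet> (A *\<^sub>v ?z)"
      using A carrier_vecD[OF mult_mat_vec_carrier[OF A z]]
      by (simp add: scalar_prod_sum[of ?z] mult_mat_vec_index[OF A z] sum_distrib_left mult_ac del: index_mult_mat_vec)
    also have "\<dots> = (euc_norm (P1 *\<^sub>v ?z))^2" unfolding A_def by (rule euc_norm_mult_sq[OF P1 z, symmetric])
    finally have "(\<Sum>t<T. \<Sum>s<T. A $$ (t,s) * z t * z s) = (euc_norm (P1 *\<^sub>v ?z))^2" .
    then show ?thesis using P1_le[OF z] by (simp add: euc_norm_sq_sum[of ?z])
  qed
  have mb: "mean_bounded f (2 * c^2 * (\<Sum>k<N. (v $ k)^2) * ?L)"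
    unfolding f_def by (rule Z.quadratic_image_mean_bounded[OF c hs form])
  \<comment> \<open>The sign of \<open>C\<close> is read off a fourth moment, which needs an entry
    to exist; empty dimensions are therefore treated separately below.\<close>
  have C0: "0 \<le> C" if "0 < T" "0 < N"
  proof -
    have "0 \<le> expectation (\<lambda>w. (S w $$ (0,0)) ^ 4)" by simp
    also have "\<dots> \<le> C" using that by (intro Z.m4) simp
    finally show ?thesis .
  qed
  show ?thesis
  proof (rule mean_bounded_mono[OF mean_bounded_cmult[OF mb c]])
    fix w assume w: "w \<in> space M"
    let ?u = "S w *\<^sub>v v"
    let ?v = "A *\<^sub>v ?u"
    let ?x = "(S w)\<^sup>T *\<^sub>v ?v"
    have Sv: "?u \<in> carrier_vec T" by (rule mult_mat_vec_carrier[OF S[OF w] v])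
    have ASv: "?v \<in> carrier_vec T" by (rule mult_mat_vec_carrier[OF A Sv])
    have ST: "(S w)\<^sup>T \<in> carrier_mat N T" using S[OF w] by simp
    have SASv: "?x \<in> carrier_vec N" by (rule mult_mat_vec_carrier[OF ST ASv])
    have Ew: "E w \<in> carrier_mat T N" by (rule E_carrier[OF w])
    have ET: "(E w)\<^sup>T \<in> carrier_mat N T" using Ew by simp
    have Eb: "E w *\<^sub>v b = P1 *\<^sub>v ?u"
      unfolding E[OF w] v_def assoc_mult_mat_vec[OF mult_carrier_mat[OF P1 S[OF w]] P2 b]
      by (rule assoc_mult_mat_vec[OF P1 S[OF w]]) (use v in \<open>simp add: v_def\<close>)
    have Ebc: "E w *\<^sub>v b \<in> carrier_vec T" by (rule mult_mat_vec_carrier[OF Ew b])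
    have "((E w)\<^sup>T * E w) *\<^sub>v b = (E w)\<^sup>T *\<^sub>v (E w *\<^sub>v b)"
      by (rule assoc_mult_mat_vec[OF ET Ew b])
    also have "\<dots> = P2\<^sup>T *\<^sub>v ((S w)\<^sup>T *\<^sub>v (P1\<^sup>T *\<^sub>v (E w *\<^sub>v b)))"
      by (rule ET_mult[OF w Ebc])
    also have "P1\<^sup>T *\<^sub>v (E w *\<^sub>v b) = ?v"
      unfolding Eb A_def by (rule assoc_mult_mat_vec[OF P1T P1 Sv, symmetric])
    finally have eq: "((E w)\<^sup>T * E w) *\<^sub>v b = P2\<^sup>T *\<^sub>v ?x" .
    have Svi: "?u $ s = (\<Sum>k<N. S w $$ (s,k) * v $ k)" if "s < T" for s
      by (rule mult_mat_vec_index[OF S[OF w] v that])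
    have ASvi: "?v $ t = (\<Sum>s<T. A $$ (t,s) * (\<Sum>k<N. S w $$ (s,k) * v $ k))" if "t < T" for t
      unfolding mult_mat_vec_index[OF A Sv that] by (intro sum.cong) (simp_all add: Svi del: index_mult_mat_vec)
    have "?x $ j = (\<Sum>t<T. S w $$ (t,j) * (\<Sum>s<T. A $$ (t,s) * (\<Sum>k<N. S w $$ (s,k) * v $ k)))" if "j < N" for j
      unfolding mult_mat_vec_index[OF ST ASv that] using S[OF w] that
      by (intro sum.cong) (simp_all add: ASvi del: index_mult_mat_vec)
    then have "(euc_norm ?x)^2 = f w"
      unfolding euc_norm_sq_sum f_def using carrier_vecD[OF SASv] by (intro sum.cong) (simp_all del: index_mult_mat_vec)
    then show "(euc_norm (((E w)\<^sup>T * E w) *\<^sub>v b))^2 \<le> c * f w"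
      unfolding eq using P2T_le[OF SASv] by simp
  next
    have le: "c * (2 * c^2 * (euc_norm v)^2 * ?L) \<le> c * (2 * c^2 * (c * (euc_norm b)^2) * ?L)"
    proof (cases "0 < T \<and> 0 < N")
      case True
      have vb: "(euc_norm v)^2 \<le> c * (euc_norm b)^2" unfolding v_def by (rule P2_le[OF b])
      show ?thesis by (intro mult_left_mono mult_right_mono vb) (use c C0 True in simp_all)
    next
      case False
      then have "T = 0 \<or> (euc_norm v)\<^sup>2 = 0 \<and> (euc_norm b)\<^sup>2 = 0"
        using b v by (auto simp: euc_norm_sq_sum)
      then show ?thesis by auto
    qed
    show "c * (2 * c^2 * (\<Sum>k<N. (v $ k)^2) * ?L)
      \<le> 2 * c ^ 4 * (euc_norm b)^2 * ?L"
    proof -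
      have sv: "(\<Sum>k<N. (v $ k)^2) = (euc_norm v)^2" using v by (simp add: euc_norm_sq_sum)
      have eq: "c * (2 * c^2 * (c * x) * y) = 2 * c ^ 4 * x * y" for x y
        by (simp add: power2_eq_square power4_eq_xxxx)
      show ?thesis using le unfolding sv eq .
    qed
  qed simp_all
qed

lemma gram_noise_mult_mean_bounded:
  assumes B: "B \<in> carrier_mat N m"
  shows "mean_bounded (\<lambda>w. (fro_norm ((E w)\<^sup>T * E w * B))^2)
    (2 * c ^ 4 * (fro_norm B)^2 * (real N * real T + C * (real T)^2))"
proof (rule mean_bounded_mono)
  show "mean_bounded (\<lambda>w. \<Sum>l<m. (euc_norm (((E w)\<^sup>T * E w) *\<^sub>v col B l))^2)
    (\<Sum>l<m. 2 * c ^ 4 * (euc_norm (col B l))^2 * (real N * real T + C * (real T)^2))"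
    by (intro mean_bounded_sum gram_noise_mean_bounded carrier_vecI) (use B in simp)
  show "(\<Sum>l<m. 2 * c ^ 4 * (euc_norm (col B l))^2 * (real N * real T + C * (real T)^2))
    \<le> 2 * c ^ 4 * (fro_norm B)^2 * (real N * real T + C * (real T)^2)"
    using B by (simp add: fro_norm_sq_cols sum_distrib_left sum_distrib_right mult_ac)
  fix w assume w: "w \<in> space M"
  have EE: "(E w)\<^sup>T * E w \<in> carrier_mat N N" using E_carrier[OF w] by simp
  show "(fro_norm ((E w)\<^sup>T * E w * B))^2 \<le> (\<Sum>l<m. (euc_norm (((E w)\<^sup>T * E w) *\<^sub>v col B l))^2)"
    unfolding fro_norm_sq_cols using B by (simp add: col_mult2[OF EE B])
qed simp

lemma gram_noise_fro_mean_bounded: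
  "mean_bounded (\<lambda>w. (fro_norm ((E w)\<^sup>T * E w))^2)
    (2 * c ^ 4 * real N * (real N * real T + C * (real T)^2))"
proof (rule mean_bounded_mono[OF gram_noise_mult_mean_bounded[of "1\<^sub>m N" N]])
  have "(fro_norm (1\<^sub>m N))^2 = real N"
    by (simp add: fro_norm_sq if_distrib[of "\<lambda>x. x^2"] cong: if_cong)
  then show "2 * c ^ 4 * (fro_norm (1\<^sub>m N))^2 * (real N * real T + C * (real T)^2) \<le> 2 * c ^ 4 * real N * (real N * real T + C * (real T)^2)"
    by simp
  fix w assume w: "w \<in> space M"
  have "(E w)\<^sup>T * E w \<in> carrier_mat N N" using E_carrier[OF w] by simp
  then show "(fro_norm ((E w)\<^sup>T * E w))^2 \<le> (fro_norm ((E w)\<^sup>T * E w * 1\<^sub>m N))^2"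
    by (simp only: right_mult_one_mat order_refl)
qed simp_all

text \<open>Entry \<open>j\<close> of \<open>S\<^sup>T P1\<^sup>T f\<close>, for a column
  \<open>f\<close> of \<open>F\<close>, pairs the orthonormal entries of one column of
  \<open>S\<close> with the entries of \<open>P1\<^sup>T f\<close>, which are independent of
  \<open>S\<close>. Its second moment is the expected squared length of \<open>P1\<^sup>T f\<close>,
  at most \<open>c * T\<close>; the outer \<open>P2\<^sup>T\<close> costs the second factor
  \<open>c\<close>.\<close>

lemma factor_noise_mean_bounded:
  fixes F :: "'a \<Rightarrow> real mat"
  assumes ind: "indep_mats M T N S T r F" and F: "\<And>w. w \<in> space M \<Longrightarrow> F w \<in> carrier_mat T r"
    and Fm: "\<And>t l. t < T \<Longrightarrow> l < r \<Longrightarrow> (\<lambda>w. F w $$ (t,l)) \<in> borel_measurable M"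
    and F2: "\<And>t l. t < T \<Longrightarrow> l < r \<Longrightarrow> integrable M (\<lambda>w. (F w $$ (t,l))^2)"
    and EF2: "\<And>t l. t < T \<Longrightarrow> l < r \<Longrightarrow> expectation (\<lambda>w. (F w $$ (t,l))^2) = 1"
  shows "mean_bounded (\<lambda>w. (fro_norm ((F w)\<^sup>T * E w))^2) (c^2 * (real r * real N * real T))"
proof -
  interpret Z: white_noise M T N "\<lambda>p w. S w $$ p" C by (rule noise)
  have P1T: "P1\<^sup>T \<in> carrier_mat T T" using P1 by simp
  define h where "h l t w = (\<Sum>u<T. P1 $$ (u,t) * F w $$ (u,l))" for l t w
  let ?s = "\<lambda>l j w. \<Sum>t<T. S w $$ (t,j) * h l t w"
  have h2: "integrable M (\<lambda>w. (h l t w)^2)" if l: "l < r" for l t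
  proof -
    have "(h l t w)^2 = (\<Sum>u<T. \<Sum>v<T. P1 $$ (u,t) * P1 $$ (v,t) * (F w $$ (u,l) * F w $$ (v,l)))" for w
      by (simp add: h_def power2_eq_square sum_product mult_ac)
    then show ?thesis
      using l by (simp only:) (intro Bochner_Integration.integrable_sum integrable_mult_right integrable_mult_of_squares Fm F2; simp)
  qed
  have mb: "mean_bounded (\<lambda>w. (?s l j w)^2) (c * real T)" if j: "j < N" and l: "l < r" for j l
  proof (rule mean_boundedI)
    let ?f = "\<lambda>t (x :: nat \<times> nat \<Rightarrow> real). x (t,j)" and ?g = "\<lambda>t (x :: nat \<times> nat \<Rightarrow> real). \<Sum>u<T. P1 $$ (u,t) * x (u,l)"
    have fe: "?f t (entries T N S w) = S w $$ (t,j)" if "t \<in> {..<T}" for t w using that j by (simp add: entries_def)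
    have ge: "?g t (entries T r F w) = h l t w" for t w using l by (simp add: entries_def h_def)
    note iv = ind[unfolded indep_mats_def]
    have f: "?f t \<in> borel_measurable (PiM ({..<T} \<times> {..<N}) (\<lambda>_. borel))" if "t \<in> {..<T}" for t using that j by simp
    have gm: "?g t \<in> borel_measurable (PiM ({..<T} \<times> {..<r}) (\<lambda>_. borel))" for t
      using l by (intro borel_measurable_sum borel_measurable_times borel_measurable_const measurable_component_singleton) simp
    have f2: "integrable M (\<lambda>w. (?f t (entries T N S w))^2)" if "t \<in> {..<T}" for t
      unfolding fe[OF that] using that j by (intro Z.int2) simp
    have g2: "integrable M (\<lambda>w. (?g t (entries T r F w))^2)" for t unfolding ge by (rule h2[OF l])
    have orth: "expectation (\<lambda>w. ?f p (entries T N S w) * ?f q (entries T N S w)) = (if p = q then 1 else 0)"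
      if "p \<in> {..<T}" "q \<in> {..<T}" for p q
      unfolding fe[OF that(1)] fe[OF that(2)] using Z.orthonormal[of "(p,j)" "(q,j)"] that j by simp
    note * = bilinear_second_moment[OF iv finite_lessThan[of T], of ?f ?g, OF f gm f2 g2 orth]
    have eq: "(\<Sum>p<T. ?f p (entries T N S w) * ?g p (entries T r F w)) = (?s l j w)" for w
      unfolding ge using fe by (intro sum.cong) auto
    show "integrable M (\<lambda>w. (?s l j w)^2)" using *(1) unfolding eq by simp
    have "expectation (\<lambda>w. (?s l j w)^2) = (\<Sum>t<T. expectation (\<lambda>w. (h l t w)^2))"
      using *(2) unfolding eq unfolding ge by simp
    also have "\<dots> = expectation (\<lambda>w. \<Sum>t<T. (h l t w)^2)"
      using h2[OF l] by (intro Bochner_Integration.integral_sum[symmetric])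
    also have "\<dots> \<le> expectation (\<lambda>w. c * (\<Sum>t<T. (F w $$ (t,l))^2))"
    proof (rule integral_mono)
      show "integrable M (\<lambda>w. \<Sum>t<T. (h l t w)^2)" using h2[OF l] by (intro Bochner_Integration.integrable_sum)
      show "integrable M (\<lambda>w. c * (\<Sum>t<T. (F w $$ (t,l))^2))"
        using F2 l by (intro integrable_mult_right Bochner_Integration.integrable_sum) simp
      fix w assume w: "w \<in> space M"
      have Fl: "col (F w) l \<in> carrier_vec T" using F[OF w] by (intro carrier_vecI) simp
      have "(\<Sum>t<T. (h l t w)^2) = (euc_norm (P1\<^sup>T *\<^sub>v col (F w) l))^2"
        unfolding euc_norm_sq_sum h_def using P1 F[OF w] l
        by (intro sum.cong) (simp_all add: mult_mat_vec_index[OF P1T Fl] del: index_mult_mat_vec)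
      also have "\<dots> \<le> c * (euc_norm (col (F w) l))^2" by (rule P1T_le[OF Fl])
      also have "(euc_norm (col (F w) l))^2 = (\<Sum>t<T. (F w $$ (t,l))^2)"
        using F[OF w] l by (simp add: euc_norm_sq_sum)
      finally show "(\<Sum>t<T. (h l t w)^2) \<le> c * (\<Sum>t<T. (F w $$ (t,l))^2)" .
    qed
    also have "\<dots> = c * (\<Sum>t<T. expectation (\<lambda>w. (F w $$ (t,l))^2))"
      using F2 l by (subst Bochner_Integration.integral_mult_right_zero, subst Bochner_Integration.integral_sum) simp_all
    also have "\<dots> = c * real T" using EF2 l by simp
    finally show "expectation (\<lambda>w. (?s l j w)^2) \<le> c * real T" by simp
  qed simp_all
  have mb2: "mean_bounded (\<lambda>w. \<Sum>l<r. \<Sum>j<N. (?s l j w)^2) (\<Sum>l<r. \<Sum>j<N. c * real T)"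
    by (intro mean_bounded_sum mb) auto
  show ?thesis
  proof (rule mean_bounded_mono[OF mean_bounded_cmult[OF mb2 c]])
    show "c * (\<Sum>l<r. \<Sum>j<N. c * real T) \<le> c^2 * (real r * real N * real T)" by (simp add: power2_eq_square)
    fix w assume w: "w \<in> space M"
    have Ew: "E w \<in> carrier_mat T N" by (rule E_carrier[OF w])
    have ET: "(E w)\<^sup>T \<in> carrier_mat N T" and FT: "(F w)\<^sup>T \<in> carrier_mat r T" using Ew F[OF w] by simp_all
    have ST: "(S w)\<^sup>T \<in> carrier_mat N T" using S[OF w] by simp
    have "((F w)\<^sup>T * E w)\<^sup>T = (E w)\<^sup>T * F w"
      by (simp add: transpose_mult[OF FT Ew])
    then have "(fro_norm ((F w)\<^sup>T * E w))^2 = (fro_norm ((E w)\<^sup>T * F w))^2"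
      by (metis fro_norm_transpose)
    also have "\<dots> = (\<Sum>l<r. (euc_norm ((E w)\<^sup>T *\<^sub>v col (F w) l))^2)"
      unfolding fro_norm_sq_cols using F[OF w] by (simp add: col_mult2[OF ET F[OF w]])
    also have "\<dots> \<le> (\<Sum>l<r. c * (\<Sum>j<N. (?s l j w)^2))"
    proof (rule sum_mono)
      fix l assume "l \<in> {..<r}"
      then have l: "l < r" by simp
      have Fl: "col (F w) l \<in> carrier_vec T" using F[OF w] by (intro carrier_vecI) simp
      have PF: "P1\<^sup>T *\<^sub>v col (F w) l \<in> carrier_vec T" by (rule mult_mat_vec_carrier[OF P1T Fl])
      let ?x = "(S w)\<^sup>T *\<^sub>v (P1\<^sup>T *\<^sub>v col (F w) l)"
      have x: "?x \<in> carrier_vec N" by (rule mult_mat_vec_carrier[OF ST PF])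
      have "(P1\<^sup>T *\<^sub>v col (F w) l) $ t = h l t w" if "t < T" for t
        unfolding h_def mult_mat_vec_index[OF P1T Fl that] using P1 F[OF w] l that by (intro sum.cong) simp_all
      then have "?x $ j = (?s l j w)" if "j < N" for j
        unfolding mult_mat_vec_index[OF ST PF that] using S[OF w] that by (intro sum.cong) (simp_all del: index_mult_mat_vec)
      then have "(euc_norm ?x)^2 = (\<Sum>j<N. (?s l j w)^2)"
        unfolding euc_norm_sq_sum using carrier_vecD[OF x] by (intro sum.cong) (simp_all del: index_mult_mat_vec)
      then show "(euc_norm ((E w)\<^sup>T *\<^sub>v col (F w) l))^2 \<le> c * (\<Sum>j<N. (?s l j w)^2)"
        unfolding ET_mult[OF w Fl] using P2T_le[OF x] by simp
    qed
    also have "\<dots> = c * (\<Sum>l<r. \<Sum>j<N. (?s l j w)^2)" by (simp only: sum_distrib_left)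
    finally show "(fro_norm ((F w)\<^sup>T * E w))^2 \<le> c * (\<Sum>l<r. \<Sum>j<N. (?s l j w)^2)" .
  qed simp
qed

end

section \<open>Consistency\<close>

lemma (in prob_space) prob_Int_ge:
  assumes "A \<in> events" "B \<in> events"
  shows "prob A + prob B - 1 \<le> prob (A \<inter> B)"
proof -
  have "space M - A \<inter> B = (space M - A) \<union> (space M - B)" by blast
  moreover have "prob ((space M - A) \<union> (space M - B)) \<le> prob (space M - A) + prob (space M - B)"
    using assms by (intro measure_Un_le) auto
  ultimately show ?thesis using assms prob_compl[of A] prob_compl[of B] prob_compl[of "A \<inter> B"] by auto
qed

lemma fro_norm_mult_le_contraction:
  assumes A: "A \<in> carrier_mat n n" and B: "B \<in> carrier_mat n m"
    and le: "\<And>x. x \<in> carrier_vec n \<Longrightarrow> euc_norm (A *\<^sub>v x) \<le> euc_norm x"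
  shows "fro_norm (A * B) \<le> fro_norm B"
proof (rule power2_le_imp_le)
  have "(euc_norm (A *\<^sub>v col B j))^2 \<le> (euc_norm (col B j))^2" for j
    using B by (intro power_mono le carrier_vecI) simp_all
  then show "(fro_norm (A * B))^2 \<le> (fro_norm B)^2"
    unfolding fro_norm_sq_cols using B by (simp add: col_mult2[OF A B] sum_mono)
qed simp

lemma fro_norm_smult: "fro_norm (k \<cdot>\<^sub>m A) = \<bar>k\<bar> * fro_norm A"
proof -
  have "(fro_norm (k \<cdot>\<^sub>m A))^2 = (\<bar>k\<bar> * fro_norm A)^2"
    by (simp add: fro_norm_sq power_mult_distrib sum_distrib_left)
  then show ?thesis by (simp add: power2_eq_iff_nonneg)
qed

section \<open>Recovery probability at a fixed sample size\<close>

context noise_matrix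
begin

text \<open>The bounds \<open>e1\<close>, \<open>e2\<close>, \<open>e3\<close> come from
  \<open>K\<close> times the mean bounds, so each fails with probability at most
  \<open>1 / K\<close>. \<open>e1\<close> carries no \<open>T\<close> because \<open>G\<close> is
  \<open>F / sqrt T\<close>.\<close>

theorem grouped_recovery_prob:
  fixes F Fhat X :: "'a \<Rightarrow> real mat" and B :: "real mat" and r K0 :: nat and lam \<kappa> \<beta> K :: real
    and \<G> :: "nat set set" and bG :: "nat set \<Rightarrow> real Matrix.vec" and Ghat :: "'a \<Rightarrow> nat set set"
  assumes pos: "0 < N" "0 < T" "0 < lam" "0 < r" "r \<le> T" "0 < c" "0 < C" "0 < \<kappa>" "0 < \<beta>" "0 < K"
    and ind: "indep_mats M T N S T r F" and F: "random_mat M T r F"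
    and F2: "\<And>t l. t < T \<Longrightarrow> l < r \<Longrightarrow> integrable M (\<lambda>w. (F w $$ (t,l))^2)"
    and EF2: "\<And>t l. t < T \<Longrightarrow> l < r \<Longrightarrow> expectation (\<lambda>w. (F w $$ (t,l))^2) = 1"
    and FF: "AE w in M. (1 / real T) \<cdot>\<^sub>m ((F w)\<^sup>T * F w) = 1\<^sub>m r"
    and B: "B \<in> carrier_mat N r" and B_le: "fro_norm B \<le> \<beta> * sqrt (real N)"
    and sig: "\<And>a. a \<in> carrier_vec r \<Longrightarrow> \<kappa> * real N * (euc_norm a)^2 \<le> (B *\<^sub>v a) \<bullet> (D_inv N lam *\<^sub>v (B *\<^sub>v a))"
    and X: "\<And>w. w \<in> space M \<Longrightarrow> X w = F w * B\<^sup>T + E w"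
    and ppca: "\<And>w. w \<in> space M \<Longrightarrow> ppca_F N T r lam (X w) (Fhat w)"
    and part: "partition_on {..<N} \<G>" and card: "card \<G> = K0"
    and grp: "\<And>A i. A \<in> \<G> \<Longrightarrow> i \<in> A \<Longrightarrow> row B i = bG A"
    and ahc: "\<And>w. w \<in> space M \<Longrightarrow> ahc (Delta_hat r (ppca_B N T lam (X w) (Fhat w))) N K0 (Ghat w)"
    and e1: "e1 = sqrt (K * (c^2 * (real r * real N)))" and e1_small: "e1^2 \<le> \<kappa> / 4 * real N * real T"
    and e2: "e2 = sqrt (K * (2 * c ^ 4 * (\<beta>^2 * real N) * (real N * real T + C * (real T)^2)))"
    and e3: "e3 = sqrt (K * (2 * c ^ 4 * real N * (real N * real T + C * (real T)^2)))"
    and e3_small: "e3 \<le> \<kappa> / 4 * real N * real T / 2" "real r * e3 \<le> 3 / 4 * (\<kappa> / 4 * real N * real T)"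
    and D: "D \<in> events"
    and sep: "\<And>w. w \<in> D \<Longrightarrow>
      8 * real r * \<beta>^2 * (2 * (e1 * \<beta> / sqrt (\<kappa> / 4)) + 2 * (e2 / (\<kappa> / 4 * real N * sqrt (real T)))) / sqrt (real T)
        < \<kappa> / 4 * d_sep \<G> B (H_mat N T r lam B (X w) (F w) (Fhat w))"
    and meas: "{w \<in> space M. Ghat w = \<G>} \<in> events"
  shows "prob D - 3 / K \<le> prob {w \<in> space M. Ghat w = \<G>}"
proof -
  let ?L = "real N * real T + C * (real T)^2"
  have L: "0 < ?L" using pos by (simp add: add_pos_pos)
  have Fc: "F w \<in> carrier_mat T r" if "w \<in> space M" for w using F that by (simp add: random_mat_def)
  have Fm: "(\<lambda>w. F w $$ (t,l)) \<in> borel_measurable M" if "t < T" "l < r" for t l using F that by (simp add: random_mat_def)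
  have DB: "D_inv N lam * B \<in> carrier_mat N r" by (rule mult_carrier_mat[OF D_inv_carrier B])
  have DBle: "(fro_norm (D_inv N lam * B))^2 \<le> \<beta>^2 * real N"
  proof -
    have "fro_norm (D_inv N lam * B) \<le> fro_norm B"
      by (rule fro_norm_mult_le_contraction[OF D_inv_carrier B D_inv_norm_le]) (use pos in simp_all)
    then have "(fro_norm (D_inv N lam * B))^2 \<le> (\<beta> * sqrt (real N))^2" using B_le by (intro power_mono) simp_all
    then show ?thesis by (simp add: power_mult_distrib)
  qed
  let ?b1 = "c^2 * (real r * real N * real T)" and ?b2 = "2 * c ^ 4 * (\<beta>^2 * real N) * ?L" and ?b3 = "2 * c ^ 4 * real N * ?L"
  have b: "0 < ?b1" "0 < ?b2" "0 < ?b3" using pos L by simp_all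
  have mb1: "mean_bounded (\<lambda>w. (fro_norm ((F w)\<^sup>T * E w))^2) ?b1"
    by (rule factor_noise_mean_bounded[OF ind Fc Fm F2 EF2])
  have mb2: "mean_bounded (\<lambda>w. (fro_norm ((E w)\<^sup>T * E w * (D_inv N lam * B)))^2) ?b2"
    by (rule mean_bounded_mono[OF gram_noise_mult_mean_bounded[OF DB]])
      (use DBle L pos in \<open>auto intro!: mult_right_mono mult_left_mono\<close>)
  have mb3: "mean_bounded (\<lambda>w. (fro_norm ((E w)\<^sup>T * E w))^2) ?b3"
    by (rule gram_noise_fro_mean_bounded)
  obtain A1 where A1: "A1 \<in> events" "1 - ?b1 / (K * ?b1) \<le> prob A1"
      "\<And>w. w \<in> A1 \<Longrightarrow> (fro_norm ((F w)\<^sup>T * E w))\<^sup>2 < K * ?b1"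
    using mean_bounded_event[OF mb1, of "K * ?b1"] b pos by auto
  obtain A2 where A2: "A2 \<in> events" "1 - ?b2 / (K * ?b2) \<le> prob A2"
      "\<And>w. w \<in> A2 \<Longrightarrow> (fro_norm ((E w)\<^sup>T * E w * (D_inv N lam * B)))\<^sup>2 < K * ?b2"
    using mean_bounded_event[OF mb2, of "K * ?b2"] b pos by auto
  obtain A3 where A3: "A3 \<in> events" "1 - ?b3 / (K * ?b3) \<le> prob A3"
      "\<And>w. w \<in> A3 \<Longrightarrow> (fro_norm ((E w)\<^sup>T * E w))\<^sup>2 < K * ?b3"
    using mean_bounded_event[OF mb3, of "K * ?b3"] b pos by auto
  have ratio: "x / (K * x) = 1 / K" if "0 < x" for x using that by simp
  \<comment> \<open>Orthonormality of the factors holds almost surely; a measurable null set is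
    removed so that the good set stays an event.\<close>
  obtain Z where Z: "{w \<in> space M. (1 / real T) \<cdot>\<^sub>m ((F w)\<^sup>T * F w) \<noteq> 1\<^sub>m r} \<subseteq> Z" "emeasure M Z = 0" "Z \<in> events"
    using AE_E[OF FF] by blast
  have A4: "space M - Z \<in> events" "prob (space M - Z) = 1"
    using Z prob_compl[OF Z(3)] by (auto simp: measure_def)
  let ?good = "D \<inter> A1 \<inter> (A2 \<inter> A3) \<inter> (space M - Z)"
  have "prob D - 3 / K \<le> prob ?good"
    using prob_Int_ge[OF D A1(1)] prob_Int_ge[OF A2(1) A3(1)] prob_Int_ge[of "D \<inter> A1" "A2 \<inter> A3"]
      prob_Int_ge[of "D \<inter> A1 \<inter> (A2 \<inter> A3)" "space M - Z"] D A1(1,2) A2(1,2) A3(1,2) A4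
    unfolding ratio[OF b(1)] ratio[OF b(2)] ratio[OF b(3)] by auto
  also have "\<dots> \<le> prob {w \<in> space M. Ghat w = \<G>}"
  proof (rule finite_measure_mono[OF _ meas], rule subsetI)
    fix w assume good: "w \<in> ?good"
    then have w: "w \<in> space M" by simp
    have FFw: "(1 / real T) \<cdot>\<^sub>m ((F w)\<^sup>T * F w) = 1\<^sub>m r" using good Z(1) by blast
    define G where "G = (1 / sqrt (real T)) \<cdot>\<^sub>m F w"
    have G: "G \<in> carrier_mat T r" using Fc[OF w] by (simp add: G_def)
    have FT: "(F w)\<^sup>T \<in> carrier_mat r T" using Fc[OF w] by simp
    have FG: "F w = sqrt (real T) \<cdot>\<^sub>m G" unfolding G_def using pos by (intro eq_matI) auto
    have GT: "G\<^sup>T = (1 / sqrt (real T)) \<cdot>\<^sub>m (F w)\<^sup>T"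
      unfolding G_def by (rule eq_matI) auto
    have GG: "G\<^sup>T * G = 1\<^sub>m r"
    proof -
      have "G\<^sup>T * G = (1 / sqrt (real T)) \<cdot>\<^sub>m ((1 / sqrt (real T)) \<cdot>\<^sub>m ((F w)\<^sup>T * F w))"
        unfolding GT unfolding G_def mult_smult_distrib[OF smult_carrier_mat[OF FT] Fc[OF w]]
          mult_smult_assoc_mat[OF FT Fc[OF w]] ..
      also have "\<dots> = (1 / real T) \<cdot>\<^sub>m ((F w)\<^sup>T * F w)"
        using pos by (intro eq_matI) auto
      finally show ?thesis unfolding FFw .
    qed
    define W where "W = X w * D_inv N lam * (X w)\<^sup>T"
    have mD: "minv (D_mat N lam) = D_inv N lam" using pos by (intro minv_D_mat)
    obtain Q where Q: "Q \<in> carrier_mat T r" "Q\<^sup>T * Q = 1\<^sub>m r"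
      "\<And>l. l < r \<Longrightarrow> eigenvector W (col Q l) (nth_eig W l)" and FQ: "Fhat w = sqrt (real T) \<cdot>\<^sub>m Q"
      using ppca[OF w] unfolding ppca_F_def Let_def mD W_def by blast
    have BT: "B\<^sup>T \<in> carrier_mat r N" using B by simp
    have Xw: "X w = sqrt (real T) \<cdot>\<^sub>m (G * B\<^sup>T) + E w"
      unfolding X[OF w] FG mult_smult_assoc_mat[OF G BT] ..
    have f1: "fro_norm (G\<^sup>T * E w) \<le> e1"
    proof -
      have "G\<^sup>T * E w = (1 / sqrt (real T)) \<cdot>\<^sub>m ((F w)\<^sup>T * E w)"
        unfolding GT by (rule mult_smult_assoc_mat[OF FT E_carrier[OF w]])
      then have "(fro_norm (G\<^sup>T * E w))^2 = (fro_norm ((F w)\<^sup>T * E w))^2 / real T"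
        by (simp add: fro_norm_smult power_mult_distrib power_divide)
      also have "\<dots> \<le> K * ?b1 / real T" using A1(3)[of w] good by (intro divide_right_mono) auto
      also have "\<dots> = K * (c^2 * (real r * real N))" using pos by simp
      finally show ?thesis unfolding e1 by (rule real_le_rsqrt)
    qed
    have f2: "fro_norm ((E w)\<^sup>T * E w * (D_inv N lam * B)) \<le> e2"
      unfolding e2 using A2(3)[of w] good by (intro real_le_rsqrt) auto
    have f3: "fro_norm ((E w)\<^sup>T * E w) \<le> e3"
      unfolding e3 using A3(3)[of w] good by (intro real_le_rsqrt) auto
    interpret P: ppca_event N T r lam G Q "E w" B "X w" W \<kappa> \<beta> e1 e2 e3 "\<kappa> / 4"
    by unfold_locales (fact pos G GG Q B E_carrier[OF w] Xw W_def sig f1 f2 f3 B_le e1_small e3_small refl)+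
    have "ahc (Delta_hat r P.Bhat) N K0 (Ghat w)"
      using ahc[OF w] unfolding P.Bhat_def FQ .
    moreover have "8 * real r * \<beta>^2 * P.\<zeta> / sqrt (real T) < \<kappa> / 4 * d_sep \<G> B P.H"
      using sep[of w] good unfolding P.\<zeta>_def P.H_def FQ FG[symmetric] by blast
    ultimately have "Ghat w = \<G>"
      by (intro P.ahc_recovers_groups[OF pos(4) part card, where bG = bG] grp)
    then show "w \<in> {w \<in> space M. Ghat w = \<G>}" using w by simp
  qed
  finally show ?thesis .
qed

end

text \<open>If \<open>lam > 1\<close>, the rate makes \<open>B\<^sup>*\<close> negligible, and the signal lies along the all-ones vector,
  which \<open>D\<^sup>-\<^sup>1\<close> does not shrink.\<close>

lemma eventually_signal:
  fixes B U :: "nat \<Rightarrow> real mat" and N T :: "nat \<Rightarrow> nat" and lam :: "nat \<Rightarrow> real" and \<Sigma> :: "real mat"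
  assumes N: "filterlim N at_top sequentially" and T: "filterlim T at_top sequentially"
    and B: "\<And>n. B n \<in> carrier_mat (N n) r" and \<Sigma>: "\<Sigma> \<in> carrier_mat r r"
    and conv: "\<And>i j. i < r \<Longrightarrow> j < r \<Longrightarrow>
      (\<lambda>n. ((1 / real (N n)) \<cdot>\<^sub>m ((B n)\<^sup>T * B n)) $$ (i,j)) \<longlonglongrightarrow> \<Sigma> $$ (i,j)"
    and c2: "0 < c2" "c2 \<le> nth_eig \<Sigma> (r - 1)"
    and lam: "\<And>n. 0 < lam n" and U: "\<And>n. spec_U (N n) (lam n) (U n)"
    and rate: "lam \<in> O(\<lambda>n. real (N n) / (real (T n) * (fro_norm (B_star (N n) (U n) (B n)))^2))"
  shows "eventually (\<lambda>n. \<forall>a\<in>carrier_vec r. c2 / 4 * real (N n) * (euc_norm a)^2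
    \<le> (B n *\<^sub>v a) \<bullet> (D_inv (N n) (lam n) *\<^sub>v (B n *\<^sub>v a))) sequentially"
proof -
  define S where "S n = (1 / real (N n)) \<cdot>\<^sub>m ((B n)\<^sup>T * B n)" for n
  have BB: "(B n)\<^sup>T * B n \<in> carrier_mat r r" for n
    by (rule mult_carrier_mat[OF _ B]) (simp add: B)
  have S: "S n \<in> carrier_mat r r" for n using BB by (simp add: S_def)
  have symS: "S n $$ (i,j) = S n $$ (j,i)" if "i < r" "j < r" for n i j
    using that B[of n] by (simp add: S_def scalar_prod_sum mult.commute)
  have conv': "(\<lambda>n. S n $$ (i,j)) \<longlonglongrightarrow> \<Sigma> $$ (i,j)" if "i < r" "j < r" for i j
    using conv[OF that] by (simp add: S_def)
  have "\<Sigma> $$ (i,j) = \<Sigma> $$ (j,i)" if "i < r" "j < r" for i j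
    using LIMSEQ_unique[OF conv'[OF that]] conv'[OF that(2,1)] symS[OF that] by simp
  then have sym: "\<Sigma>\<^sup>T = \<Sigma>" using \<Sigma> by (intro eq_matI) auto
  have "(\<lambda>n. sqrt (\<Sum>i<r. \<Sum>j<r. (S n $$ (i,j) - \<Sigma> $$ (i,j))^2)) \<longlonglongrightarrow> sqrt (\<Sum>i<r. \<Sum>j<r. (\<Sigma> $$ (i,j) - \<Sigma> $$ (i,j))^2)"
    by (intro tendsto_real_sqrt tendsto_sum tendsto_power tendsto_diff conv' tendsto_const) auto
  moreover have "fro_norm (S n - \<Sigma>) = sqrt (\<Sum>i<r. \<Sum>j<r. (S n $$ (i,j) - \<Sigma> $$ (i,j))^2)" for n
    using S[of n] \<Sigma> by (simp add: fro_norm_def)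
  ultimately have "(\<lambda>n. fro_norm (S n - \<Sigma>)) \<longlonglongrightarrow> 0" by simp
  \<comment> \<open>Half of \<open>c2\<close> is given up to the convergence of the Gram matrices,
    another half to the penalty in \<open>D_inv_form_ge\<close>; hence \<open>c2 / 4\<close> in the
    claim.\<close>
  then have ev1: "eventually (\<lambda>n. fro_norm (S n - \<Sigma>) < c2 / 2) sequentially"
    using c2 by (intro order_tendstoD) auto
  obtain k where k: "0 < k" and ev2: "eventually (\<lambda>n. norm (lam n) \<le> k * norm (real (N n) / (real (T n) * (fro_norm (B_star (N n) (U n) (B n)))^2))) sequentially"
    using landau_o.bigE[OF rate] by blast
  \<comment> \<open>This threshold on \<open>T\<close> makes the rate bound at most 1 as soon as the
    squared norm of \<open>B_star\<close> exceeds \<open>c2 / 4\<close> times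
    \<open>N\<close>.\<close>
  have ev3: "eventually (\<lambda>n. nat \<lceil>4 * k / c2\<rceil> + 1 \<le> T n) sequentially" and ev4: "eventually (\<lambda>n. 1 \<le> N n) sequentially"
    using T N unfolding filterlim_at_top by blast+
  show ?thesis
    using ev1 ev2 ev3 ev4
  proof eventually_elim
    case (elim n)
    let ?s = "(fro_norm (B_star (N n) (U n) (B n)))^2"
    have N0: "0 < N n" using elim by simp
    have T0: "0 < T n" and Tk: "4 * k / c2 \<le> real (T n)" using elim(3) by linarith+
    have cs: "lam n \<le> 1 \<or> ?s \<le> (c2 / 2 * real (N n)) / 2"
    proof (rule disjCI)
      assume "\<not> ?s \<le> (c2 / 2 * real (N n)) / 2"
      then have s: "c2 / 4 * real (N n) < ?s" by simp
      then have s0: "0 < ?s" using c2 N0 by (meson less_trans mult_pos_pos of_nat_0_less_iff zero_less_divide_iff zero_less_numeral)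
      have "lam n \<le> k * (real (N n) / (real (T n) * ?s))" using elim(2) lam[of n] by simp
      also have "\<dots> = (4 * k / c2) * (c2 / 4 * real (N n)) / (real (T n) * ?s)" using c2 by simp
      also have "\<dots> \<le> (real (T n) * ?s) / (real (T n) * ?s)"
        using s Tk k c2 s0 by (intro divide_right_mono mult_mono) auto
      also have "\<dots> = 1" using s0 T0 by simp
      finally show "lam n \<le> 1" .
    qed
    show ?case
    proof
      fix a :: "real Matrix.vec" assume a: "a \<in> carrier_vec r"
      have Sa: "\<Sigma> *\<^sub>v a \<in> carrier_vec r" by (rule mult_mat_vec_carrier[OF \<Sigma> a])
      have SS: "S n - \<Sigma> \<in> carrier_mat r r" by (rule minus_carrier_mat[OF \<Sigma>])
      have SSa: "(S n - \<Sigma>) *\<^sub>v a \<in> carrier_vec r" by (rule mult_mat_vec_carrier[OF SS a])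
      have Sna: "S n *\<^sub>v a \<in> carrier_vec r" by (rule mult_mat_vec_carrier[OF S a])
      have "a \<bullet> ((S n - \<Sigma>) *\<^sub>v a) = a \<bullet> (S n *\<^sub>v a) - a \<bullet> (\<Sigma> *\<^sub>v a)"
        unfolding minus_mult_distrib_mat_vec[OF S \<Sigma> a] by (rule scalar_prod_minus_distrib[OF a Sna Sa])
      moreover have "\<bar>a \<bullet> ((S n - \<Sigma>) *\<^sub>v a)\<bar> \<le> c2 / 2 * (euc_norm a)^2"
      proof -
        have "\<bar>a \<bullet> ((S n - \<Sigma>) *\<^sub>v a)\<bar> \<le> euc_norm a * euc_norm ((S n - \<Sigma>) *\<^sub>v a)"
          by (rule cauchy_schwarz_vec) (simp only: carrier_vecD[OF a] carrier_vecD[OF SSa])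
        also have "\<dots> \<le> euc_norm a * (c2 / 2 * euc_norm a)"
          using elim(1) by (intro mult_left_mono order_trans[OF euc_norm_mult_le[OF SS a]] mult_right_mono) simp_all
        finally show ?thesis by (simp add: power2_eq_square mult_ac)
      qed
      moreover have "c2 * (euc_norm a)^2 \<le> a \<bullet> (\<Sigma> *\<^sub>v a)" by (rule symmetric_form_ge[OF \<Sigma> sym c2(2) a])
      moreover have "a \<bullet> (S n *\<^sub>v a) = 1 / real (N n) * (euc_norm (B n *\<^sub>v a))^2"
        unfolding S_def smult_mat_mult_vec[OF BB a] euc_norm_mult_sq[OF B a]
        using a mult_mat_vec_carrier[OF BB a] by simp
      ultimately have "c2 / 2 * (euc_norm a)^2 \<le> 1 / real (N n) * (euc_norm (B n *\<^sub>v a))^2" by linarith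
      then have "real (N n) * (c2 / 2 * (euc_norm a)^2) \<le> real (N n) * (1 / real (N n) * (euc_norm (B n *\<^sub>v a))^2)"
        by (rule mult_left_mono) simp
      then have "c2 / 2 * real (N n) * (euc_norm a)^2 \<le> (euc_norm (B n *\<^sub>v a))^2" using N0 by (simp add: mult_ac)
      from D_inv_form_ge[OF U N0 lam B a this cs]
      show "c2 / 4 * real (N n) * (euc_norm a)^2 \<le> (B n *\<^sub>v a) \<bullet> (D_inv (N n) (lam n) *\<^sub>v (B n *\<^sub>v a))"
        by simp
    qed
  qed
qed

section \<open>Rates as both dimensions grow\<close>

text \<open>The first noise term is of order \<open>sqrt (N / T)\<close>, the second of order
  \<open>1 / sqrt T + 1 / sqrt N\<close>; since \<open>N\<close> is at least 1,
  \<open>1 / sqrt T\<close> is below \<open>sqrt (N / T)\<close>. So \<open>m\<close> dominates all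
  of them.\<close>

lemma noise_rate:
  fixes N T :: nat and K c C \<beta> \<kappa> :: real
  assumes N: "0 < N" and T: "0 < T" and K: "0 < K" and c: "0 < c" and C: "0 < C" and \<beta>: "0 < \<beta>" and \<kappa>: "0 < \<kappa>"
  defines "m \<equiv> max (sqrt (real N / real T)) (1 / sqrt (real N))"
  shows "8 * real r * \<beta>^2 * (2 * (sqrt (K * (c^2 * (real r * real N))) * \<beta> / sqrt (\<kappa> / 4))
      + 2 * (sqrt (K * (2 * c ^ 4 * (\<beta>^2 * real N) * (real N * real T + C * (real T)^2))) / (\<kappa> / 4 * real N * sqrt (real T)))) / sqrt (real T)
    \<le> 8 * real r * \<beta>^2 * (2 * (sqrt (K * c^2 * real r) * \<beta> / sqrt (\<kappa> / 4))
      + 2 * (sqrt (K * 2 * c ^ 4 * \<beta>^2) * (1 + sqrt C) / (\<kappa> / 4))) * m"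
proof -
  let ?e2 = "sqrt (K * (2 * c ^ 4 * (\<beta>^2 * real N) * (real N * real T + C * (real T)^2)))"
  let ?n = "sqrt (real N)" and ?t = "sqrt (real T)"
  have n: "0 < ?n" "1 \<le> ?n" "?n * ?n = real N" and t: "0 < ?t" "?t * ?t = real T" using N T by auto
  have m1: "?n / ?t \<le> m" and m2: "1 / ?n \<le> m" by (simp_all add: m_def real_sqrt_divide)
  have m3: "1 / ?t \<le> m" using divide_right_mono[OF n(2), of ?t] t m1 by simp
  let ?a = "sqrt (K * c^2 * real r)" and ?b = "sqrt (K * 2 * c ^ 4 * \<beta>^2)"
  have e1: "sqrt (K * (c^2 * (real r * real N))) = ?a * ?n" by (simp add: real_sqrt_mult)
  have 1: "?a * ?n / ?t \<le> ?a * m"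
  proof -
    have "?a * (?n / ?t) \<le> ?a * m" by (rule mult_left_mono[OF m1]) (use K in simp)
    then show ?thesis by simp
  qed
  have 2: "?e2 / (real N * real T) \<le> ?b * ((1 + sqrt C) * m)"
  proof -
    have "?e2 = ?b * (?n * sqrt (real N * real T + C * (real T)^2))"
      by (simp add: real_sqrt_mult[symmetric] mult_ac)
    also have "\<dots> \<le> ?b * (?n * (?n * ?t + sqrt C * real T))"
    proof (intro mult_left_mono)
      have "sqrt (real N * real T + C * (real T)^2) \<le> sqrt (real N * real T) + sqrt (C * (real T)^2)"
        using C by (intro sqrt_add_le_add_sqrt) simp_all
      then show "sqrt (real N * real T + C * (real T)^2) \<le> ?n * ?t + sqrt C * real T" by (simp add: real_sqrt_mult)
    qed (use K in simp_all)
    finally have "?e2 / (real N * real T)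
        \<le> ?b * (?n * (?n * ?t + sqrt C * real T)) / (real N * real T)"
      by (rule divide_right_mono) simp
    also have "\<dots> = ?b * (1 / ?t + sqrt C * (1 / ?n))"
    proof -
      have "?n * (?n * ?t + sqrt C * real T) / (real N * real T) = 1 / ?t + sqrt C * (1 / ?n)"
      proof -
        have "x * (x * y + s * (y * y)) / ((x * x) * (y * y)) = 1 / y + s * (1 / x)" if "0 < x" "0 < y" for x y s :: real
          using that by (simp add: field_simps)
        from this[OF n(1) t(1), of "sqrt C"] show ?thesis unfolding n(3) t(2) .
      qed
      then show ?thesis by (metis times_divide_eq_right)
    qed
    also have "\<dots> \<le> ?b * (m + sqrt C * m)"
      by (intro mult_left_mono add_mono m3 m2) (use K C in simp_all)
    finally show ?thesis by (simp add: distrib_right)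
  qed
  have s2: "?e2 / (\<kappa> / 4 * real N * ?t) / ?t = ?e2 / (real N * real T) / (\<kappa> / 4)"
    using t by (simp add: mult_ac)
  have alg: "2 * ((a * m) * b / s) + 2 * ((q * (h * m)) / k) = (2 * (a * b / s) + 2 * (q * h / k)) * m"
    for a b s q h k :: real by (simp add: algebra_simps)
  have "(2 * (?a * ?n * \<beta> / sqrt (\<kappa> / 4)) + 2 * (?e2 / (\<kappa> / 4 * real N * ?t))) / ?t
      = 2 * ((?a * ?n / ?t) * \<beta> / sqrt (\<kappa> / 4)) + 2 * (?e2 / (\<kappa> / 4 * real N * ?t) / ?t)"
    by (simp add: add_divide_distrib)
  also have "\<dots> \<le> 2 * ((?a * m) * \<beta> / sqrt (\<kappa> / 4)) + 2 * ((?b * ((1 + sqrt C) * m)) / (\<kappa> / 4))"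
    unfolding s2 by (intro add_mono mult_left_mono divide_right_mono mult_right_mono 1 2) (use \<beta> \<kappa> in simp_all)
  also have "\<dots> = (2 * (?a * \<beta> / sqrt (\<kappa> / 4)) + 2 * (?b * (1 + sqrt C) / (\<kappa> / 4))) * m"
    by (rule alg)
  finally have fin: "(2 * (?a * ?n * \<beta> / sqrt (\<kappa> / 4)) + 2 * (?e2 / (\<kappa> / 4 * real N * ?t))) / ?t
    \<le> (2 * (?a * \<beta> / sqrt (\<kappa> / 4)) + 2 * (?b * (1 + sqrt C) / (\<kappa> / 4))) * m" .
  have "8 * real r * \<beta>^2 * ((2 * (?a * ?n * \<beta> / sqrt (\<kappa> / 4)) + 2 * (?e2 / (\<kappa> / 4 * real N * ?t))) / ?t)
    \<le> 8 * real r * \<beta>^2 * ((2 * (?a * \<beta> / sqrt (\<kappa> / 4)) + 2 * (?b * (1 + sqrt C) / (\<kappa> / 4))) * m)"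
    by (rule mult_left_mono[OF fin]) simp
  then show ?thesis unfolding e1 by (simp only: times_divide_eq_right mult.assoc)
qed

text \<open>Squared and divided by the square of \<open>N * T\<close>, the left side is
  \<open>k * (1 / T + C / N)\<close>, which vanishes whatever the relative growth of
  \<open>N\<close> and \<open>T\<close>.\<close>

lemma noise_gram_negligible:
  fixes N T :: "nat \<Rightarrow> nat"
  assumes N: "filterlim N at_top sequentially" and T: "filterlim T at_top sequentially" and \<delta>: "0 < \<delta>"
  shows "eventually (\<lambda>n. sqrt (k * real (N n) * (real (N n) * real (T n) + C * (real (T n))^2))
    \<le> \<delta> * real (N n) * real (T n)) sequentially"
proof -
  have N': "filterlim (\<lambda>n. real (N n)) at_top sequentially" and T': "filterlim (\<lambda>n. real (T n)) at_top sequentially"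
    using filterlim_compose[OF filterlim_real_sequentially N] filterlim_compose[OF filterlim_real_sequentially T] .
  have "(\<lambda>n. k * (1 / real (T n) + C * (1 / real (N n)))) \<longlonglongrightarrow> k * (0 + C * 0)"
    by (intro tendsto_mult tendsto_add tendsto_const
        tendsto_divide_0[OF tendsto_const filterlim_at_top_imp_at_infinity[OF T']]
        tendsto_divide_0[OF tendsto_const filterlim_at_top_imp_at_infinity[OF N']])
  then have "eventually (\<lambda>n. k * (1 / real (T n) + C * (1 / real (N n))) < \<delta>^2) sequentially"
    using \<delta> by (intro order_tendstoD) auto
  moreover have "eventually (\<lambda>n. 1 \<le> T n) sequentially" "eventually (\<lambda>n. 1 \<le> N n) sequentially"
    using T N unfolding filterlim_at_top by blast+
  ultimately show ?thesis
  proof eventually_elim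
    case (elim n)
    let ?N = "real (N n)" and ?T = "real (T n)"
    have "k * ?N * (?N * ?T + C * ?T\<^sup>2) = k * (1 / ?T + C * (1 / ?N)) * (?N * ?T)^2"
      using elim by (simp add: field_simps power2_eq_square)
    also have "\<dots> \<le> \<delta>^2 * (?N * ?T)^2" using elim by (intro mult_right_mono) auto
    also have "\<dots> = (\<delta> * ?N * ?T)^2" by (simp add: power_mult_distrib)
    finally show ?case using \<delta> by (intro real_le_lsqrt) auto
  qed
qed

theorem theorem3p4:
  fixes M :: "'w measure"
    and N T :: "nat \<Rightarrow> nat" and r K0 :: nat
    and F S E X Fhat :: "nat \<Rightarrow> 'w \<Rightarrow> real mat"
    and B P1 P2 U :: "nat \<Rightarrow> real mat" and Sigma_B :: "real mat"
    and \<G> :: "nat \<Rightarrow> nat set set" and bG :: "nat \<Rightarrow> nat set \<Rightarrow> real Matrix.vec"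
    and Ghat :: "nat \<Rightarrow> 'w \<Rightarrow> nat set set"
    and lam :: "nat \<Rightarrow> real"
    and C1 C2 C3 c1 c2 c3 c4 :: real
  assumes "prob_space M"
    and "filterlim N at_top sequentially" and "filterlim T at_top sequentially"
    and "r \<ge> 1"
    \<comment> \<open>factor model with grouped loadings\<close>
    and "\<And>n. random_mat M (T n) r (F n)"
    and "\<And>n. random_mat M (T n) (N n) (S n)"
    and "\<And>n. B n \<in> carrier_mat (N n) r"
    and "\<And>n \<omega>. \<omega> \<in> space M \<Longrightarrow> X n \<omega> = F n \<omega> * transpose_mat (B n) + E n \<omega>"
    and "\<And>n. partition_on {..<N n} (\<G> n)" and "\<And>n. card (\<G> n) = K0"
    and "\<And>n A i. A \<in> \<G> n \<Longrightarrow> i \<in> A \<Longrightarrow> Matrix.row (B n) i = bG n A"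
    \<comment> \<open>(A1)\<close>
    and "C1 > 0"
    and "\<And>n t l. t < T n \<Longrightarrow> l < r \<Longrightarrow>
           integrable M (\<lambda>\<omega>. (F n \<omega> $$ (t,l)) ^ 4) \<and>
           prob_space.expectation M (\<lambda>\<omega>. F n \<omega> $$ (t,l)) = 0 \<and>
           prob_space.expectation M (\<lambda>\<omega>. (F n \<omega> $$ (t,l)) ^ 2) = 1 \<and>
           prob_space.expectation M (\<lambda>\<omega>. (F n \<omega> $$ (t,l)) ^ 4) \<le> C1"
    and "\<And>n. AE \<omega> in M. (1 / real (T n)) \<cdot>\<^sub>m (transpose_mat (F n \<omega>) * F n \<omega>) = 1\<^sub>m r"
    and "\<And>n v. v \<in> carrier_vec (T n) \<Longrightarrow> euc_norm v = 1 \<Longrightarrow>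
           prob_space.expectation M (\<lambda>\<omega>. (euc_norm (transpose_mat (F n \<omega>) *\<^sub>v v)) ^ 2) \<le> C1"
    \<comment> \<open>(A2)\<close>
    and "C2 > 0"
    and "\<And>n j l. j < N n \<Longrightarrow> l < r \<Longrightarrow> \<bar>B n $$ (j,l)\<bar> \<le> C2"
    and "Sigma_B \<in> carrier_mat r r"
    and "\<And>i j. i < r \<Longrightarrow> j < r \<Longrightarrow>
           (\<lambda>n. ((1 / real (N n)) \<cdot>\<^sub>m (transpose_mat (B n) * B n)) $$ (i,j))
             \<longlonglongrightarrow> Sigma_B $$ (i,j)"
    and "c1 > 0" and "c2 > 0"
    and "nth_eig Sigma_B 0 \<le> c1"
    and "\<And>l. Suc l < r \<Longrightarrow> nth_eig Sigma_B (Suc l) < nth_eig Sigma_B l"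
    and "nth_eig Sigma_B (r - 1) \<ge> c2"
    \<comment> \<open>(A3)\<close>
    and "C3 > 0"
    and "\<And>n. P1 n \<in> carrier_mat (T n) (T n)" and "\<And>n. P2 n \<in> carrier_mat (N n) (N n)"
    and "\<And>n \<omega>. \<omega> \<in> space M \<Longrightarrow> E n \<omega> = P1 n * S n \<omega> * P2 n"
    and "\<And>n. prob_space.indep_vars M (\<lambda>_. borel) (\<lambda>p \<omega>. S n \<omega> $$ p) ({..<T n} \<times> {..<N n})"
    and "\<And>n t j. t < T n \<Longrightarrow> j < N n \<Longrightarrow>
           integrable M (\<lambda>\<omega>. (S n \<omega> $$ (t,j)) ^ 4) \<and>
           prob_space.expectation M (\<lambda>\<omega>. S n \<omega> $$ (t,j)) = 0 \<and>
           prob_space.expectation M (\<lambda>\<omega>. (S n \<omega> $$ (t,j)) ^ 2) = 1 \<and>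
           prob_space.expectation M (\<lambda>\<omega>. (S n \<omega> $$ (t,j)) ^ 4) \<le> C3"
    and "c3 > 0" and "c4 > 0"
    and "\<And>n t. t < T n \<Longrightarrow> c4 \<le> nth_eig (transpose_mat (P1 n) * P1 n) t
                          \<and> nth_eig (transpose_mat (P1 n) * P1 n) t \<le> c3"
    and "\<And>n j. j < N n \<Longrightarrow> c4 \<le> nth_eig (transpose_mat (P2 n) * P2 n) j
                          \<and> nth_eig (transpose_mat (P2 n) * P2 n) j \<le> c3"
    and "\<And>n. indep_mats M (T n) (N n) (S n) (T n) r (F n)"
    \<comment> \<open>PPCA and AHC estimators\<close>
    and "\<And>n. lam n > 0"
    and "\<And>n. random_mat M (T n) r (Fhat n)"
    and "\<And>n \<omega>. \<omega> \<in> space M \<Longrightarrow> ppca_F (N n) (T n) r (lam n) (X n \<omega>) (Fhat n \<omega>)"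
    and "\<And>n. Ghat n \<in> measurable M (count_space UNIV)"
    and "\<And>n \<omega>. \<omega> \<in> space M \<Longrightarrow>
           ahc (Delta_hat r (ppca_B (N n) (T n) (lam n) (X n \<omega>) (Fhat n \<omega>))) (N n) K0 (Ghat n \<omega>)"
    \<comment> \<open>the rate \<open>d\<^sub>n\<close> is random, so \<open>o(d\<^sub>n)\<close> is understood in probability\<close>
    and "\<And>\<epsilon>. \<epsilon> > 0 \<Longrightarrow>
           (\<lambda>n. prob_space.prob M {\<omega> \<in> space M.
              max (sqrt (real (N n) / real (T n))) (1 / sqrt (real (N n)))
                \<le> \<epsilon> * d_sep (\<G> n) (B n)
                       (H_mat (N n) (T n) r (lam n) (B n) (X n \<omega>) (F n \<omega>) (Fhat n \<omega>))})
             \<longlonglongrightarrow> 1"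
    and "\<And>n. spec_U (N n) (lam n) (U n)"
    and "lam \<in> \<Theta>(\<lambda>n. real (N n) / (real (T n) * (fro_norm (B_star (N n) (U n) (B n)))\<^sup>2))"
  shows "(\<lambda>n. prob_space.prob M {\<omega> \<in> space M. Ghat n \<omega> = \<G> n}) \<longlonglongrightarrow> 1"
proof -
  interpret prob_space M by (rule assms(1))
  have r: "0 < r" using assms(4) by simp
  note N = assms(2) and T = assms(3) and B = assms(7)
  have c3: "0 < c3" and C3: "0 < C3" and C2: "0 < C2" and c2: "0 < c2" by (fact assms)+
  \<comment> \<open>The \<open>N * r\<close> entries of the loading matrix are at most
    \<open>C2\<close> in absolute value.\<close>
  define \<beta> where "\<beta> = sqrt (real r) * C2"
  have \<beta>: "0 < \<beta>" using r C2 by (simp add: \<beta>_def)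
  define \<kappa> where "\<kappa> = c2 / 4"
  have \<kappa>: "0 < \<kappa>" using c2 by (simp add: \<kappa>_def)
  have B_le: "fro_norm (B n) \<le> \<beta> * sqrt (real (N n))" for n
  proof (rule power2_le_imp_le)
    have "(fro_norm (B n))^2 \<le> (\<Sum>i<N n. \<Sum>l<r. C2^2)"
      unfolding fro_norm_sq carrier_matD[OF B]
      using power_mono[OF assms(17), of _ n _ 2] by (intro sum_mono) auto
    also have "\<dots> = (\<beta> * sqrt (real (N n)))^2" by (simp add: \<beta>_def power_mult_distrib)
    finally show "(fro_norm (B n))^2 \<le> (\<beta> * sqrt (real (N n)))^2" .
  qed (use \<beta> in simp)
  have sc: "S n w \<in> carrier_mat (T n) (N n)" if "w \<in> space M" for n w
    using assms(6)[of n] that by (simp add: random_mat_def)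
  have noise: "white_noise M (T n) (N n) (\<lambda>p w. S n w $$ p) C3" for n
    by unfold_locales (use assms(29)[of n] assms(30)[of _ n] in auto)
  have noise_mat: "noise_matrix M (T n) (N n) (S n) C3 c3 (P1 n) (P2 n) (E n)" for n
  proof (intro noise_matrix.intro noise_matrix_axioms.intro prob_space_axioms)
    show "white_noise M (T n) (N n) (\<lambda>p w. S n w $$ p) C3" by (rule noise)
    show "(euc_norm (P1 n *\<^sub>v x))^2 \<le> c3 * (euc_norm x)^2" if "x \<in> carrier_vec (T n)" for x
      using assms(33) that by (intro gram_eig_bound[OF assms(26)]) auto
    show "(euc_norm (P2 n *\<^sub>v x))^2 \<le> c3 * (euc_norm x)^2" if "x \<in> carrier_vec (N n)" for x
      using assms(34) that by (intro gram_eig_bound[OF assms(27)]) auto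
  qed (use sc assms(26-28) c3 in auto)
  have rate: "lam \<in> O(\<lambda>n. real (N n) / (real (T n) * (fro_norm (B_star (N n) (U n) (B n)))^2))"
    using assms(43) by (rule bigthetaD1)
  have signal: "eventually (\<lambda>n. \<forall>a\<in>carrier_vec r. c2 / 4 * real (N n) * (euc_norm a)^2
      \<le> (B n *\<^sub>v a) \<bullet> (D_inv (N n) (lam n) *\<^sub>v (B n *\<^sub>v a))) sequentially"
    by (rule eventually_signal[OF N T B assms(18) _ c2 assms(24) assms(36) assms(42) rate]) (rule assms(19))
  show ?thesis
  proof (rule tendstoI)
    fix e :: real assume e: "0 < e"
    \<comment> \<open>The three noise events cost \<open>3 / K = e / 2\<close>; the other half of
      \<open>e\<close> is spent on the separation event.\<close>
    define K where "K = 6 / e"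
    have K: "0 < K" using e by (simp add: K_def)
    define c' where "c' = 8 * real r * \<beta>^2 * (2 * (sqrt (K * c3^2 * real r) * \<beta> / sqrt (\<kappa> / 4))
      + 2 * (sqrt (K * 2 * c3 ^ 4 * \<beta>^2) * (1 + sqrt C3) / (\<kappa> / 4)))"
    have c': "0 < c'" unfolding c'_def using r \<beta> \<kappa> K c3 C3
      by (intro mult_pos_pos add_pos_pos divide_pos_pos) auto
    \<comment> \<open>\<open>c' * \<epsilon>\<close> is half of the allowed
      \<open>\<kappa> / 4\<close>, so the separation becomes strict once the distance is known to be
      positive.\<close>
    define \<epsilon> where "\<epsilon> = \<kappa> / 8 / c'"
    have \<epsilon>: "0 < \<epsilon>" using \<kappa> c' by (simp add: \<epsilon>_def)
    let ?d = "\<lambda>n w. d_sep (\<G> n) (B n) (H_mat (N n) (T n) r (lam n) (B n) (X n w) (F n w) (Fhat n w))"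
    define m where "m n = max (sqrt (real (N n) / real (T n))) (1 / sqrt (real (N n)))" for n
    define D where "D n = {w \<in> space M. m n \<le> \<epsilon> * ?d n w}" for n
    have "(\<lambda>n. prob (D n)) \<longlonglongrightarrow> 1" unfolding D_def m_def by (rule assms(41)[OF \<epsilon>])
    \<comment> \<open>The maximum with 0 also makes the probability positive, which is used for
      measurability below.\<close>
    then have evD: "eventually (\<lambda>n. max 0 (1 - e / 2) < prob (D n)) sequentially"
      using e by (intro order_tendstoD) auto
    \<comment> \<open>The two terms meet the two smallness conditions on \<open>e3\<close>:
      absorption in the noise bound and closeness of the factor spaces.\<close>
    define \<delta> where "\<delta> = min (\<kappa> / 8) (3 * \<kappa> / (16 * real r))"
    have \<delta>: "0 < \<delta>" using \<kappa> r by (simp add: \<delta>_def)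
    \<comment> \<open>The first summand gives the smallness of \<open>e1\<close>, the second
      \<open>r \<le> T n\<close>.\<close>
    have evT: "eventually (\<lambda>n. nat \<lceil>K * c3^2 * real r * 4 / \<kappa>\<rceil> + r + 1 \<le> T n) sequentially"
      and evN: "eventually (\<lambda>n. 1 \<le> N n) sequentially"
      using T N unfolding filterlim_at_top by blast+
    show "eventually (\<lambda>n. dist (prob {w \<in> space M. Ghat n w = \<G> n}) 1 < e) sequentially"
      using signal evD noise_gram_negligible[OF N T \<delta>, of "K * (2 * c3 ^ 4)" C3] evT evN
    proof eventually_elim
      case (elim n)
      interpret noise_matrix M "T n" "N n" "S n" C3 c3 "P1 n" "P2 n" "E n" by (rule noise_mat)
      let ?N = "real (N n)" and ?T = "real (T n)"
      have N0: "0 < N n" and T0: "0 < T n" and rT: "r \<le> T n" using elim by simp_all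
      have Tk: "K * c3^2 * real r * 4 / \<kappa> \<le> ?T" using elim(4) by linarith
      have mpos: "0 < m n" using N0 by (simp add: m_def less_max_iff_disj)
      let ?e1 = "sqrt (K * (c3^2 * (real r * ?N)))"
      let ?e2 = "sqrt (K * (2 * c3 ^ 4 * (\<beta>^2 * ?N) * (?N * ?T + C3 * ?T\<^sup>2)))"
      let ?e3 = "sqrt (K * (2 * c3 ^ 4 * ?N * (?N * ?T + C3 * ?T\<^sup>2)))"
      have e3: "?e3 \<le> \<delta> * ?N * ?T" using elim(3) by (simp add: mult.assoc)
      have F4: "integrable M (\<lambda>w. (F n w $$ (t,l)) ^ 4)" if "t < T n" "l < r" for t l using assms(13)[OF that] by simp
      have Fm: "(\<lambda>w. F n w $$ (t,l)) \<in> borel_measurable M" if "t < T n" "l < r" for t l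
        using assms(5)[of n] that by (simp add: random_mat_def)
      \<comment> \<open>\<open>D n\<close> involves \<open>d_sep\<close> of a random matrix. A set
        that is not measurable has measure 0 by convention, so its positive probability shows that
        it is an event.\<close>
      have D: "D n \<in> events" using elim(2) measure_notin_sets[of "D n" M] by force
      have "prob (D n) - 3 / K \<le> prob {w \<in> space M. Ghat n w = \<G> n}"
      proof (rule grouped_recovery_prob[OF N0 T0 assms(36) r rT c3 C3 \<kappa> \<beta> K assms(35) assms(5) _ _ assms(14) B B_le _ assms(8)
            assms(38) assms(9) assms(10) assms(11) assms(40) refl _ refl refl _ _ D])
        show "integrable M (\<lambda>w. (F n w $$ (t,l))^2)" if "t < T n" "l < r" for t l
          using square_integrable_imp_integrable[of "\<lambda>w. (F n w $$ (t,l))^2"] Fm[OF that] F4[OF that] by simp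
        show "expectation (\<lambda>w. (F n w $$ (t,l))^2) = 1" if "t < T n" "l < r" for t l
          using assms(13)[OF that] by simp
        show "\<kappa> * ?N * (euc_norm a)^2 \<le> (B n *\<^sub>v a) \<bullet> (D_inv (N n) (lam n) *\<^sub>v (B n *\<^sub>v a))" if "a \<in> carrier_vec r" for a
          using elim(1) that unfolding \<kappa>_def by blast
        show "?e1\<^sup>2 \<le> \<kappa> / 4 * ?N * ?T"
        proof -
          have "K * c3^2 * real r \<le> \<kappa> / 4 * ?T" using Tk \<kappa> by (simp add: field_simps)
          then have "(K * c3^2 * real r) * ?N \<le> (\<kappa> / 4 * ?T) * ?N" by (rule mult_right_mono) simp
          moreover have "?e1\<^sup>2 = (K * c3^2 * real r) * ?N" using K by simp
          ultimately show ?thesis by (simp add: mult_ac)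
        qed
        have "\<delta> * ?N * ?T \<le> \<kappa> / 8 * ?N * ?T" by (intro mult_right_mono) (simp_all add: \<delta>_def)
        then show "?e3 \<le> \<kappa> / 4 * ?N * ?T / 2" using e3 by simp
        have "real r * \<delta> \<le> real r * (3 * \<kappa> / (16 * real r))" by (intro mult_left_mono) (simp_all add: \<delta>_def)
        also have "\<dots> = 3 * \<kappa> / 16" using r by simp
        finally have "real r * \<delta> * (?N * ?T) \<le> 3 * \<kappa> / 16 * (?N * ?T)" by (rule mult_right_mono) simp
        then show "real r * ?e3 \<le> 3 / 4 * (\<kappa> / 4 * ?N * ?T)"
          using mult_left_mono[OF e3, of "real r"] by (simp add: mult_ac)
        show "{w \<in> space M. Ghat n w = \<G> n} \<in> events"
          using measurable_sets[OF assms(39), of "{\<G> n}" n] by (simp add: vimage_def Int_def conj_commute)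
        fix w assume w: "w \<in> D n"
        have md: "m n \<le> \<epsilon> * ?d n w" using w by (simp add: D_def)
        then have dpos: "0 < ?d n w" using mpos \<epsilon> by (meson less_le_trans zero_less_mult_pos)
        have "8 * real r * \<beta>^2 * (2 * (?e1 * \<beta> / sqrt (\<kappa> / 4)) + 2 * (?e2 / (\<kappa> / 4 * ?N * sqrt ?T))) / sqrt ?T \<le> c' * m n"
          unfolding c'_def m_def by (rule noise_rate[OF N0 T0 K c3 C3 \<beta> \<kappa>])
        also have "\<dots> \<le> c' * (\<epsilon> * ?d n w)" using md c' by (intro mult_left_mono) auto
        also have "\<dots> = \<kappa> / 8 * ?d n w" using c' by (simp add: \<epsilon>_def)
        also have "\<dots> < \<kappa> / 4 * ?d n w" using dpos \<kappa> by (intro mult_strict_right_mono) auto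
        finally show "8 * real r * \<beta>^2 * (2 * (?e1 * \<beta> / sqrt (\<kappa> / 4)) + 2 * (?e2 / (\<kappa> / 4 * ?N * sqrt ?T))) / sqrt ?T < \<kappa> / 4 * ?d n w" .
      qed
      moreover have "3 / K = e / 2" by (simp add: K_def)
      moreover have "prob {w \<in> space M. Ghat n w = \<G> n} \<le> 1" by (rule prob_le_1)
      ultimately show ?case using elim(2) by (simp add: dist_real_def)
    qed
  qed
qed

end
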